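(* Let $\alpha\ge0$ and consider $\tau_\alpha(x)=-\log(x^2+\alpha^2)$. (i) There exists a unique extremal minorant $l_\alpha$ of exponential type $2\pi$ for $\tau_\alpha$. The function $l_\alpha$ interpolates the values of $\tau_\alpha$ at $\mathbb{Z}+\frac12$ and satisfies $$\int_{-\infty}^\infty\{\tau_\alpha(x)-l_\alpha(x)\}\,dx=2\log\bigl(1+e^{-2\pi\alpha}\bigr).$$ (ii) If $0<\alpha$, there exists a unique extremal majorant $m_\alpha$ of exponential type $2\pi$ for $\tau_\alpha$. The function $m_\alpha$ interpolates the values of $\tau_\alpha$ at $\mathbb{Z}$ and satisfies $$\int_{-\infty}^\infty\{m_\alpha(x)-\tau_\alpha(x)\}\,dx=-2\log\bigl(1-e^{-2\pi\alpha}\bigr).$$ (iii) There exists a unique best approximation $k_\alpha$ of exponential type $\pi$ for $\tau_\alpha$. The function $k_\alpha$ interpolates the values of $\tau_\alpha$ at $\mathbb{Z}+\frac12$, satisfying $$\mathrm{sgn}(\cos\pi x)\{\tau_\alpha(x)-k_\alpha(x)\}\ge0$$ and $$\int_{-\infty}^\infty|\tau_\alpha(x)-k_\alpha(x)|\,dx=\int_0^\infty\Bigl\{\frac1\pi\sum_{n=-\infty}^\infty\frac{(-1)^n}{n+\frac12}\,\widehat{G}_\lambda\bigl(n+\tfrac12\bigr)\Bigr\}\frac{e^{-\pi\lambda\alpha^2}}{\lambda}\,d\lambda.$$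
   Context: For $\lambda>0$, $\widehat{G}_\lambda(t)=\lambda^{-1/2}e^{-\pi\lambda^{-1}t^2}$. An entire function $F$ is of exponential type (at most) $2\pi\delta$ if for every $\epsilon>0$ there is $C>0$ with $|F(z)|\le Ce^{(2\pi\delta+\epsilon)|z|}$ for all $z\in\mathbb{C}$. An extremal minorant (resp. majorant) of exponential type $2\pi$ for $g$ is an entire function $F$ of exponential type at most $2\pi$, real valued on $\mathbb{R}$, with $F(x)\le g(x)$ (resp. $F(x)\ge g(x)$) for all real $x$, minimizing $\int_{-\infty}^\infty|g(x)-F(x)|\,dx$ among all such functions. A best approximation of exponential type $\pi$ for $g$ is an entire function $F$ of exponential type at most $\pi$ minimizing $\int_{-\infty}^\infty|g(x)-F(x)|\,dx$ among all such functions. When $\alpha=0$, $\tau_0(0)=+\infty$, so pointwise inequalities at $x=0$ hold trivially (they are conditions at $x\ne0$). *)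

theory Defs
  imports "HOL-Complex_Analysis.Complex_Analysis"
begin

text \<open>
  An entire function of exponential type at most \<open>T\<close>. In the convention where the type
  is written \<open>2 * pi * \<delta>\<close>, take \<open>T = 2 * pi * \<delta>\<close>.
\<close>

definition entire_exp_type :: "real \<Rightarrow> (complex \<Rightarrow> complex) \<Rightarrow> bool" where
  "entire_exp_type T F \<longleftrightarrow>
     F holomorphic_on UNIV \<and>
     (\<forall>\<epsilon>>0. \<exists>C>0. \<forall>z. norm (F z) \<le> C * exp ((T + \<epsilon>) * norm z))"

definition real_on_reals :: "(complex \<Rightarrow> complex) \<Rightarrow> bool" where
  "real_on_reals F \<longleftrightarrow> (\<forall>x::real. F (of_real x) \<in> \<real>)"

text \<open>
  The target function may take infinite values, whereas the approximants may be complex valued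
  on the real line; hence the case distinction. The integral is an extended nonnegative number,
  so that approximants at infinite \<open>L\<^sup>1\<close>-distance also take part in the minimization.
\<close>

definition L1_dist :: "(real \<Rightarrow> ereal) \<Rightarrow> (complex \<Rightarrow> complex) \<Rightarrow> ennreal" where
  "L1_dist g F =
     (\<integral>\<^sup>+x. (if \<bar>g x\<bar> = \<infinity> then \<infinity>
            else ennreal (norm (of_real (real_of_ereal (g x)) - F (of_real x)))) \<partial>lborel)"

definition minorant :: "real \<Rightarrow> (real \<Rightarrow> ereal) \<Rightarrow> (complex \<Rightarrow> complex) \<Rightarrow> bool" where
  "minorant T g F \<longleftrightarrow>
     entire_exp_type T F \<and> real_on_reals F \<and> (\<forall>x. ereal (Re (F (of_real x))) \<le> g x)"

definition majorant :: "real \<Rightarrow> (real \<Rightarrow> ereal) \<Rightarrow> (complex \<Rightarrow> complex) \<Rightarrow> bool" where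
  "majorant T g F \<longleftrightarrow>
     entire_exp_type T F \<and> real_on_reals F \<and> (\<forall>x. g x \<le> ereal (Re (F (of_real x))))"

definition extremal_minorant :: "real \<Rightarrow> (real \<Rightarrow> ereal) \<Rightarrow> (complex \<Rightarrow> complex) \<Rightarrow> bool" where
  "extremal_minorant T g F \<longleftrightarrow>
     minorant T g F \<and> (\<forall>H. minorant T g H \<longrightarrow> L1_dist g F \<le> L1_dist g H)"

definition extremal_majorant :: "real \<Rightarrow> (real \<Rightarrow> ereal) \<Rightarrow> (complex \<Rightarrow> complex) \<Rightarrow> bool" where
  "extremal_majorant T g F \<longleftrightarrow>
     majorant T g F \<and> (\<forall>H. majorant T g H \<longrightarrow> L1_dist g F \<le> L1_dist g H)"

definition best_approximation :: "real \<Rightarrow> (real \<Rightarrow> ereal) \<Rightarrow> (complex \<Rightarrow> complex) \<Rightarrow> bool" where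
  "best_approximation T g F \<longleftrightarrow>
     entire_exp_type T F \<and> (\<forall>H. entire_exp_type T H \<longrightarrow> L1_dist g F \<le> L1_dist g H)"

definition interpolates_at :: "(complex \<Rightarrow> complex) \<Rightarrow> (real \<Rightarrow> ereal) \<Rightarrow> real set \<Rightarrow> bool" where
  "interpolates_at F g S \<longleftrightarrow>
     (\<forall>x\<in>S. F (of_real x) \<in> \<real> \<and> ereal (Re (F (of_real x))) = g x)"

text \<open>The value at \<open>x = 0\<close> for \<open>\<alpha> = 0\<close> has to be set separately because \<open>ln 0 = 0\<close> in HOL.\<close>

definition tau :: "real \<Rightarrow> real \<Rightarrow> ereal" where
  "tau \<alpha> x = (if x\<^sup>2 + \<alpha>\<^sup>2 = 0 then \<infinity> else ereal (- ln (x\<^sup>2 + \<alpha>\<^sup>2)))"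

text \<open>The Fourier transform of the Gaussian \<open>exp (- pi * \<lambda> * x\<^sup>2)\<close>, for \<open>\<lambda> > 0\<close>.\<close>

definition Ghat :: "real \<Rightarrow> real \<Rightarrow> real" where
  "Ghat l t = l powr (- 1 / 2) * exp (- pi * (1 / l) * t\<^sup>2)"

definition best_approx_integrand :: "real \<Rightarrow> real \<Rightarrow> real" where
  "best_approx_integrand \<alpha> l =
     (1 / pi * (\<Sum>\<^sub>\<infinity>n::int. (- 1) powi n / (of_int n + 1 / 2) * Ghat l (of_int n + 1 / 2)))
       * (exp (- pi * l * \<alpha>\<^sup>2) / l)"

end

theory Submission
  imports Defs "HOL-Probability.Probability" "HOL-Real_Asymp.Real_Asymp"
begin

text \<open>
  Up to an infinite constant, \<open>- ln (x\<^sup>2 + \<alpha>\<^sup>2)\<close> is the integral of \<open>2 * a / (x\<^sup>2 + a\<^sup>2)\<close> over \<open>a > \<alpha>\<close>. So it is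
  enough to treat the functions \<open>1 / (x\<^sup>2 + a\<^sup>2)\<close>, for which everything is explicit. Let \<open>\<phi> z\<close> be one of
  \<open>cos\<^sup>2 (pi * z)\<close>, \<open>- sin\<^sup>2 (pi * z)\<close> and \<open>cos (pi * z)\<close>. The quotient \<open>(\<phi> (\<i> * a) - \<phi> z) / (z\<^sup>2 + a\<^sup>2)\<close> is entire, because the
  even function \<open>\<phi>\<close> takes the same value at \<open>\<i> * a\<close> and \<open>- \<i> * a\<close>. Division by \<open>\<phi> (\<i> * a) > 0\<close> and integration
  against \<open>2 * a\<close>, with logarithmic renormalisation, give an entire function \<open>F\<close> of the type of \<open>\<phi>\<close> with
  \<open>- ln (x\<^sup>2 + \<alpha>\<^sup>2) - F x = \<phi> x * J x\<close>, where \<open>J x\<close> is the integral of \<open>2 * a / (\<phi> (\<i> * a) * (x\<^sup>2 + a\<^sup>2))\<close> and hence nonnegative.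
  So \<open>F\<close> interpolates at the zeros of \<open>\<phi>\<close>, and it is a minorant, a majorant, and an approximant whose error
  has the sign of \<open>cos (pi * x)\<close>, respectively. The locale \<open>log_interpolation\<close> contains this construction for
  all three cases at once.

  Optimality rests on one contour shift (\<open>exp_type_orthogonal_upper\<close>): an integrable entire function \<open>D\<close> of
  type \<open>T\<close> is orthogonal to every function that is holomorphic in the upper half-plane and decays like
  \<open>exp (- T * Im z)\<close> there. This needs the Phragmen-Lindelof bound \<open>M * exp (T * \<bar>Im z\<bar>)\<close> for \<open>D\<close>. Let \<open>D\<close> be the
  difference of \<open>F\<close> and a competitor \<open>H\<close> that is at least as good.

  In the one-sided problems (\<open>one_sided_extremal_unique\<close>), \<open>D\<close> is tested against Poisson kernels that
  concentrate at the interpolation points. As the error of \<open>F\<close> contains the factor \<open>cos\<^sup>2\<close> or \<open>sin\<^sup>2\<close>, its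
  integral against these kernels tends to \<open>0\<close> at the full rate, so that of \<open>H\<close> does, too, and Fatou's
  lemma yields the integrability of \<open>D / \<phi>\<close>. Therefore \<open>D / \<phi>\<close> is entire; it is bounded, hence constant,
  and integrable, hence \<open>0\<close>.

  In the two-sided problem (\<open>best_approximation_unique\<close>), \<open>D\<close> is orthogonal to \<open>sgn (cos (pi * x))\<close>, the
  limit of the real part of \<open>4 / pi * Arctan (r * exp (\<i> * pi * x))\<close> as \<open>r\<close> tends to \<open>1\<close>. This duality shows that \<open>H\<close> is not
  better than \<open>F\<close>, and that the error of an equally good \<open>H\<close> changes sign at the half-integers as well; so
  \<open>D\<close> vanishes there, \<open>D / cos (pi * z)\<close> is entire, bounded and constant, and \<open>D = 0\<close>.

  The values of the integrals follow from Tonelli's theorem and the Poisson formula for the upper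
  half-plane (\<open>poisson_formula_upper\<close>), which evaluates the integral of \<open>\<bar>\<phi> x\<bar> / (x\<^sup>2 + a\<^sup>2)\<close>. In the two-sided
  problem this leads to the integral of \<open>8 * arctan (exp (- pi * a))\<close> over \<open>a > \<alpha>\<close>. Its expansion into a series
  agrees with that of the integral over Gaussians, whose terms are masses of inverse Gaussian
  densities (\<open>has_bochner_integral_inverse_gaussian\<close>).
\<close>

section \<open>Entire functions of exponential type that are bounded or integrable on the real line\<close>

lemma frontier_cbox_complexD:
  assumes "z \<in> frontier (cbox a b)"
  shows "z \<in> cbox a b" "Re z = Re a \<or> Re z = Re b \<or> Im z = Im a \<or> Im z = Im b"
  using assms by (auto simp: frontier_cbox in_cbox_complex_iff in_box_complex_iff)

text \<open>
  The quadrant is the image of the strip \<open>0 \<le> Im s \<le> pi / 2\<close> under \<open>exp\<close>. In the strip the factor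
  \<open>exp (- \<delta> * exp (3/2 * (s - \<i> * pi / 4)))\<close> has modulus at most \<open>1\<close>, because
  \<open>3/2 * (Im s - pi / 4)\<close> stays in \<open>[- 3/8 * pi, 3/8 * pi]\<close>, and for large \<open>Re s\<close> it beats the growth
  \<open>exp (B * exp (Re s))\<close>, because \<open>3/2 > 1\<close>. So the maximum modulus principle applies on a long
  rectangle; then \<open>\<delta>\<close> tends to \<open>0\<close>. Working in the strip avoids fractional powers of \<open>z\<close>.
\<close>

lemma phragmen_lindelof_quadrant:
  fixes u :: "complex \<Rightarrow> complex"
  assumes hol: "u holomorphic_on UNIV"
    and growth: "\<And>z. norm (u z) \<le> A * exp (B * norm z)"
    and K1: "\<And>t. t \<ge> 0 \<Longrightarrow> norm (u (of_real t)) \<le> K"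
    and K2: "\<And>t. t \<ge> 0 \<Longrightarrow> norm (u (\<i> * of_real t)) \<le> K"
    and z: "Re z \<ge> 0" "Im z \<ge> 0"
  shows "norm (u z) \<le> K"
proof (cases "z = 0")
  case True
  with K1[of 0] show ?thesis by simp
next
  case False
  define s0 where "s0 = Ln z"
  have es0: "exp s0 = z" using False by (simp add: s0_def)
  have s0: "0 \<le> Im s0" "Im s0 \<le> pi / 2"
    using z False Im_Ln_pos_le[of z] Re_Ln_pos_le[of z] by (auto simp: s0_def)
  define c where "c = cos (3 * pi / 8)"
  have c: "c > 0" unfolding c_def by (rule cos_gt_zero) auto
  have A: "A \<ge> 0" using order_trans[OF norm_ge_zero growth[of 0]] by simp
  have K: "K \<ge> 0" using order_trans[OF norm_ge_zero K1[of 0]] by simp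
  have main: "norm (u z) * exp (- \<delta> * Re (exp (3/2 * (s0 - \<i> * of_real (pi/4))))) \<le> K + \<eta>"
    if \<delta>: "\<delta> > 0" and \<eta>: "\<eta> > 0" for \<delta> \<eta> :: real
  proof -
    \<comment> \<open>The slack \<open>\<eta>\<close> is for the left side of the rectangle, where \<open>u (exp s)\<close> is only close to \<open>u 0\<close>.\<close>
    define U where "U = (\<lambda>s. u (exp s) * exp (- of_real \<delta> * exp (3/2 * (s - \<i> * of_real (pi/4)))))"
    have normU: "norm (U s) = norm (u (exp s)) * exp (- \<delta> * Re (exp (3/2 * (s - \<i> * of_real (pi/4)))))" for s
      by (simp add: U_def norm_mult)
    have Rege: "Re (exp (3/2 * (s - \<i> * of_real (pi/4)))) \<ge> exp (3/2 * Re s) * c"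
      if "0 \<le> Im s" "Im s \<le> pi/2" for s
    proof -
      have "cos (3 * pi / 8) \<le> cos \<bar>3/2 * (Im s - pi/4)\<bar>"
        using that pi_ge_zero by (intro cos_monotone_0_pi_le) (auto simp: abs_le_iff field_simps)
      then have "c \<le> cos (3/2 * (Im s - pi/4))" unfolding c_def cos_abs_real .
      then show ?thesis by (simp add: Re_exp)
    qed
    have Ule: "norm (U s) \<le> norm (u (exp s))" if "0 \<le> Im s" "Im s \<le> pi/2" for s
    proof -
      have "Re (exp (3/2 * (s - \<i> * of_real (pi/4)))) \<ge> 0"
        using Rege[OF that] c by (smt (verit) exp_ge_zero mult_nonneg_nonneg)
      then have "exp (- \<delta> * Re (exp (3/2 * (s - \<i> * of_real (pi/4))))) \<le> 1"
        using \<delta> by simp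
      then show ?thesis unfolding normU by (intro mult_left_le) auto
    qed
    have "isCont u 0" using hol holomorphic_on_imp_continuous_on continuous_on_eq_continuous_at by blast
    then obtain r where r: "r > 0" "\<And>w. norm w < r \<Longrightarrow> norm (u w - u 0) < \<eta>"
      using \<eta> unfolding continuous_at_eps_delta by (force simp: dist_norm)
    have small: "norm (u w) \<le> K + \<eta>" if "norm w < r" for w
    proof -
      have "norm (u w) \<le> norm (u w - u 0) + norm (u 0)" by norm
      with r(2)[OF that] K1[of 0] show ?thesis by simp
    qed
    have "((\<lambda>L. A * exp (B * exp L - (\<delta> * c) * exp (3/2 * L))) \<longlongrightarrow> 0) at_top"
      using \<delta> c mult_pos_pos[OF \<delta> c] by real_asymp
    then have "eventually (\<lambda>L. A * exp (B * exp L - (\<delta> * c) * exp (3/2 * L)) < K + \<eta>) at_top"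
      using K \<eta> by (intro order_tendstoD(2)) auto
    moreover have "eventually (\<lambda>L. L > max \<bar>Re s0\<bar> (- ln r)) at_top" by (rule eventually_gt_at_top)
    ultimately have "eventually (\<lambda>L. A * exp (B * exp L - (\<delta> * c) * exp (3/2 * L)) < K + \<eta> \<and>
        L > max \<bar>Re s0\<bar> (- ln r)) at_top" by (rule eventually_conj)
    then obtain L where L: "A * exp (B * exp L - (\<delta> * c) * exp (3/2 * L)) < K + \<eta>"
        "L > \<bar>Re s0\<bar>" "L > - ln r"
      using eventually_happens[of _ at_top] by fastforce
    have "norm (U s0) \<le> K + \<eta>"
    proof (rule maximum_modulus_frontier[where f = U and \<xi> = s0 and S = "cbox (Complex (-L) 0) (Complex L (pi/2))"])
      have "(\<lambda>s. u (exp s)) holomorphic_on UNIV"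
        using holomorphic_on_compose_gen[OF holomorphic_on_exp hol] by (simp add: o_def)
      then have holU: "U holomorphic_on UNIV" unfolding U_def by (intro holomorphic_intros)
      then show "U holomorphic_on interior (cbox (Complex (- L) 0) (Complex L (pi / 2)))"
        using holomorphic_on_subset by blast
      show "continuous_on (closure (cbox (Complex (- L) 0) (Complex L (pi / 2)))) U"
        using holU holomorphic_on_imp_continuous_on continuous_on_subset by blast
      show "s0 \<in> cbox (Complex (- L) 0) (Complex L (pi / 2))"
        using s0 L by (auto simp: in_cbox_complex_iff)
      fix s assume "s \<in> frontier (cbox (Complex (- L) 0) (Complex L (pi / 2)))"
      note s = frontier_cbox_complexD[OF this]
      from s(1) have Ims: "0 \<le> Im s" "Im s \<le> pi/2" by (auto simp: in_cbox_complex_iff)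
      from s(2) consider "Re s = - L" | "Re s = L" | "Im s = 0" | "Im s = pi/2" by auto
      then show "norm (U s) \<le> K + \<eta>"
      proof cases
        case 1
        have "exp (- L) < r" using L(3) r(1) by (metis exp_less_mono exp_ln minus_less_iff)
        then have "norm (u (exp s)) \<le> K + \<eta>" using 1 by (intro small) simp
        with Ule[OF Ims] show ?thesis by linarith
      next
        case 2
        have "norm (U s) \<le> (A * exp (B * exp L)) * exp (- \<delta> * (exp (3/2 * L) * c))"
          unfolding normU
          using growth[of "exp s"] Rege[OF Ims] 2 \<delta> A by (intro mult_mono) auto
        also have "\<dots> = A * exp (B * exp L - (\<delta> * c) * exp (3/2 * L))"
          by (simp add: exp_diff exp_minus field_simps)
        finally show ?thesis using L(1) by linarith
      next
        case 3
        then have "exp s = of_real (exp (Re s))" by (simp add: exp_eq_polar)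
        with K1[of "exp (Re s)"] Ule[OF Ims] \<eta> show ?thesis by simp
      next
        case 4
        then have "cis (Im s) = \<i>" by (simp only: cis_pi_half)
        then have "exp s = \<i> * of_real (exp (Re s))" by (simp add: exp_eq_polar mult.commute)
        with K2[of "exp (Re s)"] Ule[OF Ims] \<eta> show ?thesis by simp
      qed
    qed simp
    then show ?thesis by (simp add: normU es0)
  qed
  have "norm (u z) \<le> K + \<eta>" if \<eta>: "\<eta> > 0" for \<eta>
  proof (rule tendsto_upperbound)
    show "((\<lambda>\<delta>. norm (u z) * exp (- \<delta> * Re (exp (3/2 * (s0 - \<i> * of_real (pi/4))))))
      \<longlongrightarrow> norm (u z)) (at_right 0)"
      by (rule tendsto_eq_intros refl | simp)+
    show "\<forall>\<^sub>F \<delta> in at_right 0. norm (u z) * exp (- \<delta> * Re (exp (3/2 * (s0 - \<i> * of_real (pi/4))))) \<le> K + \<eta>"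
      using eventually_at_right_less[of 0] by eventually_elim (use main \<eta> in auto)
  qed simp
  then show ?thesis by (rule field_le_epsilon)
qed

lemma norm_one_minus_i_mult_ge:
  assumes "\<delta> \<ge> 0" "Im z \<ge> 0"
  shows "norm (1 - \<i> * of_real \<delta> * z) \<ge> 1" "norm (1 - \<i> * of_real \<delta> * z) \<ge> \<delta> * norm z"
proof -
  have *: "(norm (1 - \<i> * of_real \<delta> * z))\<^sup>2 = (1 + \<delta> * Im z)\<^sup>2 + (\<delta> * Re z)\<^sup>2"
    by (simp add: cmod_power2)
  have "1\<^sup>2 \<le> (norm (1 - \<i> * of_real \<delta> * z))\<^sup>2"
    unfolding * using assms by (smt (verit) power_mono mult_nonneg_nonneg zero_le_power2 one_power2)
  then show "norm (1 - \<i> * of_real \<delta> * z) \<ge> 1" by (rule power2_le_imp_le) simp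
  have "(\<delta> * norm z)\<^sup>2 \<le> (norm (1 - \<i> * of_real \<delta> * z))\<^sup>2"
    unfolding * power_mult_distrib cmod_power2 using assms
    by (simp add: algebra_simps power2_eq_square)
  then show "norm (1 - \<i> * of_real \<delta> * z) \<ge> \<delta> * norm z" by (rule power2_le_imp_le) simp
qed

text \<open>
  Dividing \<open>u\<close> by \<open>1 - \<i> * \<delta> * z\<close>, which has modulus at least \<open>max 1 (\<delta> * norm z)\<close> in the half-plane, makes it
  tend to \<open>0\<close> at infinity, so that the maximum principle on a large rectangle sees only the real line.
\<close>

lemma phragmen_lindelof_bounded_half_plane:
  fixes u :: "complex \<Rightarrow> complex"
  assumes hol: "u holomorphic_on UNIV"
    and K: "\<And>z. Im z \<ge> 0 \<Longrightarrow> norm (u z) \<le> K"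
    and M: "\<And>x::real. norm (u (of_real x)) \<le> M"
    and z: "Im z \<ge> 0"
  shows "norm (u z) \<le> M"
proof -
  have M0: "M \<ge> 0" by (rule order_trans[OF norm_ge_zero M[of 0]])
  have K0: "K \<ge> 0" by (rule order_trans[OF norm_ge_zero K[of 0]]) simp
  have main: "norm (u z) \<le> (M + \<eta>) * norm (1 - \<i> * of_real \<delta> * z)" if \<delta>: "\<delta> > 0" and \<eta>: "\<eta> > 0" for \<delta> \<eta> :: real
  proof -
    define v where "v = (\<lambda>z. u z / (1 - \<i> * of_real \<delta> * z))"
    define R where "R = norm z + K / (\<delta> * \<eta>) + 1"
    have R: "R > norm z" "R > 0" "K / (\<delta> * R) \<le> \<eta>"
    proof -
      have "K / (\<delta> * \<eta>) \<ge> 0" using \<delta> \<eta> K0 by simp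
      then show "R > norm z" "R > 0" by (auto simp: R_def add_nonneg_pos)
      moreover have "K \<le> \<delta> * \<eta> * R"
      proof -
        have "K = \<delta> * \<eta> * (K / (\<delta> * \<eta>))" using \<delta> \<eta> by simp
        also have "\<dots> \<le> \<delta> * \<eta> * R" unfolding R_def using \<delta> \<eta> by (intro mult_left_mono) auto
        finally show ?thesis .
      qed
      ultimately show "K / (\<delta> * R) \<le> \<eta>" using \<delta> by (simp add: field_simps)
    qed
    have nz: "1 - \<i> * of_real \<delta> * w \<noteq> 0" if "Im w \<ge> 0" for w
      using norm_one_minus_i_mult_ge(1)[of \<delta> w] that \<delta> by auto
    have "norm (v z) \<le> M + \<eta>"
    proof (rule maximum_modulus_frontier[where f = v and \<xi> = z and S = "cbox (Complex (-R) 0) (Complex R R)"])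
      have holv: "v holomorphic_on {w. Im w \<ge> 0}" unfolding v_def
        by (intro holomorphic_intros holomorphic_on_subset[OF hol]) (use nz in auto)
      have sub: "cbox (Complex (-R) 0) (Complex R R) \<subseteq> {w. Im w \<ge> 0}" by (auto simp: in_cbox_complex_iff)
      show "v holomorphic_on interior (cbox (Complex (- R) 0) (Complex R R))"
        by (rule holomorphic_on_subset[OF holv order_trans[OF interior_subset sub]])
      show "continuous_on (closure (cbox (Complex (- R) 0) (Complex R R))) v"
        by (rule continuous_on_subset[OF holomorphic_on_imp_continuous_on[OF holv]])
           (use sub in \<open>simp add: closure_closed\<close>)
      show "z \<in> cbox (Complex (- R) 0) (Complex R R)"
        using z R abs_Re_le_cmod[of z] abs_Im_le_cmod[of z] by (auto simp: in_cbox_complex_iff)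
      fix s assume "s \<in> frontier (cbox (Complex (- R) 0) (Complex R R))"
      note s = frontier_cbox_complexD[OF this]
      from s(1) have Ims: "0 \<le> Im s" by (auto simp: in_cbox_complex_iff)
      note ge = norm_one_minus_i_mult_ge[OF less_imp_le[OF \<delta>] Ims]
      show "norm (v s) \<le> M + \<eta>"
      proof (cases "Im s = 0")
        case True
        then have "s = of_real (Re s)" by (simp add: complex_eq_iff)
        then have "norm (u s) \<le> M" using M[of "Re s"] by simp
        also have "M \<le> M * norm (1 - \<i> * of_real \<delta> * s)" using ge(1) M0
          by (simp add: mult_left_le mult_le_cancel_left1)
        finally have "norm (v s) \<le> M" unfolding v_def norm_divide using ge(1)
          by (subst divide_le_eq) auto
        then show ?thesis using \<eta> by simp
      next
        case False
        with s(2) have "\<bar>Re s\<bar> = R \<or> \<bar>Im s\<bar> = R" using R(2) by auto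
        then have "norm s \<ge> R" using abs_Re_le_cmod[of s] abs_Im_le_cmod[of s] by auto
        then have "norm (1 - \<i> * of_real \<delta> * s) \<ge> \<delta> * R" using ge(2) \<delta>
          by (meson mult_left_mono order_trans less_imp_le)
        then have "norm (v s) \<le> K / (\<delta> * R)" unfolding v_def norm_divide
          using K[OF Ims] \<delta> R K0 by (intro frac_le) auto
        then show ?thesis using R M0 by simp
      qed
    qed simp
    then show ?thesis unfolding v_def norm_divide
      using nz[OF z] by (simp add: divide_le_eq)
  qed
  have "norm (u z) \<le> M + \<eta>" if \<eta>: "\<eta> > 0" for \<eta>
  proof (rule tendsto_lowerbound)
    show "((\<lambda>\<delta>. (M + \<eta>) * norm (1 - \<i> * of_real \<delta> * z)) \<longlongrightarrow> M + \<eta>) (at_right 0)"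
      by (rule tendsto_eq_intros refl | simp)+
    show "\<forall>\<^sub>F \<delta> in at_right 0. norm (u z) \<le> (M + \<eta>) * norm (1 - \<i> * of_real \<delta> * z)"
      using eventually_at_right_less[of 0] by eventually_elim (use main \<eta> in auto)
  qed simp
  then show ?thesis by (rule field_le_epsilon)
qed

lemma entire_exp_typeD:
  assumes "entire_exp_type T F"
  shows "F holomorphic_on UNIV" "\<And>\<epsilon>. \<epsilon> > 0 \<Longrightarrow> \<exists>C>0. \<forall>z. norm (F z) \<le> C * exp ((T + \<epsilon>) * norm z)"
  using assms by (auto simp: entire_exp_type_def)

lemma continuous_on_entire_of_real:
  fixes F :: "complex \<Rightarrow> complex"
  assumes "F holomorphic_on UNIV"
  shows "continuous_on A (\<lambda>x::real. F (of_real x))"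
  by (rule continuous_on_compose2[OF holomorphic_on_imp_continuous_on[OF assms]]) (auto intro: continuous_intros)

lemma isCont_entire_of_real:
  fixes F :: "complex \<Rightarrow> complex"
  assumes "F holomorphic_on UNIV"
  shows "isCont (\<lambda>x::real. F (of_real x)) x"
  using continuous_on_entire_of_real[OF assms, of UNIV] by (simp add: continuous_on_eq_continuous_at)

lemma borel_measurable_entire_of_real:
  fixes F :: "complex \<Rightarrow> complex"
  assumes "F holomorphic_on UNIV"
  shows "(\<lambda>x::real. F (of_real x)) \<in> borel_measurable borel"
  by (rule borel_measurable_continuous_onI[OF continuous_on_entire_of_real[OF assms]])

text \<open>
  The function \<open>F z * exp (\<i> * (T + \<epsilon>) * z)\<close> is bounded by \<open>M\<close> on the real line and bounded on the positive
  imaginary axis, hence bounded in both quadrants. Being bounded in the half-plane it is bounded there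
  by its bound \<open>M\<close> on the real line, so that the constant does not depend on \<open>\<epsilon>\<close>.
\<close>

lemma exp_type_bounded_upper:
  assumes F: "entire_exp_type T F" and M: "\<And>x::real. norm (F (of_real x)) \<le> M" and z: "Im z \<ge> 0"
  shows "norm (F z) \<le> M * exp (T * Im z)"
proof -
  note hol = entire_exp_typeD(1)[OF F]
  have main: "norm (F z) \<le> M * exp ((T + \<epsilon>) * Im z)" if \<epsilon>: "\<epsilon> > 0" for \<epsilon>
  proof -
    obtain C where C: "C > 0" "\<And>z. norm (F z) \<le> C * exp ((T + \<epsilon>) * norm z)"
      using entire_exp_typeD(2)[OF F \<epsilon>] by blast
    define u where "u = (\<lambda>z. F z * exp (\<i> * of_real (T + \<epsilon>) * z))"
    have norm_u: "norm (u z) = norm (F z) * exp (- (T + \<epsilon>) * Im z)" for z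
      by (simp add: u_def norm_mult algebra_simps)
    have hu: "u holomorphic_on UNIV" unfolding u_def by (intro holomorphic_intros hol)
    have growth: "norm (u z) \<le> C * exp ((2 * \<bar>T + \<epsilon>\<bar>) * norm z)" for z
    proof -
      have "- (T + \<epsilon>) * Im z \<le> \<bar>T + \<epsilon>\<bar> * norm z"
      proof -
        have "- (T + \<epsilon>) * Im z \<le> \<bar>- (T + \<epsilon>) * Im z\<bar>" by (rule abs_ge_self)
        also have "\<dots> \<le> \<bar>T + \<epsilon>\<bar> * norm z" unfolding abs_mult abs_minus_cancel
          by (intro mult_left_mono abs_Im_le_cmod) auto
        finally show ?thesis .
      qed
      moreover have "norm (F z) \<le> C * exp (\<bar>T + \<epsilon>\<bar> * norm z)"
        using C(1) by (intro order_trans[OF C(2)[of z]]) (simp add: mult_right_mono)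
      ultimately have "norm (u z) \<le> (C * exp (\<bar>T + \<epsilon>\<bar> * norm z)) * exp (\<bar>T + \<epsilon>\<bar> * norm z)"
        unfolding norm_u using C(1) by (intro mult_mono) auto
      then show ?thesis by (simp add: mult_ac flip: exp_add)
    qed
    define K where "K = max M C"
    have real: "norm (u (of_real t)) \<le> K" for t
      using M[of t] by (simp add: norm_u K_def)
    have imag: "norm (u (\<i> * of_real t)) \<le> K" if "t \<ge> 0" for t
    proof -
      have "norm (u (\<i> * of_real t)) \<le> C * exp ((T + \<epsilon>) * t) * exp (- (T + \<epsilon>) * t)"
        unfolding norm_u using C(2)[of "\<i> * of_real t"] that
        by (intro mult_mono) (use C(1) in \<open>auto simp: norm_mult\<close>)
      also have "\<dots> = C" by (simp add: mult.assoc algebra_simps flip: exp_add)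
      finally show ?thesis by (simp add: K_def)
    qed
    have bdd: "norm (u z) \<le> K" if z: "Im z \<ge> 0" for z
    proof (cases "Re z \<ge> 0")
      case True
      show ?thesis by (rule phragmen_lindelof_quadrant[OF hu growth]) (use real imag True z in auto)
    next
      case False
      define v where "v = (\<lambda>z. u (\<i> * z))"
      have "norm (v (z / \<i>)) \<le> K"
      proof (rule phragmen_lindelof_quadrant[where u = v and z = "z / \<i>"])
        show "v holomorphic_on UNIV" unfolding v_def
          using holomorphic_on_compose_gen[OF _ hu, of "\<lambda>z. \<i> * z" UNIV]
          by (simp add: o_def holomorphic_intros)
        show "norm (v z) \<le> C * exp ((2 * \<bar>T + \<epsilon>\<bar>) * norm z)" for z
          using growth[of "\<i> * z"] by (simp add: v_def norm_mult)
        show "norm (v (of_real t)) \<le> K" if "t \<ge> 0" for t using imag[OF that] by (simp add: v_def)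
        show "norm (v (\<i> * of_real t)) \<le> K" if "t \<ge> 0" for t
          using real[of "- t"] by (simp add: v_def flip: mult.assoc)
      qed (use z False in auto)
      then show ?thesis by (simp add: v_def)
    qed
    have "norm (u z) \<le> M"
      by (rule phragmen_lindelof_bounded_half_plane[OF hu bdd _ z]) (use M in \<open>auto simp: norm_u\<close>)
    then have "norm (F z) * exp (- (T + \<epsilon>) * Im z) * exp ((T + \<epsilon>) * Im z) \<le> M * exp ((T + \<epsilon>) * Im z)"
      unfolding norm_u by (rule mult_right_mono) simp
    then show ?thesis by (simp add: mult.assoc algebra_simps flip: exp_add)
  qed
  show ?thesis
  proof (rule tendsto_lowerbound)
    show "((\<lambda>\<epsilon>. M * exp ((T + \<epsilon>) * Im z)) \<longlongrightarrow> M * exp (T * Im z)) (at_right 0)"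
      by (rule tendsto_eq_intros refl | simp)+
    show "\<forall>\<^sub>F \<epsilon> in at_right 0. norm (F z) \<le> M * exp ((T + \<epsilon>) * Im z)"
      using eventually_at_right_less[of 0] by eventually_elim (use main in auto)
  qed simp
qed

lemma entire_exp_type_reflect:
  assumes "entire_exp_type T F"
  shows "entire_exp_type T (\<lambda>z. F (- z))"
proof -
  note d = entire_exp_typeD[OF assms]
  have "(\<lambda>z. F (- z)) holomorphic_on UNIV"
    using holomorphic_on_compose_gen[OF _ d(1), of "\<lambda>z. - z" UNIV]
    by (simp add: o_def holomorphic_intros)
  moreover have "\<exists>C>0. \<forall>z. norm (F (- z)) \<le> C * exp ((T + \<epsilon>) * norm z)" if "\<epsilon> > 0" for \<epsilon>
    using d(2)[OF that] by (metis norm_minus_cancel)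
  ultimately show ?thesis by (auto simp: entire_exp_type_def)
qed

lemma exp_type_bounded_on_reals:
  assumes F: "entire_exp_type T F" and M: "\<And>x::real. norm (F (of_real x)) \<le> M"
  shows "norm (F z) \<le> M * exp (T * \<bar>Im z\<bar>)"
proof (cases "Im z \<ge> 0")
  case True
  then show ?thesis using exp_type_bounded_upper[OF F M] by simp
next
  case False
  then have "norm (F (- (- z))) \<le> M * exp (T * Im (- z))"
    by (intro exp_type_bounded_upper[OF entire_exp_type_reflect[OF F]]) (use M in \<open>auto simp flip: of_real_minus\<close>)
  then show ?thesis using False by simp
qed

text \<open>
  A primitive of \<open>F\<close> is again of type \<open>T\<close>, and it is bounded on the real line by the \<open>L\<^sup>1\<close>-norm of \<open>F\<close>. The
  Phragmen-Lindelof bound for the primitive passes to its derivative \<open>F\<close> by Cauchy's inequality on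
  discs of radius \<open>1\<close>.
\<close>

lemma integrable_exp_type_bound:
  assumes F: "entire_exp_type T F" and int: "integrable lborel (\<lambda>x. F (of_real x))" and T: "T \<ge> 0"
  obtains M where "\<And>z. norm (F z) \<le> M * exp (T * \<bar>Im z\<bar>)"
proof -
  note hol = entire_exp_typeD(1)[OF F]
  obtain P0 where "\<And>x. x \<in> UNIV \<Longrightarrow> (P0 has_field_derivative F x) (at x within UNIV)"
    using holomorphic_convex_primitive'[of UNIV F] hol by (metis convex_UNIV open_UNIV)
  then have P0: "\<And>x. (P0 has_field_derivative F x) (at x)" by simp
  define P where "P = (\<lambda>z. P0 z - P0 0)"
  have P: "(P has_field_derivative F z) (at z)" for z
    unfolding P_def by (rule derivative_eq_intros P0 refl | simp)+
  have P00: "P 0 = 0" by (simp add: P_def)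
  have holP: "P holomorphic_on UNIV"
    unfolding holomorphic_on_def using P field_differentiable_def by fastforce
  define I where "I = (LINT x|lborel. norm (F (of_real x)))"
  have incr: "norm (P (of_real b) - P (of_real a)) \<le> I" if ab: "a \<le> b" for a b :: real
  proof -
    have "(LINT x|lborel. indicator {a..b} x *\<^sub>R F (of_real x)) = P (of_real b) - P (of_real a)"
    proof (rule integral_FTC_atLeastAtMost[OF ab])
      show "((\<lambda>x. P (of_real x)) has_vector_derivative F (of_real x)) (at x within {a..b})" for x
        using has_vector_derivative_real_field[OF P] has_vector_derivative_at_within by blast
      show "continuous_on {a..b} (\<lambda>x. F (of_real x))" by (rule continuous_on_entire_of_real[OF hol])
    qed
    moreover have "norm (LINT x|lborel. indicator {a..b} x *\<^sub>R F (of_real x)) \<le>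
        (LINT x|lborel. norm (indicator {a..b} x *\<^sub>R F (of_real x)))" by (rule integral_norm_bound)
    moreover have "(LINT x|lborel. norm (indicator {a..b} x *\<^sub>R F (of_real x))) \<le> I"
      unfolding I_def
    proof (rule integral_mono)
      show "integrable lborel (\<lambda>x. norm (indicator {a..b} x *\<^sub>R F (of_real x)))"
        by (intro integrable_norm integrable_mult_indicator int) auto
    qed (use int in \<open>auto simp: indicator_def\<close>)
    ultimately show ?thesis by simp
  qed
  have Preal: "norm (P (of_real x)) \<le> I" for x
    using incr[of 0 x] incr[of x 0] P00 by (cases "x \<ge> 0") auto
  have Ptype: "entire_exp_type T P" unfolding entire_exp_type_def
  proof (intro conjI holP allI impI)
    fix \<epsilon> :: real assume \<epsilon>: "\<epsilon> > 0"
    then obtain C where C: "C > 0" "\<And>z. norm (F z) \<le> C * exp ((T + \<epsilon>/2) * norm z)"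
      using entire_exp_typeD(2)[OF F, of "\<epsilon>/2"] by auto
    have "norm (P z) \<le> (2 * C / \<epsilon>) * exp ((T + \<epsilon>) * norm z)" for z
    proof -
      have "norm (P z - P 0) \<le> (C * exp ((T + \<epsilon>/2) * norm z)) * norm (z - 0)"
      proof (rule field_differentiable_bound[of "cball 0 (norm z)"])
        fix w :: complex assume "w \<in> cball 0 (norm z)"
        then have "(T + \<epsilon>/2) * norm w \<le> (T + \<epsilon>/2) * norm z" using T \<epsilon> by (intro mult_left_mono) auto
        then show "norm (F w) \<le> C * exp ((T + \<epsilon>/2) * norm z)"
          using C(2)[of w] C(1) by (smt (verit) exp_le_cancel_iff mult_le_cancel_left_pos)
      qed (auto intro: has_field_derivative_at_within[OF P])
      also have "norm (z - 0) \<le> 2 / \<epsilon> * exp (\<epsilon> / 2 * norm z)"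
        using exp_ge_add_one_self[of "\<epsilon> / 2 * norm z"] \<epsilon> by (simp add: field_simps)
      finally have "norm (P z) \<le>
          (C * exp ((T + \<epsilon>/2) * norm z)) * (2 / \<epsilon> * exp (\<epsilon> / 2 * norm z))"
        using C(1) by (simp add: P00 mult_left_mono)
      also have "\<dots> = (2 * C / \<epsilon>) * (exp ((T + \<epsilon>/2) * norm z) * exp (\<epsilon> / 2 * norm z))"
        by simp
      also have "exp ((T + \<epsilon>/2) * norm z) * exp (\<epsilon> / 2 * norm z) = exp ((T + \<epsilon>) * norm z)"
        unfolding exp_add[symmetric] by (rule arg_cong[of _ _ exp]) (simp add: field_simps)
      finally show ?thesis .
    qed
    then show "\<exists>C>0. \<forall>z. norm (P z) \<le> C * exp ((T + \<epsilon>) * norm z)"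
      using C(1) \<epsilon> by (intro exI[of _ "2 * C / \<epsilon>"]) auto
  qed
  have "norm (F z) \<le> (I * exp T) * exp (T * \<bar>Im z\<bar>)" for z
  proof -
    have "norm ((deriv ^^ 1) P z) \<le> fact 1 * (I * exp (T * (\<bar>Im z\<bar> + 1))) / 1 ^ 1"
    proof (rule Cauchy_inequality)
      show "continuous_on (cball z 1) P" using holP holomorphic_on_imp_continuous_on continuous_on_subset by blast
      fix w assume w: "norm (z - w) = 1"
      have "\<bar>Im w\<bar> \<le> \<bar>Im z\<bar> + 1" using abs_Im_le_cmod[of "z - w"] w by auto
      then have "exp (T * \<bar>Im w\<bar>) \<le> exp (T * (\<bar>Im z\<bar> + 1))" using T by (simp add: mult_left_mono)
      moreover have "I \<ge> 0" by (rule order_trans[OF norm_ge_zero Preal[of 0]])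
      ultimately show "norm (P w) \<le> I * exp (T * (\<bar>Im z\<bar> + 1))"
        using exp_type_bounded_on_reals[OF Ptype Preal, of w] by (meson mult_left_mono order_trans)
    qed (use holP holomorphic_on_subset in auto)
    moreover have "deriv P z = F z" using P DERIV_imp_deriv by blast
    ultimately show ?thesis by (simp add: distrib_left exp_add mult_ac)
  qed
  then show thesis by (rule that)
qed

section \<open>Integrals over the real line of functions holomorphic in the upper half-plane\<close>

text \<open>
  Close the interval \<open>[- n, n]\<close> by a half-circle: it contributes at most \<open>(K / n\<^sup>2) * n * pi\<close>.
\<close>

lemma line_integral_eq_0_if_quadratic_decay:
  fixes V :: "complex \<Rightarrow> complex"
  assumes hol: "V holomorphic_on {z. Im z > - c}" and c: "c > 0"
    and decay: "\<And>z. Im z \<ge> 0 \<Longrightarrow> norm z \<ge> R0 \<Longrightarrow> norm (V z) \<le> K / (norm z)\<^sup>2"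
    and int: "integrable lborel (\<lambda>x. V (of_real x))"
  shows "(LINT x|lborel. V (of_real x)) = 0"
proof -
  define I where "I = (\<lambda>n::nat. LINT x|lborel. indicator {- real n..real n} x *\<^sub>R V (of_real x))"
  have "I \<longlonglongrightarrow> (LINT x|lborel. V (of_real x))" unfolding I_def
  proof (rule integral_dominated_convergence)
    show "integrable lborel (\<lambda>x. norm (V (of_real x)))" using int by simp
    show "AE x in lborel. (\<lambda>n. indicat_real {- real n..real n} x *\<^sub>R V (of_real x)) \<longlonglongrightarrow> V (of_real x)"
    proof (intro AE_I2 tendsto_eventually)
      fix x :: real
      show "\<forall>\<^sub>F n in sequentially. indicat_real {- real n..real n} x *\<^sub>R V (of_real x) = V (of_real x)"
        using eventually_ge_at_top[of "nat \<lceil>\<bar>x\<bar>\<rceil>"]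
      proof eventually_elim
        case (elim n)
        then have "\<bar>x\<bar> \<le> real n" by linarith
        then show ?case by (auto simp: indicator_def abs_le_iff)
      qed
    qed
    show "AE x in lborel. norm (indicat_real {- real n..real n} x *\<^sub>R V (of_real x)) \<le> norm (V (of_real x))" for n
      by (auto simp: indicator_def)
  qed (use int in \<open>auto intro: borel_measurable_integrable\<close>)
  moreover have "I \<longlonglongrightarrow> 0"
  proof (rule Lim_null_comparison)
    show "\<forall>\<^sub>F n in sequentially. norm (I n) \<le> \<bar>K\<bar> * pi / real n"
      using eventually_ge_at_top[of "nat \<lceil>\<bar>R0\<bar>\<rceil> + 1"]
    proof eventually_elim
      case (elim n)
      then have n: "real n \<ge> R0" "n > 0" by linarith+
      let ?S = "{z. Im z > - c}"
      let ?g1 = "linepath (- of_real (real n)) (of_real (real n) :: complex)"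
      let ?g2 = "part_circlepath 0 (real n) 0 pi"
      have cvx: "convex ?S" by (simp add: convex_halfspace_Im_gt)
      have cont: "continuous_on ?S V" using hol by (rule holomorphic_on_imp_continuous_on)
      have sub1: "path_image ?g1 \<subseteq> ?S"
        using c by (auto simp: in_segment)
      have im2: "Im z \<ge> 0 \<and> norm z = real n" if "z \<in> path_image ?g2" for z
        using that n by (auto simp: path_image_part_circlepath' closed_segment_eq_real_ivl norm_mult sin_ge_zero)
      then have sub2: "path_image ?g2 \<subseteq> ?S" using c by fastforce
      have ci1: "V contour_integrable_on ?g1" and ci2: "V contour_integrable_on ?g2"
        by (intro contour_integrable_holomorphic_simple[OF hol] sub1 sub2 valid_path_linepath
            valid_path_part_circlepath open_halfspace_Im_gt)+
      have "(V has_contour_integral 0) (?g1 +++ ?g2)"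
        by (rule Cauchy_theorem_convex_simple[OF hol cvx])
           (use sub1 sub2 in \<open>auto intro!: valid_path_join simp: path_image_join exp_pi_i'\<close>)
      then have "contour_integral ?g1 V + contour_integral ?g2 V = 0"
        using ci1 ci2 by (metis contour_integral_join contour_integral_unique valid_path_linepath
            valid_path_part_circlepath)
      then have eq: "contour_integral ?g1 V = - contour_integral ?g2 V" by (simp add: eq_neg_iff_add_eq_0)
      have "norm (contour_integral ?g2 V) \<le> (\<bar>K\<bar> / (real n)\<^sup>2) * real n * \<bar>pi - 0\<bar>"
      proof (rule contour_integral_bound_part_circlepath[OF ci2])
        fix z assume "z \<in> path_image ?g2"
        with im2 have z: "Im z \<ge> 0" "norm z = real n" by auto
        then have "norm (V z) \<le> K / (real n)\<^sup>2" using decay[of z] n by simp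
        also have "\<dots> \<le> \<bar>K\<bar> / (real n)\<^sup>2" by (intro divide_right_mono) auto
        finally show "norm (V z) \<le> \<bar>K\<bar> / (real n)\<^sup>2" .
      qed auto
      also have "\<dots> = \<bar>K\<bar> * pi / real n" using n by (simp add: power2_eq_square)
      finally have bd: "norm (contour_integral ?g1 V) \<le> \<bar>K\<bar> * pi / real n"
        unfolding eq norm_minus_cancel .
      have "contour_integral ?g1 V = integral {- real n..real n} (\<lambda>x. V (of_real x))"
        using n by (subst contour_integral_linepath_Reals_eq) auto
      also have "\<dots> = (LINT x:{- real n..real n}|lborel. V (of_real x))"
        by (rule set_borel_integral_eq_integral(2)[symmetric])
           (simp add: set_integrable_def integrable_mult_indicator int)
      also have "\<dots> = I n" by (simp add: I_def set_lebesgue_integral_def)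
      finally show ?case using bd by simp
    qed
    show "(\<lambda>n. \<bar>K\<bar> * pi / real n) \<longlonglongrightarrow> 0" by real_asymp
  qed
  ultimately show ?thesis by (rule LIMSEQ_unique)
qed

text \<open>
  The product \<open>D * U\<close> is bounded in the upper half-plane, as the growth \<open>exp (T * Im z)\<close> of \<open>D\<close> is cancelled by
  the decay of \<open>U\<close>. The factor \<open>1 / (1 - \<i> * \<eta> * z)\<^sup>2\<close>, whose pole lies in the lower half-plane, supplies the
  quadratic decay for the contour argument; it is bounded by \<open>1\<close> on the real line and tends to \<open>1\<close>
  with \<open>\<eta>\<close>, so that it disappears by dominated convergence. In Fourier terms, the transform of \<open>D\<close> is
  supported in \<open>[- T, T]\<close> and vanishes at the end points too.
\<close>

lemma exp_type_orthogonal_upper: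
  fixes D U :: "complex \<Rightarrow> complex"
  assumes D: "entire_exp_type T D" and T: "T \<ge> 0" and int: "integrable lborel (\<lambda>x. D (of_real x))"
    and U: "U holomorphic_on {z. Im z > - c}" and c: "c > 0"
    and bd: "\<And>z. Im z \<ge> 0 \<Longrightarrow> norm (U z) \<le> K * exp (- T * Im z)"
  shows "integrable lborel (\<lambda>x. D (of_real x) * U (of_real x))"
    and "(LINT x|lborel. D (of_real x) * U (of_real x)) = 0"
proof -
  obtain M where M: "\<And>z. norm (D z) \<le> M * exp (T * \<bar>Im z\<bar>)"
    using integrable_exp_type_bound[OF D int T] by blast
  have M0: "M \<ge> 0" using order_trans[OF norm_ge_zero M[of 0]] by simp
  have K0: "K \<ge> 0" using order_trans[OF norm_ge_zero bd[of 0]] by simp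
  have UK: "norm (U (of_real x)) \<le> K" for x using bd[of "of_real x"] by simp
  have contU: "continuous_on UNIV (\<lambda>x. U (of_real x :: complex))"
    by (intro continuous_on_compose2[OF holomorphic_on_imp_continuous_on[OF U]] continuous_intros)
       (use c in auto)
  then have mU [measurable]: "(\<lambda>x. U (of_real x)) \<in> borel_measurable borel"
    by (rule borel_measurable_continuous_onI)
  have mD [measurable]: "(\<lambda>x. D (of_real x)) \<in> borel_measurable borel"
    using int borel_measurable_integrable by fastforce
  have int_bd: "integrable lborel (\<lambda>x. D (of_real x) * (U (of_real x) * W x))"
    if [measurable]: "W \<in> borel_measurable borel" and W: "\<And>x. norm (W x) \<le> 1" for W :: "real \<Rightarrow> complex"
  proof (rule Bochner_Integration.integrable_bound)
    show "integrable lborel (\<lambda>x. K *\<^sub>R norm (D (of_real x)))" using int by simp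
    show "AE x in lborel. norm (D (of_real x) * (U (of_real x) * W x)) \<le> norm (K *\<^sub>R norm (D (of_real x)))"
    proof (rule AE_I2)
      fix x
      have "norm (U (of_real x)) * norm (W x) \<le> K * 1" using UK W K0 by (intro mult_mono) auto
      then show "norm (D (of_real x) * (U (of_real x) * W x)) \<le> norm (K *\<^sub>R norm (D (of_real x)))"
        using K0 by (simp add: norm_mult abs_mult mult.commute[of K] mult_left_mono)
    qed
  qed measurable
  show intDU: "integrable lborel (\<lambda>x. D (of_real x) * U (of_real x))"
    using int_bd[of "\<lambda>_. 1"] by simp
  define w where "w = (\<lambda>\<eta> z. 1 / (1 - \<i> * of_real \<eta> * z)\<^sup>2 :: complex)"
  have w1: "norm (w \<eta> z) \<le> 1" if "\<eta> \<ge> 0" "Im z \<ge> 0" for \<eta> z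
    using norm_one_minus_i_mult_ge(1)[OF that] by (simp add: w_def norm_divide norm_power divide_le_eq one_le_power)
  \<comment> \<open>For \<open>\<eta> \<le> 1 / c\<close> the pole \<open>- \<i> / \<eta>\<close> of the factor is outside of the domain of \<open>U\<close>.\<close>
  have zero: "(LINT x|lborel. D (of_real x) * (U (of_real x) * w \<eta> (of_real x))) = 0"
    if \<eta>: "\<eta> > 0" "\<eta> \<le> 1 / c" for \<eta>
  proof (rule line_integral_eq_0_if_quadratic_decay[OF _ c])
    have nz: "1 - \<i> * of_real \<eta> * z \<noteq> 0" if "Im z > - c" for z
    proof
      assume "1 - \<i> * of_real \<eta> * z = 0"
      then have "Re (1 - \<i> * of_real \<eta> * z) = 0" by simp
      then have "\<eta> * Im z = -1" by simp
      moreover have "\<eta> * Im z > \<eta> * (- c)" using that \<eta> by (intro mult_strict_left_mono) auto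
      moreover have "\<eta> * c \<le> 1" using \<eta> c by (simp add: field_simps)
      ultimately show False by simp
    qed
    show "(\<lambda>z. D z * (U z * w \<eta> z)) holomorphic_on {z. Im z > - c}"
      unfolding w_def using nz
      by (intro holomorphic_intros U holomorphic_on_subset[OF entire_exp_typeD(1)[OF D]]) auto
    show "norm (D z * (U z * w \<eta> z)) \<le> (M * K / \<eta>\<^sup>2) / (norm z)\<^sup>2" if z: "Im z \<ge> 0" "norm z \<ge> 1" for z
    proof -
      have "norm (D z * (U z * w \<eta> z)) \<le> (M * exp (T * Im z)) * ((K * exp (- T * Im z)) * (1 / (\<eta> * norm z)\<^sup>2))"
        unfolding norm_mult
      proof (intro mult_mono)
        show "norm (D z) \<le> M * exp (T * Im z)" using M[of z] z by simp
        show "norm (w \<eta> z) \<le> 1 / (\<eta> * norm z)\<^sup>2" unfolding w_def norm_divide norm_power norm_one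
        proof (intro divide_left_mono power_mono)
          show "0 < (cmod (1 - \<i> * complex_of_real \<eta> * z))\<^sup>2 * (\<eta> * cmod z)\<^sup>2"
            using norm_one_minus_i_mult_ge(1)[of \<eta> z] \<eta> z by (intro mult_pos_pos zero_less_power) linarith+
        qed (use norm_one_minus_i_mult_ge(2)[of \<eta> z] \<eta> z in auto)
      qed (use bd z M0 K0 in auto)
      also have "\<dots> = (M * K / \<eta>\<^sup>2) / (norm z)\<^sup>2 * (exp (T * Im z) * exp (- T * Im z))"
        by (simp add: power_mult_distrib)
      finally show ?thesis by (simp flip: exp_add)
    qed
    show "integrable lborel (\<lambda>x. D (of_real x) * (U (of_real x) * w \<eta> (of_real x)))"
      by (rule int_bd) (use w1 \<eta> in \<open>auto simp: w_def\<close>)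
  qed
  have "(\<lambda>n. LINT x|lborel. D (of_real x) * (U (of_real x) * w (1 / (c * real (Suc n))) (of_real x))) \<longlonglongrightarrow>
      (LINT x|lborel. D (of_real x) * U (of_real x))"
  proof (rule integral_dominated_convergence)
    show "integrable lborel (\<lambda>x. norm (D (of_real x) * U (of_real x)))" using intDU by simp
    show "AE x in lborel. (\<lambda>n. D (of_real x) * (U (of_real x) * w (1 / (c * real (Suc n))) (of_real x))) \<longlonglongrightarrow>
        D (of_real x) * U (of_real x)"
    proof (rule AE_I2)
      fix x :: real
      have "(\<lambda>n. 1 / (c * real (Suc n))) \<longlonglongrightarrow> 0" using c by real_asymp
      then have "(\<lambda>n. D (of_real x) * (U (of_real x) * w (1 / (c * real (Suc n))) (of_real x))) \<longlonglongrightarrow>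
          D (of_real x) * (U (of_real x) * (1 / (1 - \<i> * of_real 0 * of_real x)\<^sup>2))"
        unfolding w_def by (intro tendsto_intros) auto
      then show "(\<lambda>n. D (of_real x) * (U (of_real x) * w (1 / (c * real (Suc n))) (of_real x))) \<longlonglongrightarrow>
        D (of_real x) * U (of_real x)" by simp
    qed
    show "AE x in lborel. norm (D (of_real x) * (U (of_real x) * w (1 / (c * real (Suc n))) (of_real x)))
        \<le> norm (D (of_real x) * U (of_real x))" for n
    proof (rule AE_I2)
      fix x
      have "norm (w (1 / (c * real (Suc n))) (of_real x)) \<le> 1" using c by (intro w1) auto
      then show "norm (D (of_real x) * (U (of_real x) * w (1 / (c * real (Suc n))) (of_real x)))
        \<le> norm (D (of_real x) * U (of_real x))"
        by (simp add: norm_mult mult_left_mono mult_left_le)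
    qed
  qed (auto simp: w_def)
  moreover have "(\<lambda>n. LINT x|lborel. D (of_real x) * (U (of_real x) * w (1 / (c * real (Suc n))) (of_real x))) = (\<lambda>n. 0)"
  proof (rule ext, rule zero)
    fix n
    have "c * 1 \<le> c * real (Suc n)" using c by (intro mult_left_mono) auto
    with c show "0 < 1 / (c * real (Suc n))" "1 / (c * real (Suc n)) \<le> 1 / c"
      by (auto intro!: divide_left_mono simp del: of_nat_Suc)
  qed
  ultimately show "(LINT x|lborel. D (of_real x) * U (of_real x)) = 0"
    by (simp only: LIMSEQ_const_iff)
qed

lemma has_bochner_integral_cauchy_density:
  fixes a :: real assumes a: "a > 0"
  shows "has_bochner_integral lborel (\<lambda>x. 1 / (x\<^sup>2 + a\<^sup>2)) (pi / a)"
proof -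
  have pos: "x\<^sup>2 + a\<^sup>2 > 0" for x :: real using a by (simp add: sum_power2_gt_zero_iff)
  let ?F = "\<lambda>x. arctan (x / a) / a"
  have D: "DERIV ?F x :> 1 / (x\<^sup>2 + a\<^sup>2)" for x
  proof -
    have *: "1 + (x / a)\<^sup>2 = (x\<^sup>2 + a\<^sup>2) / a\<^sup>2" using a by (simp add: field_simps)
    have "DERIV ?F x :> inverse (1 + (x / a)\<^sup>2) * (1 / a) / a"
      using a by (auto intro!: derivative_eq_intros simp: mult.commute)
    also have "inverse (1 + (x / a)\<^sup>2) * (1 / a) / a = 1 / (x\<^sup>2 + a\<^sup>2)"
      unfolding * using a by (simp add: power2_eq_square)
    finally show ?thesis .
  qed
  have lim_top: "((?F \<circ> real_of_ereal) \<longlongrightarrow> pi / (2 * a)) (at_left \<infinity>)"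
  proof -
    have "(?F \<longlongrightarrow> pi / 2 / a) at_top" using a
      by (real_asymp simp: field_simps)
    then show ?thesis by (simp add: ereal_tendsto_simps)
  qed
  have lim_bot: "((?F \<circ> real_of_ereal) \<longlongrightarrow> - (pi / (2 * a))) (at_right (-\<infinity>))"
  proof -
    have "(?F \<longlongrightarrow> - (pi / 2) / a) at_bot" using a
      by (real_asymp simp: field_simps)
    then show ?thesis by (simp add: ereal_tendsto_simps)
  qed
  have cont: "isCont (\<lambda>x. 1 / (x\<^sup>2 + a\<^sup>2)) x" for x
    using pos[of x] by (intro continuous_intros) auto
  have "set_integrable lborel (einterval (-\<infinity>) \<infinity>) (\<lambda>x. 1 / (x\<^sup>2 + a\<^sup>2))"
    "(LBINT x=-\<infinity>..\<infinity>. 1 / (x\<^sup>2 + a\<^sup>2)) = pi / (2 * a) - - (pi / (2 * a))"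
    by (rule interval_integral_FTC_nonneg[OF _ D cont _ lim_bot lim_top]; simp)+
  then show ?thesis
    by (simp add: has_bochner_integral_iff set_integrable_def interval_lebesgue_integral_def
        set_lebesgue_integral_def einterval_def)
qed

text \<open>
  The quotient \<open>(U z - U (\<i> * a)) / (z\<^sup>2 + a\<^sup>2)\<close> has a removable singularity at \<open>\<i> * a\<close> and decays quadratically,
  so its integral is \<open>0\<close>; what remains is the mass \<open>pi / a\<close> of the Cauchy density.
\<close>

lemma poisson_formula_upper:
  fixes U :: "complex \<Rightarrow> complex"
  assumes U: "U holomorphic_on {z. Im z > - c}" and c: "c > 0" and a: "a > 0"
    and bd: "\<And>z. Im z \<ge> 0 \<Longrightarrow> norm (U z) \<le> K"
  shows "has_bochner_integral lborel (\<lambda>x. U (of_real x) / of_real (x\<^sup>2 + a\<^sup>2)) (of_real (pi / a) * U (\<i> * of_real a))"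
proof -
  define w where "w = \<i> * complex_of_real a"
  have [simp]: "Im w = a" "norm w = a" using a by (auto simp: w_def norm_mult)
  have K0: "K \<ge> 0" using order_trans[OF norm_ge_zero bd[of 0]] by simp
  have pos: "x\<^sup>2 + a\<^sup>2 > 0" for x :: real using a by (simp add: sum_power2_gt_zero_iff)
  have fact: "of_real (x\<^sup>2 + a\<^sup>2) = (of_real x - w) * (of_real x + w)" for x
    by (simp add: w_def algebra_simps power2_eq_square)
  have nw: "of_real x \<noteq> w" for x using a by (metis Im_complex_of_real \<open>Im w = a\<close> less_irrefl)
  define Q where "Q = (\<lambda>z. if z = w then deriv U w else (U z - U w) / (z - w))"
  have Q: "Q holomorphic_on {z. Im z > - c}" unfolding Q_def
    by (rule pole_lemma_open[OF U open_halfspace_Im_gt])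
  define V where "V = (\<lambda>z. Q z / (z + w))"
  have c': "min c a > 0" using a c by simp
  have mU [measurable]: "(\<lambda>x. U (of_real x)) \<in> borel_measurable borel"
    by (intro borel_measurable_continuous_onI continuous_on_compose2[OF holomorphic_on_imp_continuous_on[OF U]] continuous_intros)
       (use c in auto)
  have Vreal: "V (of_real x) = (U (of_real x) - U w) / of_real (x\<^sup>2 + a\<^sup>2)" for x
    using nw by (simp add: V_def Q_def fact del: of_real_add of_real_power)
  have P: "has_bochner_integral lborel (\<lambda>x. 1 / (x\<^sup>2 + a\<^sup>2)) (pi / a)"
    by (rule has_bochner_integral_cauchy_density[OF a])
  have Pc: "has_bochner_integral lborel (\<lambda>x. complex_of_real (1 / (x\<^sup>2 + a\<^sup>2))) (of_real (pi / a))"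
    by (rule has_bochner_integral_of_real[OF P])
  have intU: "integrable lborel (\<lambda>x. U (of_real x) / of_real (x\<^sup>2 + a\<^sup>2))"
  proof (rule Bochner_Integration.integrable_bound)
    show "integrable lborel (\<lambda>x. K *\<^sub>R (1 / (x\<^sup>2 + a\<^sup>2)))"
      using P by (intro integrable_scaleR_right) (auto simp: has_bochner_integral_iff)
    show "AE x in lborel. norm (U (of_real x) / of_real (x\<^sup>2 + a\<^sup>2)) \<le> norm (K *\<^sub>R (1 / (x\<^sup>2 + a\<^sup>2)))"
    proof (rule AE_I2)
      fix x :: real
      have "norm (U (of_real x)) / (x\<^sup>2 + a\<^sup>2) \<le> K / (x\<^sup>2 + a\<^sup>2)"
        using bd[of "of_real x"] pos[of x] by (intro divide_right_mono) auto
      then show "norm (U (of_real x) / of_real (x\<^sup>2 + a\<^sup>2)) \<le> norm (K *\<^sub>R (1 / (x\<^sup>2 + a\<^sup>2)))"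
        using pos[of x] K0 by (simp add: norm_divide del: of_real_add of_real_power)
    qed
  qed measurable
  have intw: "has_bochner_integral lborel (\<lambda>x. U w / of_real (x\<^sup>2 + a\<^sup>2)) (U w * of_real (pi / a))"
    using has_bochner_integral_mult_right[OF Pc, of "U w"] by simp
  have "(LINT x|lborel. V (of_real x)) = 0"
  proof (rule line_integral_eq_0_if_quadratic_decay[OF _ c'])
    have "z + w \<noteq> 0" if "Im z > - a" for z
    proof
      assume "z + w = 0" then have "Im (z + w) = 0" by simp
      with that show False by simp
    qed
    then show "V holomorphic_on {z. Im z > - min c a}" unfolding V_def
      by (intro holomorphic_intros holomorphic_on_subset[OF Q]) auto
    show "norm (V z) \<le> (8 * K) / (norm z)\<^sup>2" if z: "Im z \<ge> 0" "norm z \<ge> 2 * a" for z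
    proof -
      have z0: "norm z > 0" using z a by linarith
      have 1: "norm (z - w) \<ge> norm z / 2" "norm (z + w) \<ge> norm z / 2"
        using z norm_triangle_ineq2[of z w] norm_diff_ineq[of z w] by auto
      then have "z \<noteq> w" using z0 a by auto
      then have "norm (V z) = norm (U z - U w) / (norm (z - w) * norm (z + w))"
        by (simp add: V_def Q_def norm_divide norm_mult)
      also have "\<dots> \<le> (K + K) / (norm z / 2 * (norm z / 2))"
      proof (rule frac_le)
        show "norm (U z - U w) \<le> K + K" using bd[OF z(1)] bd[of w] a norm_triangle_ineq4[of "U z" "U w"] by simp
        show "norm z / 2 * (norm z / 2) \<le> norm (z - w) * norm (z + w)" using 1 z0 by (intro mult_mono) auto
      qed (use K0 z0 in auto)
      finally show ?thesis by (simp add: power2_eq_square)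
    qed
    show "integrable lborel (\<lambda>x. V (of_real x))" unfolding Vreal diff_divide_distrib
      using intU intw by (intro Bochner_Integration.integrable_diff) (auto simp: has_bochner_integral_iff)
  qed
  then have "(LINT x|lborel. U (of_real x) / of_real (x\<^sup>2 + a\<^sup>2)) = U w * of_real (pi / a)"
    unfolding Vreal diff_divide_distrib using intU intw
    by (subst (asm) Bochner_Integration.integral_diff) (auto simp: has_bochner_integral_iff)
  with intU show ?thesis by (simp add: has_bochner_integral_iff w_def mult.commute)
qed

section \<open>Division by the cosine\<close>

lemma cos_pi_half_int: "cos (pi * (of_int n + 1/2)) = (0::real)"
proof -
  have "pi * (of_int n + 1/2) = of_int n * pi + pi / 2" by (simp add: algebra_simps)
  then show ?thesis by (simp add: cos_add sin_times_pi_eq_0)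
qed

lemma cos_pi_complex_eq_0_iff:
  fixes z :: complex
  shows "cos (of_real pi * z) = 0 \<longleftrightarrow> (\<exists>n::int. z = of_real (of_int n + 1/2))"
proof -
  have "of_real pi * z = complex_of_real (of_int n * pi) + of_real pi / 2 \<longleftrightarrow> z = of_real (of_int n + 1/2)" for n
  proof -
    have "complex_of_real (of_int n * pi) + of_real pi / 2 = of_real pi * of_real (of_int n + 1/2)"
      by (simp add: algebra_simps)
    then show ?thesis by (simp only: mult_cancel_left) simp
  qed
  then show ?thesis by (simp add: cos_eq_0 del: of_real_add of_real_mult)
qed

text \<open>
  The cosine has simple zeros, so a nonzero value of \<open>G\<close> at a zero would leave a singularity of the
  form \<open>c / (x - x\<^sub>0)\<close>, whose integral diverges logarithmically.
\<close>

lemma isCont_eq_0_if_integrable_div_cos: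
  fixes G :: "real \<Rightarrow> complex" and n :: int
  assumes G: "isCont G (of_int n + 1/2)"
    and int: "integrable lborel (\<lambda>x. norm (G x) / \<bar>cos (pi * x)\<bar>)"
  shows "G (of_int n + 1/2) = 0"
proof (rule ccontr)
  define x0 where "x0 = real_of_int n + 1/2"
  assume "G (of_int n + 1/2) \<noteq> 0"
  then have pos: "norm (G x0) > 0" by (simp add: x0_def)
  define c where "c = norm (G x0) / 2"
  have c: "c > 0" using pos by (simp add: c_def)
  obtain d where d: "d > 0" "\<And>x. dist x x0 < d \<Longrightarrow> dist (G x) (G x0) < c"
    using G c unfolding continuous_at_eps_delta x0_def[symmetric] by blast
  define \<delta> where "\<delta> = min d 1 / 2"
  have \<delta>: "0 < \<delta>" "\<delta> < d" "\<delta> < 1" using d by (auto simp: \<delta>_def)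
  have lower: "c / (pi * (x - x0)) \<le> norm (G x) / \<bar>cos (pi * x)\<bar>" if x: "x0 < x" "x \<le> x0 + \<delta>" for x
  proof -
    have "dist (G x) (G x0) < c" using x \<delta> by (intro d) (auto simp: dist_real_def)
    then have Gx: "norm (G x) \<ge> c"
      unfolding c_def dist_norm using norm_triangle_ineq2[of "G x0" "G x"] by (simp add: norm_minus_commute)
    define t where "t = x - x0"
    have t: "0 < t" "t < 1" using x \<delta> by (auto simp: t_def)
    have "cos (pi * x) = cos (pi * (of_int n + 1/2) + pi * t)"
      by (simp add: t_def x0_def algebra_simps)
    then have eq: "\<bar>cos (pi * x)\<bar> = \<bar>sin (pi * (of_int n + 1/2))\<bar> * \<bar>sin (pi * t)\<bar>"
      unfolding cos_add cos_pi_half_int by (simp add: abs_mult)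
    have "\<bar>sin (pi * (of_int n + 1/2))\<bar> = 1"
      using sin_cos_squared_add[of "pi * (of_int n + 1/2)"] unfolding cos_pi_half_int
      by (auto simp: power2_eq_1_iff)
    with eq have eq: "\<bar>cos (pi * x)\<bar> = \<bar>sin (pi * t)\<bar>" by simp
    have "sin (pi * t) > 0" using t by (intro sin_gt_zero) auto
    moreover have "\<bar>sin (pi * t)\<bar> \<le> pi * t" using t abs_sin_x_le_abs_x[of "pi * t"] by simp
    ultimately show ?thesis unfolding eq t_def[symmetric] using Gx c by (intro frac_le) auto
  qed
  define I where "I = (LINT x|lborel. norm (G x) / \<bar>cos (pi * x)\<bar>)"
  have bound: "c / pi * ln (\<delta> / \<epsilon>) \<le> I" if \<epsilon>: "0 < \<epsilon>" "\<epsilon> < \<delta>" for \<epsilon>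
  proof -
    have cont: "continuous_on {x0 + \<epsilon>..x0 + \<delta>} (\<lambda>x. c / (pi * (x - x0)))"
      using \<epsilon> by (intro continuous_intros) auto
    have "(LINT x|lborel. indicator {x0 + \<epsilon>..x0 + \<delta>} x *\<^sub>R (c / (pi * (x - x0)))) =
        c / pi * ln (x0 + \<delta> - x0) - c / pi * ln (x0 + \<epsilon> - x0)"
      using \<epsilon> cont
      by (intro integral_FTC_atLeastAtMost)
         (auto intro!: derivative_eq_intros simp: has_real_derivative_iff_has_vector_derivative[symmetric] field_simps)
    also have "\<dots> = c / pi * ln (\<delta> / \<epsilon>)" using \<epsilon> \<delta> by (simp add: ln_div right_diff_distrib)
    finally have "c / pi * ln (\<delta> / \<epsilon>) = (LINT x|lborel. indicator {x0 + \<epsilon>..x0 + \<delta>} x *\<^sub>R (c / (pi * (x - x0))))" ..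
    also have "\<dots> \<le> I" unfolding I_def
    proof (rule integral_mono[OF _ int])
      show "integrable lborel (\<lambda>x. indicator {x0 + \<epsilon>..x0 + \<delta>} x *\<^sub>R (c / (pi * (x - x0))))"
        using borel_integrable_atLeastAtMost'[OF cont] by (simp add: set_integrable_def)
      show "indicator {x0 + \<epsilon>..x0 + \<delta>} x *\<^sub>R (c / (pi * (x - x0))) \<le> norm (G x) / \<bar>cos (pi * x)\<bar>" for x
        using lower[of x] \<epsilon> by (auto simp: indicator_def)
    qed
    finally show ?thesis .
  qed
  have I0: "I \<ge> 0" unfolding I_def by (rule integral_nonneg_AE) auto
  \<comment> \<open>With this choice \<open>c / pi * ln (\<delta> / \<epsilon>) = I + 1\<close>, more than the whole integral \<open>I\<close>.\<close>
  define \<epsilon> where "\<epsilon> = \<delta> * exp (- (pi / c * (I + 1)))"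
  have "\<epsilon> < \<delta> * 1" unfolding \<epsilon>_def using \<delta> I0 c by (intro mult_strict_left_mono) auto
  then have "c / pi * ln (\<delta> / \<epsilon>) \<le> I" using \<delta> by (intro bound) (auto simp: \<epsilon>_def)
  also have "\<delta> / \<epsilon> = exp (pi / c * (I + 1))" using \<delta> by (simp add: \<epsilon>_def exp_minus divide_inverse)
  also have "c / pi * ln (exp (pi / c * (I + 1))) = I + 1" using c by simp
  finally show False by simp
qed

text \<open>
  At the zeros of the cosine the quotient is continued by l'Hopital's value; the isolated
  singularities are then removable.
\<close>

lemma entire_div_cos:
  fixes G :: "complex \<Rightarrow> complex"
  assumes hol: "G holomorphic_on UNIV" and zero: "\<And>n::int. G (of_real (of_int n + 1/2)) = 0"
  obtains E where "E holomorphic_on UNIV" "\<And>z. G z = E z * cos (of_real pi * z)"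
proof -
  define C where "C = (\<lambda>z. cos (of_real pi * z :: complex))"
  define S where "S = {z. C z = 0}"
  define E where "E = (\<lambda>z. if z \<in> S then deriv G z / (- (sin (of_real pi * z) * of_real pi)) else G z / C z)"
  have holC: "C holomorphic_on A" for A unfolding C_def by (intro holomorphic_intros)
  have S: "S = {z. \<exists>n::int. z = of_real (of_int n + 1/2)}"
    unfolding S_def C_def cos_pi_complex_eq_0_iff ..
  have GS: "G z = 0" if "z \<in> S" for z using that zero unfolding S by auto
  have "E holomorphic_on ball z (1/2)" for z
  proof -
    define K where "K = S \<inter> ball z (1/2)"
    have K: "K \<subseteq> {w}" if "w \<in> K" for w
    proof
      fix w' assume "w' \<in> K"
      with that obtain n n' :: int where n: "w = of_real (of_int n + 1/2)" "w' = of_real (of_int n' + 1/2)"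
        by (auto simp: K_def S)
      have "dist w w' < 1" using \<open>w' \<in> K\<close> that unfolding K_def
        using dist_triangle_half_r[of z w 1 w'] by (auto simp: dist_commute)
      then have "\<bar>real_of_int n - real_of_int n'\<bar> < 1"
        unfolding n dist_of_real by (simp add: dist_real_def)
      then have "n = n'" by linarith
      then show "w' \<in> {w}" using n by simp
    qed
    have finK: "finite K"
    proof (cases "K = {}")
      case False
      then obtain w where "w \<in> K" by blast
      from K[OF this] show ?thesis by (rule finite_subset) simp
    qed simp
    have openB: "open (ball z (1/2) - K)" by (intro open_Diff finite_imp_closed finK) auto
    have "(\<lambda>z. G z / C z) holomorphic_on (ball z (1/2) - K)"
      by (intro holomorphic_intros holC holomorphic_on_subset[OF hol]) (auto simp: K_def S_def)
    then have hol1: "E holomorphic_on (ball z (1/2) - K)"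
      by (rule holomorphic_transform) (auto simp: E_def K_def)
    have contK: "isCont E w" if w: "w \<in> K" for w
    proof -
      have wS: "w \<in> S" "C w = 0" using w by (auto simp: K_def S_def)
      have sn: "sin (of_real pi * w) \<noteq> 0"
      proof
        assume "sin (of_real pi * w) = 0"
        with wS(2) have "(sin (of_real pi * w))\<^sup>2 + (cos (of_real pi * w))\<^sup>2 = 0" by (simp add: C_def)
        then show False unfolding sin_cos_squared_add by simp
      qed
      have dG: "(G has_field_derivative deriv G w) (at w)"
        using hol by (simp add: holomorphic_derivI)
      have dC: "(C has_field_derivative (- (sin (of_real pi * w) * of_real pi))) (at w)"
        unfolding C_def by (rule derivative_eq_intros refl | simp)+
      have lim: "((\<lambda>w. G w / C w) \<longlongrightarrow> E w) (at w)"
        by (rule lhopital_complex_simple[OF dG dC GS[OF wS(1)] wS(2)]) (use sn wS in \<open>auto simp: E_def\<close>)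
      have "open (ball z (1/2) - (K - {w}))" by (intro open_Diff finite_imp_closed finite_Diff finK) auto
      then have "eventually (\<lambda>v. v \<in> ball z (1/2) - (K - {w})) (at w)"
        using w by (intro eventually_at_in_open') (auto simp: K_def)
      then have "eventually (\<lambda>v. v \<in> ball z (1/2) - (K - {w}) \<and> v \<noteq> w) (at w)"
        by (simp add: eventually_conj_iff eventually_neq_at_within)
      then have "eventually (\<lambda>v. G v / C v = E v) (at w)"
        by eventually_elim (auto simp: E_def K_def)
      then show ?thesis using lim unfolding isCont_def by (rule Lim_transform_eventually[rotated])
    qed
    have "continuous_on (ball z (1/2)) E"
    proof (rule continuous_at_imp_continuous_on, rule ballI)
      fix w assume w: "w \<in> ball z (1/2)"
      show "isCont E w"
      proof (cases "w \<in> K")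
        case False
        then show ?thesis using hol1 openB w
          by (metis DiffI holomorphic_on_imp_continuous_on continuous_on_eq_continuous_at)
      qed (rule contK)
    qed
    then show ?thesis by (rule no_isolated_singularity[OF _ hol1 open_ball finK])
  qed
  then have "E holomorphic_on UNIV"
    unfolding holomorphic_on_def
    by (metis UNIV_I at_within_open centre_in_ball open_ball half_gt_zero zero_less_one
        field_differentiable_at_within)
  moreover have "G z = E z * cos (of_real pi * z)" for z
    using GS[of z] by (auto simp: E_def S_def C_def)
  ultimately show thesis by (rule that)
qed

lemma cos_pi_of_real: "cos (of_real pi * of_real x :: complex) = of_real (cos (pi * x))"
  unfolding of_real_mult[symmetric] cos_of_real ..

text \<open>
  The two cases describe the sides of the rectangles \<open>[n, n + 1] \<times> [- 1, 1]\<close> and everything outside of the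
  strip they fill: there \<open>cos (pi * z)\<close> attains its maximal growth up to a constant.
\<close>

lemma norm_cos_pi_ge:
  fixes z :: complex
  assumes "\<bar>Im z\<bar> \<ge> 1 \<or> Re z \<in> \<int>"
  shows "exp (pi * \<bar>Im z\<bar>) / 4 \<le> norm (cos (of_real pi * z))"
proof -
  define e where "e = exp (pi * \<bar>Im z\<bar>)"
  have e: "e \<ge> 1" by (simp add: e_def)
  have sq: "(exp (pi * Im z) - inverse (exp (pi * Im z)))\<^sup>2 = (e - inverse e)\<^sup>2"
    by (cases "Im z \<ge> 0") (auto simp: e_def exp_minus power2_commute)
  have norm: "(norm (cos (of_real pi * z)))\<^sup>2 = (cos (pi * Re z))\<^sup>2 + (e - inverse e)\<^sup>2 / 4"
    unfolding norm_cos_squared by (simp add: sq)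
  have ie: "0 < inverse e" "inverse e \<le> 1" using e by (auto simp: field_simps)
  have "(e / 4)\<^sup>2 \<le> (norm (cos (of_real pi * z)))\<^sup>2"
    using assms
  proof
    assume "\<bar>Im z\<bar> \<ge> 1"
    then have "1 + pi * 1 \<le> 1 + pi * \<bar>Im z\<bar>" by simp
    also have "\<dots> \<le> e" unfolding e_def by (rule exp_ge_add_one_self)
    finally have "e \<ge> 2" using pi_gt3 by simp
    then have "(e / 4)\<^sup>2 \<le> ((e - inverse e) / 2)\<^sup>2" using ie by (intro power_mono) auto
    also have "\<dots> = (e - inverse e)\<^sup>2 / 4" by (simp add: power_divide)
    finally show ?thesis unfolding norm by (simp add: add_increasing)
  next
    assume "Re z \<in> \<int>"
    then obtain n where "Re z = of_int n" by (auto elim: Ints_cases)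
    then have "sin (pi * Re z) = 0" by (simp add: sin_times_pi_eq_0 mult.commute)
    then have c1: "(cos (pi * Re z))\<^sup>2 = 1" using sin_cos_squared_add[of "pi * Re z"] by simp
    have "(e / 4)\<^sup>2 \<le> ((e + inverse e) / 2)\<^sup>2" using ie e by (intro power_mono) auto
    also have "\<dots> = 1 + (e - inverse e)\<^sup>2 / 4"
      using e by (simp add: power2_eq_square field_simps)
    finally show ?thesis unfolding norm c1 .
  qed
  then show ?thesis unfolding e_def by (rule power2_le_imp_le) simp
qed

text \<open>
  The bound \<open>norm (Z z) \<le> M * exp (k * pi * \<bar>Im z\<bar>)\<close> and the lower bound for the cosine make \<open>E\<close> bounded
  away from the zeros of the cosine, and by the maximum principle everywhere. So \<open>E\<close> is constant, and a
  nonzero multiple of \<open>cos (pi * x) ^ k\<close> is not integrable.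
\<close>

lemma exp_type_multiple_of_cos_eq_0:
  fixes Z E :: "complex \<Rightarrow> complex"
  assumes Z: "entire_exp_type (of_nat k * pi) Z" and k: "k \<in> {1, 2}"
    and int: "integrable lborel (\<lambda>x. Z (of_real x))"
    and E: "E holomorphic_on UNIV" and ZE: "\<And>z. Z z = E z * cos (of_real pi * z) ^ k"
  shows "Z z = 0"
proof -
  obtain M where M: "\<And>z. norm (Z z) \<le> M * exp (of_nat k * pi * \<bar>Im z\<bar>)"
    using integrable_exp_type_bound[OF Z int] by auto
  have M0: "M \<ge> 0" using order_trans[OF norm_ge_zero M[of 0]] by simp
  have good: "norm (E z) \<le> M * 4 ^ k" if z: "\<bar>Im z\<bar> \<ge> 1 \<or> Re z \<in> \<int>" for z
  proof -
    define e where "e = exp (pi * \<bar>Im z\<bar>)"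
    have e: "e > 0" by (simp add: e_def)
    have "(e / 4) ^ k \<le> norm (cos (of_real pi * z)) ^ k"
      using norm_cos_pi_ge[OF z] by (intro power_mono) (auto simp: e_def)
    then have "norm (E z) * (e / 4) ^ k \<le> norm (E z) * norm (cos (of_real pi * z)) ^ k"
      by (intro mult_left_mono) auto
    also have "\<dots> = norm (Z z)" by (simp add: ZE norm_mult norm_power)
    also have "\<dots> \<le> M * e ^ k" using M[of z] by (simp add: e_def mult.assoc flip: exp_of_nat_mult)
    finally have "(norm (E z) / 4 ^ k) * e ^ k \<le> M * e ^ k" by (simp add: power_divide)
    then have "norm (E z) / 4 ^ k \<le> M" using e by (subst (asm) mult_le_cancel_right_pos) auto
    then show ?thesis by (simp add: field_simps)
  qed
  have bdd: "norm (E z) \<le> M * 4 ^ k" for z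
  proof (cases "\<bar>Im z\<bar> \<ge> 1")
    case True then show ?thesis using good by blast
  next
    case False
    let ?S = "cbox (Complex (of_int \<lfloor>Re z\<rfloor>) (-1)) (Complex (of_int \<lfloor>Re z\<rfloor> + 1) 1)"
    show ?thesis
    proof (rule maximum_modulus_frontier[where f = E and \<xi> = z and S = ?S])
      show "E holomorphic_on interior ?S" using E holomorphic_on_subset by blast
      show "continuous_on (closure ?S) E"
        using E holomorphic_on_imp_continuous_on continuous_on_subset by blast
      show "z \<in> ?S" using False by (auto simp: in_cbox_complex_iff)
      fix w assume "w \<in> frontier ?S"
      from frontier_cbox_complexD(2)[OF this] show "norm (E w) \<le> M * 4 ^ k"
        by (intro good) (auto simp: Ints_def intro: range_eqI[of _ _ "\<lfloor>Re z\<rfloor> + 1"])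
    qed simp
  qed
  then have "bounded (range E)" by (auto simp: bounded_iff)
  then obtain e where e: "\<And>z. E z = e"
    using Liouville_theorem[OF E] by (auto simp: constant_on_def)
  have "integrable lborel (\<lambda>x. norm e * (cos (pi * x))\<^sup>2)"
  proof (rule Bochner_Integration.integrable_bound)
    show "integrable lborel (\<lambda>x. norm (Z (of_real x)))" using int by simp
    show "AE x in lborel. norm (norm e * (cos (pi * x))\<^sup>2) \<le> norm (norm (Z (of_real x)))"
    proof (rule AE_I2)
      fix x
      have "\<bar>cos (pi * x)\<bar> ^ 2 \<le> \<bar>cos (pi * x)\<bar> ^ k" using k by (intro power_decreasing) auto
      moreover have "norm (Z (of_real x)) = norm e * \<bar>cos (pi * x)\<bar> ^ k"
        by (simp add: ZE e norm_mult norm_power cos_pi_of_real)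
      ultimately show "norm (norm e * (cos (pi * x))\<^sup>2) \<le> norm (norm (Z (of_real x)))"
        by (simp add: abs_mult mult_left_mono)
    qed
  qed measurable
  \<comment> \<open>Adding the translate by \<open>1/2\<close> turns \<open>cos\<^sup>2\<close> into \<open>cos\<^sup>2 + sin\<^sup>2 = 1\<close>, and a nonzero constant is not integrable.\<close>
  note int1 = this
  from lborel_integrable_real_affine[OF int1, of 1 "1/2"]
  have int2: "integrable lborel (\<lambda>x. norm e * (cos (pi * (1/2 + x)))\<^sup>2)" by simp
  have "integrable lborel (\<lambda>x. norm e * (cos (pi * x))\<^sup>2 + norm e * (cos (pi * (1/2 + x)))\<^sup>2)"
    by (rule Bochner_Integration.integrable_add[OF int1 int2])
  moreover have "norm e * (cos (pi * x))\<^sup>2 + norm e * (cos (pi * (1/2 + x)))\<^sup>2 = norm e" for x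
  proof -
    have "cos (pi * (1/2 + x)) = - sin (pi * x)" by (simp add: distrib_left cos_add)
    then show ?thesis by (simp flip: distrib_left)
  qed
  ultimately have "integrable lborel (\<lambda>x::real. norm e)" by simp
  then have "(\<integral>\<^sup>+x. ennreal (norm e) \<partial>(lborel :: real measure)) < \<infinity>" by (simp add: integrable_iff_bounded)
  then have "e = 0" by (auto simp: ennreal_mult_less_top ennreal_eq_0_iff)
  then show ?thesis by (simp add: ZE e)
qed

section \<open>Uniqueness for one-sided approximation\<close>

text \<open>
  The left-hand side is the Poisson kernel \<open>(1 - r\<^sup>2) / (norm (1 - q))\<^sup>2\<close> of the disc, with its peak at the
  half-integers because of the sign of \<open>q\<close>. The right-hand side shows the two features that the
  extremality argument needs: the product with \<open>cos\<^sup>2\<close> is at most \<open>(1 - r\<^sup>2) / (4 * r)\<close>, and the quotient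
  by \<open>1 - r\<^sup>2\<close> tends to \<open>1 / (4 * cos\<^sup>2)\<close> as \<open>r\<close> tends to \<open>1\<close>.
\<close>

lemma poisson_kernel_half_angle:
  fixes r x :: real
  assumes r: "0 < r" "r < 1"
  defines "q \<equiv> - of_real r * exp (\<i> * of_real (2 * pi * x))"
  shows "1 + 2 * Re (q / (1 - q)) = (1 - r\<^sup>2) * (1 / ((1 - r)\<^sup>2 + 4 * r * (cos (pi * x))\<^sup>2))"
proof -
  define t where "t = 2 * pi * x"
  have q: "Re q = - r * cos t" "Im q = - r * sin t"
    by (simp_all add: q_def t_def Re_exp Im_exp)
  have nq: "norm q = r" using r by (simp add: q_def norm_mult)
  then have ne: "1 - q \<noteq> 0" using r by auto
  have cd: "cos t = 2 * (cos (pi * x))\<^sup>2 - 1"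
    using cos_double_cos[of "pi * x"] by (simp add: t_def mult.assoc)
  have n2: "(norm (1 - q))\<^sup>2 = (1 - r)\<^sup>2 + 4 * r * (cos (pi * x))\<^sup>2"
  proof -
    have "(norm (1 - q))\<^sup>2 = (1 + r * cos t)\<^sup>2 + (r * sin t)\<^sup>2" by (simp add: cmod_power2 q)
    also have "\<dots> = 1 + 2 * r * cos t + r\<^sup>2 * ((sin t)\<^sup>2 + (cos t)\<^sup>2)" by algebra
    also have "\<dots> = 1 + 2 * r * cos t + r\<^sup>2" by simp
    finally show ?thesis unfolding cd by (simp add: power2_eq_square algebra_simps)
  qed
  have "1 + 2 * (q / (1 - q)) = (1 + q) / (1 - q)" using ne by (simp add: field_simps)
  moreover have "1 + 2 * Re w = Re (1 + 2 * w)" for w by simp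
  ultimately have "1 + 2 * Re (q / (1 - q)) = Re ((1 + q) / (1 - q))" by (simp only:)
  also have "(1 + q) / (1 - q) = ((1 + q) * cnj (1 - q)) / of_real ((norm (1 - q))\<^sup>2)"
    using complex_div_cnj[of "1 + q" "1 - q"] by simp
  also have "Re \<dots> = Re ((1 + q) * cnj (1 - q)) / (norm (1 - q))\<^sup>2" by (rule Re_divide_of_real)
  also have "Re ((1 + q) * cnj (1 - q)) = 1 - ((Re q)\<^sup>2 + (Im q)\<^sup>2)"
    by (simp add: power2_eq_square algebra_simps)
  also have "\<dots> = 1 - r\<^sup>2" using nq cmod_power2[of q] by simp
  finally show ?thesis unfolding n2 by simp
qed

lemma entire_exp_type_diff:
  assumes F: "entire_exp_type T F" and H: "entire_exp_type T H"
  shows "entire_exp_type T (\<lambda>z. F z - H z)"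
  unfolding entire_exp_type_def
proof (intro conjI allI impI)
  show "(\<lambda>z. F z - H z) holomorphic_on UNIV"
    by (intro holomorphic_intros entire_exp_typeD(1)[OF F] entire_exp_typeD(1)[OF H])
  fix \<epsilon> :: real assume \<epsilon>: "\<epsilon> > 0"
  obtain C1 where C1: "C1 > 0" "\<And>z. norm (F z) \<le> C1 * exp ((T + \<epsilon>) * norm z)"
    using entire_exp_typeD(2)[OF F \<epsilon>] by blast
  obtain C2 where C2: "C2 > 0" "\<And>z. norm (H z) \<le> C2 * exp ((T + \<epsilon>) * norm z)"
    using entire_exp_typeD(2)[OF H \<epsilon>] by blast
  have "norm (F z - H z) \<le> (C1 + C2) * exp ((T + \<epsilon>) * norm z)" for z
    unfolding distrib_right[of C1 C2]
    by (rule order_trans[OF norm_triangle_ineq4 add_mono[OF C1(2) C2(2)]])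
  then show "\<exists>C>0. \<forall>z. norm (F z - H z) \<le> C * exp ((T + \<epsilon>) * norm z)"
    using C1(1) C2(1) by (intro exI[of _ "C1 + C2"]) auto
qed

lemma entire_exp_type_translate:
  assumes D: "entire_exp_type T D" and T: "T \<ge> 0"
  shows "entire_exp_type T (\<lambda>z. D (of_real \<beta> + z))"
  unfolding entire_exp_type_def
proof (intro conjI allI impI)
  show "(\<lambda>z. D (of_real \<beta> + z)) holomorphic_on UNIV"
    using holomorphic_on_compose_gen[OF _ entire_exp_typeD(1)[OF D], of "\<lambda>z. of_real \<beta> + z" UNIV]
    by (simp add: o_def holomorphic_intros)
  fix \<epsilon> :: real assume \<epsilon>: "\<epsilon> > 0"
  obtain C where C: "C > 0" "\<And>z. norm (D z) \<le> C * exp ((T + \<epsilon>) * norm z)"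
    using entire_exp_typeD(2)[OF D \<epsilon>] by blast
  have "norm (D (of_real \<beta> + z)) \<le> (C * exp ((T + \<epsilon>) * \<bar>\<beta>\<bar>)) * exp ((T + \<epsilon>) * norm z)" for z
  proof -
    have "norm (of_real \<beta> + z) \<le> \<bar>\<beta>\<bar> + norm z" by (rule order_trans[OF norm_triangle_ineq]) simp
    then have "(T + \<epsilon>) * norm (of_real \<beta> + z) \<le> (T + \<epsilon>) * (\<bar>\<beta>\<bar> + norm z)"
      using \<epsilon> T by (intro mult_left_mono) auto
    then have "norm (D (of_real \<beta> + z)) \<le> C * exp ((T + \<epsilon>) * (\<bar>\<beta>\<bar> + norm z))"
      using C by (intro order_trans[OF C(2)] mult_left_mono) auto
    also have "\<dots> = (C * exp ((T + \<epsilon>) * \<bar>\<beta>\<bar>)) * exp ((T + \<epsilon>) * norm z)"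
      unfolding distrib_left exp_add by (simp only: mult.assoc)
    finally show ?thesis .
  qed
  then show "\<exists>C>0. \<forall>z. norm (D (of_real \<beta> + z)) \<le> C * exp ((T + \<epsilon>) * norm z)"
    using C(1) by (intro exI[of _ "C * exp ((T + \<epsilon>) * \<bar>\<beta>\<bar>)"]) auto
qed

text \<open>
  Integrability of \<open>D / cos\<^sup>2\<close> forces \<open>D\<close> to have double zeros at the zeros of the cosine: the first
  division by the cosine is possible since \<open>D / cos\<close> is integrable, and the quotient then has the same
  property.
\<close>

lemma exp_type_eq_0_if_integrable_div_cos_squared:
  assumes D: "entire_exp_type (2 * pi) D" and intD: "integrable lborel (\<lambda>x. D (of_real x))"
    and intDc: "integrable lborel (\<lambda>x. norm (D (of_real x)) / (cos (pi * (x - \<beta>)))\<^sup>2)"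
  shows "D z = 0"
proof -
  define Z where "Z = (\<lambda>z. D (of_real \<beta> + z))"
  have Z: "entire_exp_type (of_nat 2 * pi) Z"
    unfolding Z_def using entire_exp_type_translate[OF D, of \<beta>] by simp
  note holZ = entire_exp_typeD(1)[OF Z]
  have intZ: "integrable lborel (\<lambda>x. Z (of_real x))"
    using lborel_integrable_real_affine[OF intD, of 1 \<beta>] by (simp add: Z_def)
  have intZc: "integrable lborel (\<lambda>x. norm (Z (of_real x)) / \<bar>cos (pi * x)\<bar>\<^sup>2)"
    using lborel_integrable_real_affine[OF intDc, of 1 \<beta>] by (simp add: Z_def)
  have "Z (of_real (of_int n + 1/2)) = 0" for n :: int
  proof (rule isCont_eq_0_if_integrable_div_cos[where G = "\<lambda>x. Z (of_real x)"])
    show "integrable lborel (\<lambda>x. norm (Z (of_real x)) / \<bar>cos (pi * x)\<bar>)"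
    proof (rule Bochner_Integration.integrable_bound[OF intZc])
      show "AE x in lborel. norm (norm (Z (of_real x)) / \<bar>cos (pi * x)\<bar>) \<le> norm (norm (Z (of_real x)) / \<bar>cos (pi * x)\<bar>\<^sup>2)"
      proof (rule AE_I2)
        fix x
        have "\<bar>cos (pi * x)\<bar>\<^sup>2 \<le> \<bar>cos (pi * x)\<bar>" using power_decreasing[of 1 2 "\<bar>cos (pi * x)\<bar>"] by simp
        then show "norm (norm (Z (of_real x)) / \<bar>cos (pi * x)\<bar>) \<le> norm (norm (Z (of_real x)) / \<bar>cos (pi * x)\<bar>\<^sup>2)"
          by (cases "cos (pi * x) = 0") (auto intro!: divide_left_mono)
      qed
    qed (use intZ in measurable)
  qed (rule isCont_entire_of_real[OF holZ])
  then obtain E0 where E0: "E0 holomorphic_on UNIV" "\<And>z. Z z = E0 z * cos (of_real pi * z)"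
    using entire_div_cos[OF holZ] by blast
  have "E0 (of_real (of_int n + 1/2)) = 0" for n :: int
  proof (rule isCont_eq_0_if_integrable_div_cos[where G = "\<lambda>x. E0 (of_real x)"])
    have *: "p * y / y\<^sup>2 = p / y" for p y :: real by (simp add: power2_eq_square)
    show "integrable lborel (\<lambda>x. norm (E0 (of_real x)) / \<bar>cos (pi * x)\<bar>)"
      using intZc unfolding E0(2) norm_mult cos_pi_of_real norm_of_real * .
  qed (rule isCont_entire_of_real[OF E0(1)])
  then obtain E where E: "E holomorphic_on UNIV" "\<And>z. E0 z = E z * cos (of_real pi * z)"
    using entire_div_cos[OF E0(1)] by blast
  have "Z z = 0" for z
    by (rule exp_type_multiple_of_cos_eq_0[OF Z _ intZ E(1)]) (auto simp: E0(2) E(2) power2_eq_square)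
  moreover have "D z = Z (z - of_real \<beta>)" by (simp add: Z_def)
  ultimately show ?thesis by simp
qed

text \<open>
  The case \<open>s = 1\<close> is about minorants, \<open>s = - 1\<close> about majorants. Let \<open>A = s * (g - F)\<close> and \<open>B = s * (g - H)\<close>,
  both nonnegative. Since \<open>F - H\<close> is integrable of type \<open>2 * pi\<close>, its integral against the Poisson
  kernel with peaks at the zeros of \<open>cos (pi * (x - \<beta>))\<close> equals its plain integral, which has a sign by
  the assumption on the distances. So \<open>B\<close> has no more mass against the kernel than \<open>A\<close>, that is
  \<open>O(1 - r)\<close>, because \<open>A\<close> is \<open>cos\<^sup>2\<close> times an integrable function. After division by \<open>1 - r\<^sup>2\<close>, Fatou's
  lemma yields the integrability of \<open>B / cos\<^sup>2\<close>, and with it that of \<open>(F - H) / cos\<^sup>2\<close>. Hence a competitor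
  that is at least as good as \<open>F\<close> is equal to \<open>F\<close>. Extremality and uniqueness are thus
  proved together.
\<close>

lemma one_sided_extremal_unique:
  fixes g J :: "real \<Rightarrow> real" and s \<beta> :: real
  assumes F: "entire_exp_type (2 * pi) F" "real_on_reals F"
    and H: "entire_exp_type (2 * pi) H" "real_on_reals H"
    and s: "s = 1 \<or> s = - 1"
    and g [measurable]: "g \<in> borel_measurable borel"
    and J: "integrable lborel J" "\<And>x. J x \<ge> 0"
    and FJ: "AE x in lborel. s * (g x - Re (F (of_real x))) = (cos (pi * (x - \<beta>)))\<^sup>2 * J x"
    and Hg: "AE x in lborel. s * (g x - Re (H (of_real x))) \<ge> 0"
    and le: "(\<integral>\<^sup>+x. ennreal \<bar>g x - Re (H (of_real x))\<bar> \<partial>lborel) \<le> (\<integral>\<^sup>+x. ennreal \<bar>g x - Re (F (of_real x))\<bar> \<partial>lborel)"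
  shows "H = F"
proof -
  note holF = entire_exp_typeD(1)[OF F(1)] and holH = entire_exp_typeD(1)[OF H(1)]
  have Re_meas: "(\<lambda>x. Re (G (of_real x))) \<in> borel_measurable borel" if "G holomorphic_on UNIV" for G
    by (intro borel_measurable_continuous_onI continuous_on_Re continuous_on_entire_of_real that)
  note [measurable] = Re_meas[OF holF] Re_meas[OF holH]
  have [measurable]: "J \<in> borel_measurable borel" using J(1) borel_measurable_integrable by fastforce
  define c where "c = (\<lambda>x. cos (pi * (x - \<beta>)))"
  have [measurable]: "c \<in> borel_measurable borel" unfolding c_def by measurable
  have c1: "(c x)\<^sup>2 \<le> 1" for x by (simp add: c_def abs_square_le_1)
  define A where "A = (\<lambda>x. s * (g x - Re (F (of_real x))))"
  define B where "B = (\<lambda>x. s * (g x - Re (H (of_real x))))"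
  have [measurable]: "A \<in> borel_measurable borel" "B \<in> borel_measurable borel"
    unfolding A_def B_def by measurable
  have AJ: "AE x in lborel. A x = (c x)\<^sup>2 * J x" using FJ by (simp add: A_def c_def)
  have B0: "AE x in lborel. B x \<ge> 0" using Hg by (simp add: B_def)
  have A0: "AE x in lborel. A x \<ge> 0" using AJ by eventually_elim (use J(2) in simp)
  have absA: "\<bar>A x\<bar> = \<bar>g x - Re (F (of_real x))\<bar>" and absB: "\<bar>B x\<bar> = \<bar>g x - Re (H (of_real x))\<bar>" for x
    using s by (auto simp: A_def B_def)
  have intA: "integrable lborel A"
  proof (rule Bochner_Integration.integrable_bound[OF J(1)])
    show "AE x in lborel. norm (A x) \<le> norm (J x)"
      using AJ
    proof eventually_elim
      case (elim x)
      have "(c x)\<^sup>2 * J x \<le> 1 * J x" by (intro mult_right_mono c1 J)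
      then show ?case using elim J(2)[of x] by simp
    qed
  qed simp
  have nnA: "(\<integral>\<^sup>+x. ennreal (A x) \<partial>lborel) = ennreal (LINT x|lborel. A x)"
    by (rule nn_integral_eq_integral[OF intA A0])
  have leAB: "(\<integral>\<^sup>+x. ennreal (norm (B x)) \<partial>lborel) \<le> (\<integral>\<^sup>+x. ennreal (norm (A x)) \<partial>lborel)"
    using le by (simp add: absA absB)
  have intB: "integrable lborel B"
    using leAB intA by (intro integrableI_bounded) (auto simp: integrable_iff_bounded)
  have LB: "(LINT x|lborel. B x) \<le> (LINT x|lborel. A x)"
  proof -
    have "ennreal (LINT x|lborel. B x) = (\<integral>\<^sup>+x. ennreal (B x) \<partial>lborel)"
      using nn_integral_eq_integral[OF intB B0] by simp
    also have "\<dots> = (\<integral>\<^sup>+x. ennreal (norm (B x)) \<partial>lborel)"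
      by (rule nn_integral_cong_AE) (use B0 in eventually_elim, simp)
    also have "\<dots> \<le> (\<integral>\<^sup>+x. ennreal (norm (A x)) \<partial>lborel)" by (rule leAB)
    also have "\<dots> = ennreal (LINT x|lborel. A x)"
      unfolding nnA[symmetric] by (rule nn_integral_cong_AE) (use A0 in eventually_elim, simp)
    finally show ?thesis using integral_nonneg_AE[OF A0] by (simp add: ennreal_le_iff)
  qed
  define d where "d = (\<lambda>x. Re (F (of_real x)) - Re (H (of_real x)))"
  have sd: "s * d x = B x - A x" for x by (simp add: d_def A_def B_def algebra_simps)
  have d: "d x = s * (B x - A x)" for x using sd[of x] s by (elim disjE) simp_all
  have intd: "integrable lborel d" unfolding d[abs_def]
    by (intro integrable_mult_right Bochner_Integration.integrable_diff intA intB)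
  define D where "D = (\<lambda>z. F z - H z)"
  have D: "entire_exp_type (2 * pi) D" unfolding D_def by (rule entire_exp_type_diff[OF F(1) H(1)])
  have Dx: "D (of_real x) = of_real (d x)" for x
    using F(2) H(2) by (simp add: D_def d_def real_on_reals_def of_real_Re)
  have intD: "integrable lborel (\<lambda>x. D (of_real x))" unfolding Dx using intd by simp
  \<comment> \<open>The Poisson kernel divided by \<open>1 - r\<^sup>2\<close>.\<close>
  define k where "k = (\<lambda>r x. 1 / ((1 - r)\<^sup>2 + 4 * r * (c x)\<^sup>2))"
  have [measurable]: "k r \<in> borel_measurable borel" for r unfolding k_def by measurable
  have k0: "k r x \<ge> 0" if "0 < r" "r < 1" for r x using that by (simp add: k_def)
  have intk: "integrable lborel (\<lambda>x. f x * k r x)"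
    if r: "0 < r" "r < 1" and f: "integrable lborel f" for r and f :: "real \<Rightarrow> real"
  proof (rule Bochner_Integration.integrable_bound)
    show "integrable lborel (\<lambda>x. (1 / (1 - r)\<^sup>2) * f x)" using f by simp
    show "AE x in lborel. norm (f x * k r x) \<le> norm ((1 / (1 - r)\<^sup>2) * f x)"
    proof (rule AE_I2)
      fix x
      have "k r x \<le> 1 / (1 - r)\<^sup>2" unfolding k_def using r by (intro divide_left_mono) (auto simp: add_pos_nonneg)
      then show "norm (f x * k r x) \<le> norm ((1 / (1 - r)\<^sup>2) * f x)"
        using k0[OF r, of x] mult_left_mono[of "k r x" "1 / (1 - r)\<^sup>2" "\<bar>f x\<bar>"] by (simp add: abs_mult)
    qed
    show "(\<lambda>x. f x * k r x) \<in> borel_measurable lborel" using f by measurable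
  qed
  have key: "(LINT x|lborel. B x * k r x) \<le> (LINT x|lborel. J x) / (4 * r)" if r: "0 < r" "r < 1" for r
  proof -
    \<comment> \<open>\<open>U = q + q\<^sup>2 + \<dots>\<close> starts with frequency \<open>2 * pi\<close>, the type of \<open>D\<close>, so \<open>D\<close> is orthogonal to it.\<close>
    define q where "q = (\<lambda>z::complex. - of_real r * exp (\<i> * (2 * pi * (z - of_real \<beta>))))"
    define U where "U = (\<lambda>z. q z / (1 - q z))"
    have nq: "norm (q z) = r * exp (- 2 * pi * Im z)" for z using r by (simp add: q_def norm_mult)
    define \<gamma> where "\<gamma> = - ln r / (2 * pi)"
    have \<gamma>: "\<gamma> > 0" using r by (simp add: \<gamma>_def field_simps)
    have holU: "U holomorphic_on {z. Im z > - \<gamma>}" unfolding U_def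
    proof (intro holomorphic_intros)
      fix z assume z: "z \<in> {z. Im z > - \<gamma>}"
      have "- 2 * pi * Im z < - ln r" using z pi_gt_zero by (simp add: \<gamma>_def field_simps)
      then have "norm (q z) < r * exp (- ln r)" unfolding nq using r by simp
      also have "\<dots> = 1" using r by (simp add: exp_minus)
      finally show "1 - q z \<noteq> 0" by auto
    qed (auto simp: q_def intro!: holomorphic_intros)
    have bdU: "norm (U z) \<le> r / (1 - r) * exp (- (2 * pi) * Im z)" if z: "Im z \<ge> 0" for z
    proof -
      have "norm (q z) \<le> r" unfolding nq using r z by (simp add: mult_left_le)
      then have "norm (1 - q z) \<ge> 1 - r" using norm_triangle_ineq2[of 1 "q z"] by simp
      then have "norm (U z) \<le> r * exp (- 2 * pi * Im z) / (1 - r)"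
        unfolding U_def norm_divide nq using r by (intro frac_le) auto
      then show ?thesis by simp
    qed
    note orth = exp_type_orthogonal_upper[OF D _ intD holU \<gamma> bdU]
    have int1: "integrable lborel (\<lambda>x. of_real (d x) * U (of_real x))" and
      z1: "(LINT x|lborel. of_real (d x) * U (of_real x)) = 0" using orth by (auto simp: Dx)
    have z2: "(LINT x|lborel. d x * Re (U (of_real x))) = 0"
      using integral_Re[OF int1] z1 by simp
    have int2: "integrable lborel (\<lambda>x. d x * Re (U (of_real x)))"
      using integrable_Re[OF int1] by simp
    have PK: "1 + 2 * Re (U (of_real x)) = (1 - r\<^sup>2) * k r x" for x
      using poisson_kernel_half_angle[OF r, of "x - \<beta>"] by (simp add: U_def q_def k_def c_def)
    have "(LINT x|lborel. (1 - r\<^sup>2) * (d x * k r x)) = (LINT x|lborel. d x + 2 * (d x * Re (U (of_real x))))"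
    proof (rule Bochner_Integration.integral_cong[OF refl])
      fix x
      show "(1 - r\<^sup>2) * (d x * k r x) = d x + 2 * (d x * Re (U (of_real x)))"
        using arg_cong[OF PK[of x], of "\<lambda>y. d x * y"] by (simp add: algebra_simps)
    qed
    also have "\<dots> = (LINT x|lborel. d x)"
      using intd int2 z2 by (subst Bochner_Integration.integral_add) auto
    finally have e1: "s * ((1 - r\<^sup>2) * (LINT x|lborel. d x * k r x)) = s * (LINT x|lborel. d x)" by simp
    have e2: "s * (LINT x|lborel. d x) = (LINT x|lborel. B x) - (LINT x|lborel. A x)"
      using intA intB by (simp flip: Bochner_Integration.integral_diff integral_mult_right_zero add: sd)
    have e3: "s * (LINT x|lborel. d x * k r x) = (LINT x|lborel. B x * k r x) - (LINT x|lborel. A x * k r x)"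
    proof -
      have "s * (LINT x|lborel. d x * k r x) = (LINT x|lborel. s * d x * k r x)"
        by (simp add: mult.assoc)
      also have "\<dots> = (LINT x|lborel. B x * k r x - A x * k r x)"
        by (simp add: sd left_diff_distrib)
      also have "\<dots> = (LINT x|lborel. B x * k r x) - (LINT x|lborel. A x * k r x)"
        by (intro Bochner_Integration.integral_diff intk r intA intB)
      finally show ?thesis .
    qed
    have "(1 - r\<^sup>2) * ((LINT x|lborel. B x * k r x) - (LINT x|lborel. A x * k r x)) \<le> 0"
      unfolding e3[symmetric] mult.left_commute[of _ s] e1 e2 using LB by simp
    moreover have "1 - r\<^sup>2 > 0" using r by (simp add: power_less_one_iff)
    ultimately have "(LINT x|lborel. B x * k r x) \<le> (LINT x|lborel. A x * k r x)"
      by (simp add: mult_le_0_iff)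
    also have "\<dots> \<le> (LINT x|lborel. J x / (4 * r))"
    proof (rule integral_mono_AE)
      show "AE x in lborel. A x * k r x \<le> J x / (4 * r)"
        using AJ
      proof eventually_elim
        case (elim x)
        have "(c x)\<^sup>2 * k r x \<le> 1 / (4 * r)"
        proof (cases "c x = 0")
          case False
          have "(c x)\<^sup>2 * k r x = (c x)\<^sup>2 / ((1 - r)\<^sup>2 + 4 * r * (c x)\<^sup>2)" by (simp add: k_def)
          also have "\<dots> \<le> (c x)\<^sup>2 / (4 * r * (c x)\<^sup>2)" using r False by (intro divide_left_mono) (auto simp: add_nonneg_pos)
          finally show ?thesis using False by simp
        qed (use r in simp)
        then have "J x * ((c x)\<^sup>2 * k r x) \<le> J x * (1 / (4 * r))" by (rule mult_left_mono) (rule J)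
        then show ?case by (simp add: elim mult_ac)
      qed
    qed (use intk[OF r intA] J(1) in auto)
    finally show ?thesis by simp
  qed
  define r where "r = (\<lambda>n::nat. 1 - 1 / (real n + 2))"
  have r: "0 < r n" "r n < 1" "1/2 \<le> r n" for n by (auto simp: r_def field_simps)
  have r_lim: "r \<longlonglongrightarrow> 1" unfolding r_def by real_asymp
  define IJ where "IJ = (LINT x|lborel. J x)"
  have IJ: "IJ \<ge> 0" unfolding IJ_def using J(2) by (intro integral_nonneg_AE) auto
  have "(\<integral>\<^sup>+x. ennreal (B x / (4 * (c x)\<^sup>2)) \<partial>lborel) \<le> (\<integral>\<^sup>+x. liminf (\<lambda>n. ennreal (B x * k (r n) x)) \<partial>lborel)"
  proof (rule nn_integral_mono)
    fix x :: real
    show "ennreal (B x / (4 * (c x)\<^sup>2)) \<le> liminf (\<lambda>n. ennreal (B x * k (r n) x))"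
    proof (cases "c x = 0")
      case False
      have "(\<lambda>n. B x * k (r n) x) \<longlonglongrightarrow> B x * (1 / ((1 - 1)\<^sup>2 + 4 * 1 * (c x)\<^sup>2))"
        unfolding k_def using False by (intro tendsto_intros r_lim) auto
      then have "(\<lambda>n. ennreal (B x * k (r n) x)) \<longlonglongrightarrow> ennreal (B x / (4 * (c x)\<^sup>2))"
        by (intro tendsto_ennrealI) simp
      then show ?thesis by (simp add: lim_imp_Liminf)
    qed simp
  qed
  also have "\<dots> \<le> liminf (\<lambda>n. \<integral>\<^sup>+x. ennreal (B x * k (r n) x) \<partial>lborel)"
    by (rule nn_integral_liminf) measurable
  also have "\<dots> \<le> liminf (\<lambda>n::nat. ennreal IJ)"
  proof (intro Liminf_mono always_eventually allI)
    fix n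
    have "(\<integral>\<^sup>+x. ennreal (B x * k (r n) x) \<partial>lborel) = ennreal (LINT x|lborel. B x * k (r n) x)"
      using B0 by (intro nn_integral_eq_integral intk r intB) (auto elim!: eventually_mono intro!: mult_nonneg_nonneg k0 r)
    also have "\<dots> \<le> ennreal IJ"
    proof (rule ennreal_leI)
      have "IJ / (4 * r n) \<le> IJ / 1" using r(3)[of n] IJ by (intro divide_left_mono) auto
      with key[OF r(1,2), of n] show "(LINT x|lborel. B x * k (r n) x) \<le> IJ" by (simp add: IJ_def)
    qed
    finally show "(\<integral>\<^sup>+x. ennreal (B x * k (r n) x) \<partial>lborel) \<le> ennreal IJ" .
  qed
  also have "\<dots> = ennreal IJ" by (rule Liminf_const) simp
  also have "\<dots> < \<infinity>" by simp
  finally have fin: "(\<integral>\<^sup>+x. ennreal (B x / (4 * (c x)\<^sup>2)) \<partial>lborel) < \<infinity>" .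
  have intB': "integrable lborel (\<lambda>x. B x / (4 * (c x)\<^sup>2))"
    using fin B0 by (intro integrableI_nonneg) (auto elim!: eventually_mono)
  have intDc: "integrable lborel (\<lambda>x. norm (D (of_real x)) / (c x)\<^sup>2)"
  proof (rule Bochner_Integration.integrable_bound)
    show "integrable lborel (\<lambda>x. J x + 4 * (B x / (4 * (c x)\<^sup>2)))"
      by (intro Bochner_Integration.integrable_add integrable_mult_right J(1) intB')
    show "AE x in lborel. norm (norm (D (of_real x)) / (c x)\<^sup>2) \<le> norm (J x + 4 * (B x / (4 * (c x)\<^sup>2)))"
      using AJ B0
    proof eventually_elim
      case (elim x)
      have "\<bar>d x\<bar> \<le> \<bar>B x\<bar> + \<bar>A x\<bar>" using sd[of x] s by auto
      then have "\<bar>d x\<bar> / (c x)\<^sup>2 \<le> (B x + (c x)\<^sup>2 * J x) / (c x)\<^sup>2"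
        using elim J(2)[of x] by (intro divide_right_mono) auto
      also have "\<dots> \<le> J x + B x / (c x)\<^sup>2" using J(2)[of x] by (cases "c x = 0") (auto simp: add_divide_distrib)
      finally show ?case using elim J(2)[of x] by (simp add: Dx)
    qed
    show "(\<lambda>x. norm (D (of_real x)) / (c x)\<^sup>2) \<in> borel_measurable lborel" using intD by measurable
  qed
  have "D z = 0" for z
    by (rule exp_type_eq_0_if_integrable_div_cos_squared[OF D intD]) (use intDc in \<open>simp add: c_def\<close>)
  then show "H = F" by (auto simp: D_def)
qed

section \<open>The square wave and uniqueness for best approximation\<close>

lemma one_plus_minus_i_mult_ne_0:
  assumes "norm w < 1"
  shows "1 + \<i> * w \<noteq> 0" "1 - \<i> * w \<noteq> 0"
  using assms norm_diff_ineq[of 1 "\<i> * w"] norm_triangle_ineq2[of 1 "\<i> * w"] by (auto simp: norm_mult)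

text \<open>
  \<open>- 2 * Re (Arctan w)\<close> is the argument of \<open>(1 - \<i> * w) / (1 + \<i> * w)\<close>, which lies in the right half-plane.
\<close>

lemma Re_Arctan_unit_disc:
  assumes "norm w < 1"
  shows "Re (Arctan w) = arctan (2 * Re w / (1 - (norm w)\<^sup>2)) / 2"
proof -
  have n2: "(norm w)\<^sup>2 < 1" using assms by (simp add: power_less_one_iff)
  have nz: "1 + \<i> * w \<noteq> 0" by (rule one_plus_minus_i_mult_ne_0[OF assms])
  define N where "N = (norm (1 + \<i> * w))\<^sup>2"
  have N: "N > 0" using nz by (simp add: N_def)
  define \<zeta> where "\<zeta> = (1 - \<i> * w) / (1 + \<i> * w)"
  have \<zeta>: "\<zeta> = ((1 - \<i> * w) * cnj (1 + \<i> * w)) / of_real N"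
    unfolding \<zeta>_def N_def using complex_div_cnj[of "1 - \<i> * w" "1 + \<i> * w"] by simp
  have Re: "Re \<zeta> = (1 - (norm w)\<^sup>2) / N"
    unfolding \<zeta> Re_divide_of_real cmod_power2[of w] by (simp add: power2_eq_square algebra_simps)
  have Im: "Im \<zeta> = - (2 * Re w) / N"
    unfolding \<zeta> Im_divide_of_real by (simp add: algebra_simps)
  have pos: "Re \<zeta> > 0" unfolding Re using n2 N by simp
  then have nz\<zeta>: "\<zeta> \<noteq> 0" by auto
  have "Re (Arctan w) = - Im (Ln \<zeta>) / 2" by (simp add: Arctan_def \<zeta>_def)
  also have "Im (Ln \<zeta>) = arctan (Im \<zeta> / Re \<zeta>)"
    using Arg_eq_Im_Ln[OF nz\<zeta>] arg_conv_arctan[OF pos] by simp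
  also have "Im \<zeta> / Re \<zeta> = - (2 * Re w / (1 - (norm w)\<^sup>2))" unfolding Re Im using N by simp
  finally show ?thesis by (simp add: arctan_minus)
qed

lemma cnj_Arctan_unit_disc:
  assumes "norm w < 1"
  shows "cnj (Arctan w) = Arctan (cnj w)"
proof -
  have "Re ((1 - \<i> * w) * cnj (1 + \<i> * w)) = 1 - (norm w)\<^sup>2"
    unfolding cmod_power2[of w] by (simp add: power2_eq_square algebra_simps)
  moreover have "(norm w)\<^sup>2 < 1" using assms by (simp add: power_less_one_iff)
  ultimately have "Re ((1 - \<i> * w) / (1 + \<i> * w)) > 0"
    using one_plus_minus_i_mult_ne_0[OF assms] unfolding complex_div_cnj[of "1 - \<i> * w"] by (simp add: Re_divide_of_real del: times_complex.sel complex_cnj_add flip: of_real_power)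
  then have nn: "(1 - \<i> * w) / (1 + \<i> * w) \<notin> \<real>\<^sub>\<le>\<^sub>0" by (auto simp: complex_nonpos_Reals_iff)
  have "cnj (Arctan w) = - (\<i> / 2) * cnj (Ln ((1 - \<i> * w) / (1 + \<i> * w)))" by (simp add: Arctan_def)
  also have "cnj (Ln ((1 - \<i> * w) / (1 + \<i> * w))) = - cnj (Ln (inverse ((1 - \<i> * w) / (1 + \<i> * w))))"
    using Ln_inverse[OF nn] by simp
  also have "cnj (Ln (inverse ((1 - \<i> * w) / (1 + \<i> * w)))) = Ln (cnj (inverse ((1 - \<i> * w) / (1 + \<i> * w))))"
    by (rule cnj_Ln) (use nn in \<open>simp only: nonpos_Reals_inverse_iff not_False_eq_True\<close>)
  also have "cnj (inverse ((1 - \<i> * w) / (1 + \<i> * w))) = (1 - \<i> * cnj w) / (1 + \<i> * cnj w)"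
    by simp
  finally show ?thesis by (simp add: Arctan_def)
qed

text \<open>
  The derivative \<open>1 / (1 + w\<^sup>2)\<close> of \<open>Arctan\<close> is at most \<open>1 / (1 - r\<^sup>2)\<close> on the disc of radius \<open>r\<close>.
\<close>

lemma norm_Arctan_le:
  assumes r: "norm w \<le> r" "r < 1"
  shows "norm (Arctan w) \<le> norm w / (1 - r\<^sup>2)"
proof -
  have r0: "r \<ge> 0" using order_trans[OF norm_ge_zero r(1)] .
  have r2: "r\<^sup>2 < 1" using r0 r by (simp add: power_less_one_iff)
  have "norm (Arctan w - Arctan 0) \<le> (1 / (1 - r\<^sup>2)) * norm (w - 0)"
  proof (rule field_differentiable_bound[of "cball 0 r"])
    fix z :: complex assume z: "z \<in> cball 0 r"
    have nz: "norm z \<le> r" using z by simp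
    have "Re z = 0 \<Longrightarrow> \<bar>Im z\<bar> < 1" using abs_Im_le_cmod[of z] nz r by linarith
    from has_field_derivative_Arctan[OF this]
    show "(Arctan has_field_derivative inverse (1 + z\<^sup>2)) (at z within cball 0 r)"
      by (rule has_field_derivative_at_within)
    have "(norm z)\<^sup>2 \<le> r\<^sup>2" using nz by (intro power_mono) auto
    then have "norm (1 + z\<^sup>2) \<ge> 1 - r\<^sup>2"
      using norm_diff_ineq[of 1 "z\<^sup>2"] by (simp add: norm_power)
    then show "norm (inverse (1 + z\<^sup>2)) \<le> 1 / (1 - r\<^sup>2)"
      unfolding norm_inverse using r2 by (simp only: inverse_eq_divide) (intro frac_le, auto)
  qed (use r r0 in auto)
  then show ?thesis by simp
qed

text \<open>
  The power series of \<open>Arctan\<close> shows that this is the Abel mean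
  \<open>\<Sum>n. (- 1) ^ n / (2 * n + 1) * r ^ (2 * n + 1) * cos ((2 * n + 1) * pi * x)\<close> of the Fourier series of
  \<open>pi / 4 * sgn (cos (pi * x))\<close>. The closed form gives a uniform bound and the limit for \<open>r\<close> to \<open>1\<close>.
\<close>

lemma arctan_square_wave:
  fixes r x :: real
  assumes "0 < r" "r < 1"
  shows "Re (Arctan (of_real r * exp (\<i> * of_real (pi * x)))) = arctan (2 * r * cos (pi * x) / (1 - r\<^sup>2)) / 2"
  using Re_Arctan_unit_disc[of "of_real r * exp (\<i> * of_real (pi * x))"] assms
  by (simp add: norm_mult Re_exp mult.assoc)

lemma arctan_square_wave_tendsto:
  fixes r :: "nat \<Rightarrow> real"
  assumes r: "\<And>n. 0 < r n" "\<And>n. r n < 1" "r \<longlonglongrightarrow> 1"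
  shows "(\<lambda>n. arctan (2 * r n * c / (1 - (r n)\<^sup>2)) / 2) \<longlonglongrightarrow> pi / 4 * sgn c"
proof -
  have "(\<lambda>n. 1 - (r n)\<^sup>2) \<longlonglongrightarrow> 1 - 1\<^sup>2" by (intro tendsto_intros r)
  moreover have "1 - (r n)\<^sup>2 > 0" for n using r(1,2)[of n] by (simp add: power_less_one_iff)
  ultimately have inv: "LIM n sequentially. inverse (1 - (r n)\<^sup>2) :> at_top"
    by (intro filterlim_inverse_at_top) (auto intro!: always_eventually)
  have lim2: "(\<lambda>n. 2 * r n * c) \<longlonglongrightarrow> 2 * 1 * c" by (intro tendsto_intros r)
  consider "c > 0" | "c < 0" | "c = 0" by linarith
  then show ?thesis
  proof cases
    case 1
    have "LIM n sequentially. (2 * r n * c) / (1 - (r n)\<^sup>2) :> at_top"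
      unfolding divide_inverse by (rule filterlim_tendsto_pos_mult_at_top[OF lim2 _ inv]) (use 1 in simp)
    from tendsto_divide[OF filterlim_compose[OF tendsto_arctan_at_top this] tendsto_const, of 2]
    have "(\<lambda>n. arctan ((2 * r n * c) / (1 - (r n)\<^sup>2)) / 2) \<longlonglongrightarrow> (pi / 2) / 2" by simp
    then show ?thesis using 1 by simp
  next
    case 2
    have "LIM n sequentially. (2 * r n * c) / (1 - (r n)\<^sup>2) :> at_bot"
      unfolding divide_inverse by (rule filterlim_tendsto_neg_mult_at_bot[OF lim2 _ inv]) (use 2 in simp)
    from tendsto_divide[OF filterlim_compose[OF tendsto_arctan_at_bot this] tendsto_const, of 2]
    have "(\<lambda>n. arctan ((2 * r n * c) / (1 - (r n)\<^sup>2)) / 2) \<longlonglongrightarrow> (- (pi / 2)) / 2" by simp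
    then show ?thesis using 2 by simp
  qed simp
qed

lemma holomorphic_arctan_exp:
  fixes r :: real
  assumes r: "0 < r" "r < 1"
  shows "(\<lambda>z. Arctan (of_real r * exp (\<i> * (of_real pi * z)))) holomorphic_on {z. Im z > - (- ln r / pi)}"
    and "\<And>z. Im z \<ge> 0 \<Longrightarrow> norm (Arctan (of_real r * exp (\<i> * (of_real pi * z)))) \<le> r / (1 - r\<^sup>2) * exp (- pi * Im z)"
proof -
  define w where "w = (\<lambda>z. of_real r * exp (\<i> * (of_real pi * z)))"
  have nw: "norm (w z) = r * exp (- pi * Im z)" for z using r by (simp add: w_def norm_mult)
  have "norm (w z) < 1" if "Im z > - (- ln r / pi)" for z
  proof -
    have "- pi * Im z < - ln r" using that by (simp add: field_simps)
    then have "norm (w z) < r * exp (- ln r)" unfolding nw using r by simp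
    also have "\<dots> = 1" using r by (simp add: exp_minus)
    finally show ?thesis .
  qed
  then have sub: "w ` {z. Im z > - (- ln r / pi)} \<subseteq> ball 0 1" by auto
  have "Arctan holomorphic_on ball 0 1"
  proof (rule holomorphic_on_Arctan)
    fix z :: complex assume "z \<in> ball 0 1"
    then show "\<bar>Im z\<bar> < 1" using abs_Im_le_cmod[of z] by simp
  qed
  from holomorphic_on_compose_gen[OF _ this sub]
  have "(Arctan \<circ> w) holomorphic_on {z. Im z > - (- ln r / pi)}"
    unfolding w_def by (simp add: holomorphic_intros)
  then show "(\<lambda>z. Arctan (of_real r * exp (\<i> * (of_real pi * z)))) holomorphic_on {z. Im z > - (- ln r / pi)}"
    by (simp add: o_def w_def)
  fix z :: complex assume "Im z \<ge> 0"
  then have "norm (w z) \<le> r" unfolding nw using r by (simp add: mult_left_le)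
  from norm_Arctan_le[OF this r(2)] have "norm (Arctan (w z)) \<le> r * exp (- pi * Im z) / (1 - r\<^sup>2)"
    unfolding nw .
  then show "norm (Arctan (of_real r * exp (\<i> * (of_real pi * z)))) \<le> r / (1 - r\<^sup>2) * exp (- pi * Im z)"
    by (simp add: w_def)
qed

text \<open>
  The Abel means of the square wave are combinations of \<open>Arctan (r * exp (\<i> * pi * x))\<close> and of its conjugate,
  the same function at \<open>- x\<close>. The first is orthogonal to \<open>D\<close> by a contour shift to the upper half-plane,
  the second because \<open>D (- z)\<close> has the same type. Dominated convergence gives the limit.
\<close>

lemma exp_type_pi_orthogonal_sgn_cos:
  assumes D: "entire_exp_type pi D" and int: "integrable lborel (\<lambda>x. D (of_real x))"
  shows "(LINT x|lborel. D (of_real x) * of_real (sgn (cos (pi * x)))) = 0"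
proof -
  have [measurable]: "(\<lambda>x. D (of_real x)) \<in> borel_measurable borel"
    using int borel_measurable_integrable by fastforce
  define h where "h = (\<lambda>r x. arctan (2 * r * cos (pi * x) / (1 - r\<^sup>2)) / 2)"
  have h_le: "\<bar>h r x\<bar> \<le> 1" for r x
    unfolding h_def using arctan_bounded[of "2 * r * cos (pi * x) / (1 - r\<^sup>2)"] pi_less_4 by (auto simp: abs_le_iff)
  have zero: "(LINT x|lborel. D (of_real x) * of_real (h r x)) = 0" if r: "0 < r" "r < 1" for r
  proof -
    define U where "U = (\<lambda>z. Arctan (of_real r * exp (\<i> * (of_real pi * z))))"
    have c: "- ln r / pi > 0" using r by (simp add: field_simps)
    have U1: "U holomorphic_on {z. Im z > - (- ln r / pi)}"
      and U2: "\<And>z. Im z \<ge> 0 \<Longrightarrow> norm (U z) \<le> r / (1 - r\<^sup>2) * exp (- pi * Im z)"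
      unfolding U_def by (rule holomorphic_arctan_exp[OF r]; assumption?)+
    have int': "integrable lborel (\<lambda>x. D (- of_real x))"
      using lborel_integrable_real_affine[OF int, of "-1" 0] by simp
    note o1 = exp_type_orthogonal_upper[OF D pi_ge_zero int U1 c U2]
    note o2 = exp_type_orthogonal_upper[OF entire_exp_type_reflect[OF D] pi_ge_zero int' U1 c U2]
    have "(LINT x|lborel. D (of_real x) * U (- of_real x)) = (LINT x|lborel. D (- of_real x) * U (of_real x))"
      using lborel_integral_real_affine[of "-1" "\<lambda>x. D (of_real x) * U (- of_real x)" 0] by simp
    then have z2: "(LINT x|lborel. D (of_real x) * U (- of_real x)) = 0" using o2(2) by simp
    have i2: "integrable lborel (\<lambda>x. D (of_real x) * U (- of_real x))"
      using lborel_integrable_real_affine[OF o2(1), of "-1" 0] by simp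
    have *: "U (of_real x) + U (- of_real x) = 2 * of_real (h r x)" for x
    proof -
      have "norm (of_real r * exp (\<i> * (of_real pi * of_real x))) < 1" using r by (simp add: norm_mult)
      from cnj_Arctan_unit_disc[OF this]
      have "cnj (U (of_real x)) = U (- of_real x)" by (simp add: U_def exp_cnj)
      then have "U (of_real x) + U (- of_real x) = of_real (2 * Re (U (of_real x)))"
        using complex_add_cnj[of "U (of_real x)"] by simp
      also have "Re (U (of_real x)) = h r x"
        using arctan_square_wave[OF r, of x] by (simp add: U_def h_def)
      finally show ?thesis by simp
    qed
    have "2 * (LINT x|lborel. D (of_real x) * of_real (h r x)) =
        (LINT x|lborel. D (of_real x) * U (of_real x) + D (of_real x) * U (- of_real x))"
      by (subst distrib_left[symmetric], subst *) (simp add: mult.left_commute[of _ 2])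
    also have "\<dots> = 0" using o1 i2 z2 by (subst Bochner_Integration.integral_add) auto
    finally show ?thesis by simp
  qed
  define r where "r = (\<lambda>n::nat. 1 - 1 / (real n + 2))"
  have r: "0 < r n" "r n < 1" for n by (auto simp: r_def field_simps)
  have r_lim: "r \<longlonglongrightarrow> 1" unfolding r_def by real_asymp
  have "(\<lambda>n. LINT x|lborel. D (of_real x) * of_real (h (r n) x)) \<longlonglongrightarrow>
      (LINT x|lborel. D (of_real x) * of_real (pi / 4 * sgn (cos (pi * x))))"
  proof (rule integral_dominated_convergence)
    show "integrable lborel (\<lambda>x. norm (D (of_real x)))" using int by simp
    show "AE x in lborel. (\<lambda>n. D (of_real x) * of_real (h (r n) x)) \<longlonglongrightarrow> D (of_real x) * of_real (pi / 4 * sgn (cos (pi * x)))"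
      unfolding h_def by (intro AE_I2 tendsto_intros arctan_square_wave_tendsto r r_lim)
    show "AE x in lborel. norm (D (of_real x) * of_real (h (r n) x)) \<le> norm (D (of_real x))" for n
      using h_le[of "r n"] by (auto simp: norm_mult intro!: mult_left_le)
  qed (auto simp: h_def)
  moreover have "(\<lambda>n. LINT x|lborel. D (of_real x) * of_real (h (r n) x)) = (\<lambda>n. 0)"
    using zero r by auto
  ultimately have "(LINT x|lborel. D (of_real x) * of_real (pi / 4 * sgn (cos (pi * x)))) = 0"
    by (simp only: LIMSEQ_const_iff)
  then have "(LINT x|lborel. of_real (pi / 4) * (D (of_real x) * of_real (sgn (cos (pi * x))))) = 0"
    by (simp add: mult_ac)
  then show ?thesis by simp
qed

lemma sgn_cos_sign_change:
  fixes n :: int and t :: real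
  assumes "0 < t" "t < 1"
  shows "sgn (cos (pi * (of_int n + 1/2 - t))) = - sgn (cos (pi * (of_int n + 1/2 + t)))"
    and "sgn (cos (pi * (of_int n + 1/2 + t))) = sgn (cos (pi * (of_int n + 1)))"
proof -
  have s: "sin (pi * t) > 0" using assms by (intro sin_gt_zero) auto
  have "cos (pi * (of_int n + 1/2 + t)) = - (sin (pi * (of_int n + 1/2)) * sin (pi * t))"
    unfolding distrib_left[of pi _ t] cos_add cos_pi_half_int by simp
  moreover have "cos (pi * (of_int n + 1/2 - t)) = sin (pi * (of_int n + 1/2)) * sin (pi * t)"
    unfolding right_diff_distrib[of pi _ t] cos_diff cos_pi_half_int by simp
  moreover have "cos (pi * (of_int n + 1)) = - sin (pi * (of_int n + 1/2))"
  proof -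
    have "pi * (of_int n + 1) = pi * (of_int n + 1/2) + pi / 2" by (simp add: algebra_simps)
    then show ?thesis by (simp only: cos_add) simp
  qed
  ultimately show "sgn (cos (pi * (of_int n + 1/2 - t))) = - sgn (cos (pi * (of_int n + 1/2 + t)))"
    "sgn (cos (pi * (of_int n + 1/2 + t))) = sgn (cos (pi * (of_int n + 1)))"
    using s by (simp_all add: sgn_mult sgn_minus)
qed

text \<open>
  The square wave changes sign at \<open>n + 1/2\<close>. If \<open>f\<close> were nonzero there, it would have nearly the same value at
  points on both sides where \<open>f\<close> is a positive multiple of \<open>\<sigma>\<close> and of \<open>- \<sigma>\<close>, respectively.
\<close>

lemma eq_0_if_sgn_cos_aligned:
  fixes f :: "real \<Rightarrow> complex" and n :: int
  assumes cont: "isCont f (of_int n + 1/2)"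
    and al: "AE x in lborel. f x * of_real (sgn (cos (pi * x))) = of_real (norm (f x))"
  shows "f (of_int n + 1/2) = 0"
proof (rule ccontr)
  define x0 where "x0 = real_of_int n + 1/2"
  assume "f (of_int n + 1/2) \<noteq> 0"
  then have pos: "norm (f x0) / 2 > 0" by (simp add: x0_def)
  then obtain d where d: "d > 0" "\<And>x. dist x x0 < d \<Longrightarrow> dist (f x) (f x0) < norm (f x0) / 2"
    using cont unfolding continuous_at_eps_delta x0_def[symmetric] by blast
  define \<delta> where "\<delta> = min d 1"
  have \<delta>: "0 < \<delta>" "\<delta> \<le> d" "\<delta> \<le> 1" using d by (auto simp: \<delta>_def)
  have ex: "\<exists>t\<in>{0<..<\<delta>}. f (x0 + \<sigma> * t) * of_real (sgn (cos (pi * (x0 + \<sigma> * t)))) = of_real (norm (f (x0 + \<sigma> * t)))"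
    if \<sigma>: "\<sigma> = 1 \<or> \<sigma> = - 1" for \<sigma> :: real
  proof (rule ccontr)
    assume no: "\<not> ?thesis"
    define I where "I = (\<lambda>t. x0 + \<sigma> * t) ` {0<..<\<delta>}"
    have I: "I = {x0<..<x0 + \<delta>} \<or> I = {x0 - \<delta><..<x0}"
    proof (cases "\<sigma> = 1")
      case True
      have "I = {x0<..<x0 + \<delta>}"
      proof (intro set_eqI iffI)
        fix y assume "y \<in> {x0<..<x0 + \<delta>}"
        then show "y \<in> I" unfolding I_def True by (intro image_eqI[of _ _ "y - x0"]) auto
      qed (auto simp: I_def True)
      then show ?thesis ..
    next
      case False
      with \<sigma> have s: "\<sigma> = -1" by simp
      have "I = {x0 - \<delta><..<x0}"
      proof (intro set_eqI iffI)
        fix y assume "y \<in> {x0 - \<delta><..<x0}"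
        then show "y \<in> I" unfolding I_def s by (intro image_eqI[of _ _ "x0 - y"]) auto
      qed (auto simp: I_def s)
      then show ?thesis ..
    qed
    from al have "AE x in lborel. x \<notin> I"
      by eventually_elim (use no in \<open>auto simp: I_def\<close>)
    then have "I \<in> null_sets lborel" using I by (intro AE_iff_null_sets[THEN iffD2]) auto
    then have "emeasure lborel I = 0" by blast
    with I \<delta> show False by auto
  qed
  from ex[of 1] obtain t where t: "0 < t" "t < \<delta>"
    "f (x0 + t) * of_real (sgn (cos (pi * (x0 + t)))) = of_real (norm (f (x0 + t)))" by auto
  from ex[of "-1"] obtain u where u: "0 < u" "u < \<delta>"
    "f (x0 - u) * of_real (sgn (cos (pi * (x0 - u)))) = of_real (norm (f (x0 - u)))" by auto
  define \<sigma> where "\<sigma> = sgn (cos (pi * (of_int n + 1)))"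
  have st: "sgn (cos (pi * (x0 + t))) = \<sigma>" and su: "sgn (cos (pi * (x0 - u))) = - \<sigma>"
    using sgn_cos_sign_change[of t n] sgn_cos_sign_change[of u n] t u \<delta> by (auto simp: x0_def \<sigma>_def)
  have d1: "dist (f (x0 + t)) (f x0) < norm (f x0) / 2"
    using t \<delta> by (intro d) (auto simp: dist_real_def)
  have d2: "dist (f (x0 - u)) (f x0) < norm (f x0) / 2"
    using u \<delta> by (intro d) (auto simp: dist_real_def)
  have n1: "norm (f (x0 + t)) > norm (f x0) / 2"
    using d1 norm_triangle_ineq2[of "f x0" "f (x0 + t)"] by (simp add: dist_norm norm_minus_commute)
  have n2: "norm (f (x0 - u)) > norm (f x0) / 2"
    using d2 norm_triangle_ineq2[of "f x0" "f (x0 - u)"] by (simp add: dist_norm norm_minus_commute)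
  have "f (x0 + t) * of_real \<sigma> - f (x0 - u) * of_real \<sigma> = of_real (norm (f (x0 + t)) + norm (f (x0 - u)))"
    unfolding of_real_add t(3)[unfolded st, symmetric] u(3)[unfolded su, symmetric] by simp
  then have "norm ((f (x0 + t) - f (x0 - u)) * of_real \<sigma>) = norm (f (x0 + t)) + norm (f (x0 - u))"
    by (simp add: left_diff_distrib del: of_real_add)
  moreover have "norm ((f (x0 + t) - f (x0 - u)) * of_real \<sigma>) \<le> norm (f (x0 + t) - f (x0 - u))"
    unfolding norm_mult by (rule mult_left_le) (auto simp: \<sigma>_def sgn_if)
  moreover have "norm (f (x0 + t) - f (x0 - u)) \<le> dist (f (x0 + t)) (f x0) + dist (f (x0 - u)) (f x0)"
    using dist_triangle2[of "f (x0 + t)" "f (x0 - u)" "f x0"] by (simp add: dist_norm)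
  ultimately show False using d1 d2 n1 n2 pos by linarith
qed

text \<open>
  Let \<open>a = g - k\<close> and \<open>b = g - H\<close>. Since \<open>k - H\<close> is orthogonal to the square wave \<open>\<sigma>\<close>,
  \<open>\<integral>b * \<sigma> = \<integral>a * \<sigma> = \<integral>\<bar>a\<bar>\<close>, so \<open>\<integral>\<bar>b\<bar> \<le> \<integral>\<bar>a\<bar>\<close> is possible only if \<open>b * \<sigma> = \<bar>b\<bar>\<close> almost everywhere. Then both
  \<open>a\<close> and \<open>b\<close> vanish at the jumps of \<open>\<sigma>\<close>, and so does \<open>k - H\<close>, which is therefore a multiple of the cosine.
\<close>

lemma best_approximation_unique:
  fixes g J :: "real \<Rightarrow> real"
  assumes k: "entire_exp_type pi k" and H: "entire_exp_type pi H"
    and g [measurable]: "g \<in> borel_measurable borel"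
    and cont: "\<And>n::int. isCont g (of_int n + 1/2)"
    and J: "integrable lborel J" "\<And>x. J x \<ge> 0"
    and kJ: "AE x in lborel. of_real (g x) - k (of_real x) = of_real (cos (pi * x) * J x)"
    and le: "(\<integral>\<^sup>+x. ennreal (norm (of_real (g x) - H (of_real x))) \<partial>lborel)
      \<le> (\<integral>\<^sup>+x. ennreal (norm (of_real (g x) - k (of_real x))) \<partial>lborel)"
  shows "H = k"
proof -
  note holk = entire_exp_typeD(1)[OF k] and holH = entire_exp_typeD(1)[OF H]
  note [measurable] = borel_measurable_entire_of_real[OF holk] borel_measurable_entire_of_real[OF holH]
  define a where "a = (\<lambda>x. of_real (g x) - k (of_real x))"
  define b where "b = (\<lambda>x. of_real (g x) - H (of_real x))"
  have [measurable]: "a \<in> borel_measurable borel" "b \<in> borel_measurable borel"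
    unfolding a_def b_def by measurable
  have inta: "integrable lborel a"
  proof (rule Bochner_Integration.integrable_bound[OF J(1)])
    show "AE x in lborel. norm (a x) \<le> norm (J x)" using kJ
    proof eventually_elim
      case (elim x)
      have "\<bar>cos (pi * x)\<bar> * J x \<le> 1 * J x" using J(2)[of x] by (intro mult_right_mono) auto
      then show ?case using elim J(2)[of x] by (simp add: a_def norm_mult)
    qed
  qed simp
  have leab: "(\<integral>\<^sup>+x. ennreal (norm (b x)) \<partial>lborel) \<le> (\<integral>\<^sup>+x. ennreal (norm (a x)) \<partial>lborel)"
    using le by (simp add: a_def b_def)
  have intb: "integrable lborel b"
    using leab inta by (intro integrableI_bounded) (auto simp: integrable_iff_bounded)
  have L: "(LINT x|lborel. norm (b x)) \<le> (LINT x|lborel. norm (a x))"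
  proof -
    have "ennreal (LINT x|lborel. norm (b x)) \<le> ennreal (LINT x|lborel. norm (a x))"
      using leab nn_integral_eq_integral[OF integrable_norm[OF intb]]
        nn_integral_eq_integral[OF integrable_norm[OF inta]] by simp
    then show ?thesis by (subst (asm) ennreal_le_iff) (auto intro: integral_nonneg_AE)
  qed
  define \<sigma> where "\<sigma> = (\<lambda>x. sgn (cos (pi * x)))"
  have [measurable]: "\<sigma> \<in> borel_measurable borel" unfolding \<sigma>_def by measurable
  have \<sigma>1: "\<bar>\<sigma> x\<bar> \<le> 1" for x by (simp add: \<sigma>_def sgn_if)
  have ints: "integrable lborel (\<lambda>x. f x * of_real (\<sigma> x))" if f: "integrable lborel f" for f :: "real \<Rightarrow> complex"
  proof (rule Bochner_Integration.integrable_bound[OF f])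
    show "AE x in lborel. norm (f x * of_real (\<sigma> x)) \<le> norm (f x)"
      using \<sigma>1 by (auto simp: norm_mult intro!: mult_left_le)
    show "(\<lambda>x. f x * of_real (\<sigma> x)) \<in> borel_measurable lborel" using f by measurable
  qed
  define D where "D = (\<lambda>z. k z - H z)"
  have D: "entire_exp_type pi D" unfolding D_def by (rule entire_exp_type_diff[OF k H])
  have Dx: "D (of_real x) = b x - a x" for x by (simp add: D_def a_def b_def)
  have intD: "integrable lborel (\<lambda>x. D (of_real x))" unfolding Dx
    by (rule Bochner_Integration.integrable_diff[OF intb inta])
  have al_a: "AE x in lborel. a x * of_real (\<sigma> x) = of_real (norm (a x))"
    using kJ
  proof eventually_elim
    case (elim x)
    have *: "cos (pi * x) * J x * \<sigma> x = \<bar>cos (pi * x)\<bar> * J x"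
      by (simp only: \<sigma>_def abs_sgn[of "cos (pi * x)"] mult_ac)
    show ?case
      by (simp only: a_def elim of_real_mult[symmetric] norm_of_real * abs_mult abs_of_nonneg[OF J(2)])
  qed
  have "(LINT x|lborel. D (of_real x) * of_real (\<sigma> x)) = 0"
    unfolding \<sigma>_def by (rule exp_type_pi_orthogonal_sgn_cos[OF D intD])
  then have "(LINT x|lborel. b x * of_real (\<sigma> x)) = (LINT x|lborel. a x * of_real (\<sigma> x))"
    unfolding Dx left_diff_distrib
    by (subst (asm) Bochner_Integration.integral_diff) (use ints inta intb in auto)
  also have "(LINT x|lborel. a x * of_real (\<sigma> x)) = (LINT x|lborel. of_real (norm (a x)))"
    using al_a by (intro integral_cong_AE) auto
  also have "\<dots> = of_real (LINT x|lborel. norm (a x))" by simp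
  finally have "Re (LINT x|lborel. b x * of_real (\<sigma> x)) = (LINT x|lborel. norm (a x))" by simp
  then have Rb: "(LINT x|lborel. Re (b x * of_real (\<sigma> x))) = (LINT x|lborel. norm (a x))"
    by (simp add: integral_Re[OF ints[OF intb]] del: times_complex.sel)
  have Rle: "Re (b x * of_real (\<sigma> x)) \<le> norm (b x)" for x
  proof -
    have "Re (b x * of_real (\<sigma> x)) \<le> norm (b x * of_real (\<sigma> x))" by (rule complex_Re_le_cmod)
    also have "\<dots> \<le> norm (b x)" using \<sigma>1 by (auto simp: norm_mult intro!: mult_left_le)
    finally show ?thesis .
  qed
  have intR: "integrable lborel (\<lambda>x. Re (b x * of_real (\<sigma> x)))"
    by (rule integrable_Re[OF ints[OF intb]])
  have int0: "integrable lborel (\<lambda>x. norm (b x) - Re (b x * of_real (\<sigma> x)))"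
    by (intro Bochner_Integration.integrable_diff integrable_norm intb intR)
  have "(LINT x|lborel. norm (b x) - Re (b x * of_real (\<sigma> x))) \<le> 0"
    using L Rb by (subst Bochner_Integration.integral_diff) (use intb intR in auto)
  moreover have "(LINT x|lborel. norm (b x) - Re (b x * of_real (\<sigma> x))) \<ge> 0"
    by (rule integral_nonneg_AE) (use Rle in auto)
  ultimately have "AE x in lborel. norm (b x) - Re (b x * of_real (\<sigma> x)) = 0"
    using integral_nonneg_eq_0_iff_AE[OF int0] Rle by auto
  then have al_b: "AE x in lborel. b x * of_real (\<sigma> x) = of_real (norm (b x))"
  proof eventually_elim
    case (elim x)
    define v where "v = b x * of_real (\<sigma> x)"
    have Rv: "Re v = norm (b x)" using elim by (simp add: v_def)
    have "norm v \<le> norm (b x)" using \<sigma>1 by (auto simp: v_def norm_mult intro!: mult_left_le)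
    then have "(norm v)\<^sup>2 \<le> (Re v)\<^sup>2" unfolding Rv by (intro power_mono) auto
    then have "Im v = 0" by (simp add: cmod_power2)
    then show ?case using Rv unfolding v_def[symmetric] by (simp add: complex_eq_iff)
  qed
  have "D (of_real (of_int n + 1/2)) = 0" for n :: int
  proof -
    have "isCont a (of_int n + 1/2)" "isCont b (of_int n + 1/2)"
      unfolding a_def b_def by (intro continuous_intros isCont_entire_of_real holk holH cont)+
    then have "a (of_int n + 1/2) = 0" "b (of_int n + 1/2) = 0"
      using al_a al_b unfolding \<sigma>_def by (intro eq_0_if_sgn_cos_aligned; simp)+
    then show ?thesis unfolding Dx by simp
  qed
  then obtain E where E: "E holomorphic_on UNIV" "\<And>z. D z = E z * cos (of_real pi * z)"
    using entire_div_cos[OF entire_exp_typeD(1)[OF D]] by blast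
  have "D z = 0" for z
    by (rule exp_type_multiple_of_cos_eq_0[of 1 D E]) (use D intD E in auto)
  then show ?thesis by (auto simp: D_def)
qed

section \<open>Integrals against the Cauchy density\<close>

lemma has_bochner_integral_cos_cauchy_density:
  assumes a: "a > 0" and T: "T \<ge> 0"
  shows "has_bochner_integral lborel (\<lambda>x. cos (T * x) / (x\<^sup>2 + a\<^sup>2)) (pi / a * exp (- T * a))"
proof -
  have "has_bochner_integral lborel (\<lambda>x. exp (\<i> * of_real T * of_real x) / of_real (x\<^sup>2 + a\<^sup>2))
      (of_real (pi / a) * exp (\<i> * of_real T * (\<i> * of_real a)))"
  proof (rule poisson_formula_upper[where U = "\<lambda>z. exp (\<i> * of_real T * z)" and c = 1 and K = 1])
    show "norm (exp (\<i> * of_real T * z)) \<le> 1" if "Im z \<ge> 0" for z using that T by simp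
  qed (use a in \<open>auto intro!: holomorphic_intros\<close>)
  from has_bochner_integral_Re[OF this]
  show ?thesis by (simp add: Re_exp Re_divide_of_real del: of_real_add of_real_power of_real_divide)
qed

lemma has_bochner_integral_one_plus_cos_cauchy_density:
  assumes a: "a > 0"
  shows "has_bochner_integral lborel (\<lambda>x. (1 + s * cos (2 * pi * x)) / 2 / (x\<^sup>2 + a\<^sup>2))
    (pi / (2 * a) * (1 + s * exp (- 2 * pi * a)))"
proof -
  have "has_bochner_integral lborel (\<lambda>x. (1 / (x\<^sup>2 + a\<^sup>2) + s * (cos (2 * pi * x) / (x\<^sup>2 + a\<^sup>2))) / 2)
     ((pi / a + s * (pi / a * exp (- (2 * pi) * a))) / 2)"
    by (intro has_bochner_integral_divide_zero has_bochner_integral_add has_bochner_integral_mult_right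
        has_bochner_integral_cauchy_density has_bochner_integral_cos_cauchy_density a) simp
  moreover have "(1 / A + s * (c / A)) / 2 = (1 + s * c) / 2 / A" for A c
    by (simp add: add_divide_distrib mult.commute)
  moreover have "(pi / a + s * (pi / a * exp (- (2 * pi) * a))) / 2 = pi / (2 * a) * (1 + s * exp (- 2 * pi * a))"
    using a by (simp add: field_simps)
  ultimately show ?thesis by (simp only:)
qed

lemma norm_cos_le_exp: "norm (cos z) \<le> exp \<bar>Im z\<bar>" for z :: complex
proof -
  have "cos z = (exp (\<i> * z) + exp (- (\<i> * z))) / 2" by (simp add: cos_exp_eq)
  then have "norm (cos z) = norm (exp (\<i> * z) + exp (- (\<i> * z))) / 2"
    by (simp only: norm_divide norm_numeral)
  also have "\<dots> \<le> (norm (exp (\<i> * z)) + norm (exp (- (\<i> * z)))) / 2"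
    by (intro divide_right_mono norm_triangle_ineq) simp
  also have "\<dots> \<le> (exp \<bar>Im z\<bar> + exp \<bar>Im z\<bar>) / 2" by (intro divide_right_mono add_mono) auto
  finally show ?thesis by simp
qed

text \<open>
  \<open>\<bar>cos (pi * x)\<bar>\<close> is the limit of \<open>4 / pi\<close> times the real part of \<open>U z = Arctan (r * exp (\<i> * pi * z)) * cos (pi * z)\<close> for
  real \<open>z = x\<close>. The function \<open>U\<close> is bounded in the upper half-plane, where the decay of the first factor
  compensates the growth of the second, so its integral is given by the value \<open>U (\<i> * a)\<close>.
\<close>

lemma has_bochner_integral_abs_cos_cauchy_density:
  assumes a: "a > 0"
  shows "has_bochner_integral lborel (\<lambda>x. \<bar>cos (pi * x)\<bar> / (x\<^sup>2 + a\<^sup>2)) (4 / a * arctan (exp (- pi * a)) * cosh (pi * a))"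
proof -
  define h where "h = (\<lambda>r x. arctan (2 * r * cos (pi * x) / (1 - r\<^sup>2)) / 2)"
  have h_le: "\<bar>h r x\<bar> \<le> 1" for r x
    unfolding h_def using arctan_bounded[of "2 * r * cos (pi * x) / (1 - r\<^sup>2)"] pi_less_4 by (auto simp: abs_le_iff)
  have pos: "x\<^sup>2 + a\<^sup>2 > 0" for x :: real using a by (simp add: sum_power2_gt_zero_iff)
  note P = has_bochner_integral_cauchy_density[OF a]
  have step: "has_bochner_integral lborel (\<lambda>x. h r x * cos (pi * x) / (x\<^sup>2 + a\<^sup>2))
      (pi / a * (arctan (r * exp (- pi * a)) * cosh (pi * a)))" if r: "0 < r" "r < 1" for r
  proof -
    define U where "U = (\<lambda>z. Arctan (of_real r * exp (\<i> * (of_real pi * z))))"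
    have c: "- ln r / pi > 0" using r by (simp add: field_simps)
    have U1: "U holomorphic_on {z. Im z > - (- ln r / pi)}"
      and U2: "\<And>z. Im z \<ge> 0 \<Longrightarrow> norm (U z) \<le> r / (1 - r\<^sup>2) * exp (- pi * Im z)"
      unfolding U_def by (rule holomorphic_arctan_exp[OF r]; assumption?)+
    have r2: "r / (1 - r\<^sup>2) \<ge> 0" using r by (simp add: power_less_one_iff less_imp_le)
    have "has_bochner_integral lborel (\<lambda>x. (U (of_real x) * cos (of_real pi * of_real x)) / of_real (x\<^sup>2 + a\<^sup>2))
      (of_real (pi / a) * (U (\<i> * of_real a) * cos (of_real pi * (\<i> * of_real a))))"
    proof (rule poisson_formula_upper[where U = "\<lambda>z. U z * cos (of_real pi * z)" and K = "r / (1 - r\<^sup>2)", OF _ c a])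
      show "(\<lambda>z. U z * cos (of_real pi * z)) holomorphic_on {z. - (- ln r / pi) < Im z}"
        by (intro holomorphic_intros U1)
      show "norm (U z * cos (of_real pi * z)) \<le> r / (1 - r\<^sup>2)" if z: "Im z \<ge> 0" for z
      proof -
        have "norm (U z * cos (of_real pi * z)) \<le> (r / (1 - r\<^sup>2) * exp (- pi * Im z)) * exp (pi * Im z)"
          unfolding norm_mult using norm_cos_le_exp[of "of_real pi * z"] z r2
          by (intro mult_mono U2[OF z]) (auto simp del: times_divide_eq_left intro!: mult_nonneg_nonneg)
        then show ?thesis by (simp only: mult.assoc flip: exp_add) simp
      qed
    qed
    from has_bochner_integral_Re[OF this]
    have "has_bochner_integral lborel (\<lambda>x. Re (U (of_real x)) * cos (pi * x) / (x\<^sup>2 + a\<^sup>2))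
      (pi / a * Re (U (\<i> * of_real a) * cos (of_real pi * (\<i> * of_real a))))"
      by (simp add: Re_divide_of_real cos_pi_of_real del: of_real_add of_real_power of_real_divide)
    also have "Re (U (\<i> * of_real a) * cos (of_real pi * (\<i> * of_real a))) = arctan (r * exp (- pi * a)) * cosh (pi * a)"
    proof -
      have e: "\<i> * (of_real pi * (\<i> * of_real a)) = complex_of_real (- pi * a)"
        by (simp add: complex_eq_iff)
      have "of_real r * exp (\<i> * (of_real pi * (\<i> * of_real a))) = complex_of_real (r * exp (- pi * a))"
        unfolding e exp_of_real of_real_mult[symmetric] ..
      then have 1: "U (\<i> * of_real a) = of_real (arctan (r * exp (- pi * a)))"
        unfolding U_def by (simp only: Arctan_of_real)
      have 2: "cos (of_real pi * (\<i> * of_real a)) = complex_of_real (cosh (pi * a))"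
        unfolding cos_exp_eq e of_real_minus[symmetric] exp_of_real cosh_def by (simp add: add.commute)
      show ?thesis unfolding 1 2 by simp
    qed
    also have "(\<lambda>x. Re (U (of_real x))) = h r"
      using arctan_square_wave[OF r] by (auto simp: U_def h_def)
    finally show ?thesis .
  qed
  define r where "r = (\<lambda>n::nat. 1 - 1 / (real n + 2))"
  have r: "0 < r n" "r n < 1" for n by (auto simp: r_def field_simps)
  have r_lim: "r \<longlonglongrightarrow> 1" unfolding r_def by real_asymp
  have dom: "\<bar>f\<bar> \<le> 1 \<Longrightarrow> norm (f * cos (pi * x) / (x\<^sup>2 + a\<^sup>2)) \<le> 1 / (x\<^sup>2 + a\<^sup>2)" for f x
  proof -
    assume "\<bar>f\<bar> \<le> 1"
    then have "\<bar>f\<bar> * \<bar>cos (pi * x)\<bar> \<le> 1 * 1" by (intro mult_mono) auto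
    then show ?thesis using pos[of x] by (simp add: abs_mult divide_right_mono)
  qed
  have [measurable]: "h r \<in> borel_measurable borel" for r unfolding h_def by measurable
  have DCT: "integrable lborel (\<lambda>x. (pi / 4 * sgn (cos (pi * x))) * cos (pi * x) / (x\<^sup>2 + a\<^sup>2))"
    "(\<lambda>n. LINT x|lborel. h (r n) x * cos (pi * x) / (x\<^sup>2 + a\<^sup>2)) \<longlonglongrightarrow>
      (LINT x|lborel. (pi / 4 * sgn (cos (pi * x))) * cos (pi * x) / (x\<^sup>2 + a\<^sup>2))"
  proof -
    have A: "integrable lborel (\<lambda>x. 1 / (x\<^sup>2 + a\<^sup>2))" using P by (simp add: has_bochner_integral_iff)
    have B: "AE x in lborel. (\<lambda>n. h (r n) x * cos (pi * x) / (x\<^sup>2 + a\<^sup>2)) \<longlonglongrightarrow>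
        (pi / 4 * sgn (cos (pi * x))) * cos (pi * x) / (x\<^sup>2 + a\<^sup>2)"
      unfolding h_def using pos by (intro AE_I2 tendsto_intros arctan_square_wave_tendsto r r_lim) (metis less_irrefl)
    have C: "AE x in lborel. norm (h (r n) x * cos (pi * x) / (x\<^sup>2 + a\<^sup>2)) \<le> 1 / (x\<^sup>2 + a\<^sup>2)" for n
      by (intro AE_I2 dom h_le)
    show "integrable lborel (\<lambda>x. (pi / 4 * sgn (cos (pi * x))) * cos (pi * x) / (x\<^sup>2 + a\<^sup>2))"
      by (rule integrable_dominated_convergence[OF _ _ A B C]) measurable
    show "(\<lambda>n. LINT x|lborel. h (r n) x * cos (pi * x) / (x\<^sup>2 + a\<^sup>2)) \<longlonglongrightarrow>
      (LINT x|lborel. (pi / 4 * sgn (cos (pi * x))) * cos (pi * x) / (x\<^sup>2 + a\<^sup>2))"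
      by (rule integral_dominated_convergence[OF _ _ A B C]) measurable
  qed
  have "(\<lambda>n. LINT x|lborel. h (r n) x * cos (pi * x) / (x\<^sup>2 + a\<^sup>2)) =
      (\<lambda>n. pi / a * (arctan (r n * exp (- pi * a)) * cosh (pi * a)))"
    using step[OF r] by (auto simp: has_bochner_integral_iff)
  moreover have "(\<lambda>n. pi / a * (arctan (r n * exp (- pi * a)) * cosh (pi * a))) \<longlonglongrightarrow>
      pi / a * (arctan (1 * exp (- pi * a)) * cosh (pi * a))"
    by (intro tendsto_intros r_lim)
  ultimately have val: "(LINT x|lborel. (pi / 4 * sgn (cos (pi * x))) * cos (pi * x) / (x\<^sup>2 + a\<^sup>2)) =
      pi / a * (arctan (1 * exp (- pi * a)) * cosh (pi * a))"
    using DCT(2) LIMSEQ_unique by auto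
  have "has_bochner_integral lborel (\<lambda>x. 4 / pi * ((pi / 4 * sgn (cos (pi * x))) * cos (pi * x) / (x\<^sup>2 + a\<^sup>2)))
     (4 / pi * (pi / a * (arctan (1 * exp (- pi * a)) * cosh (pi * a))))"
    by (rule has_bochner_integral_mult_right) (use DCT(1) val in \<open>simp add: has_bochner_integral_iff\<close>)
  moreover have *: "4 / pi * (pi / 4 * s * c / A) = c * s / A" for s c A :: real
    by (cases "A = 0") (auto simp: field_simps)
  moreover have **: "4 / pi * (pi / a * (arctan (1 * exp (- pi * a)) * cosh (pi * a))) =
      4 / a * arctan (exp (- pi * a)) * cosh (pi * a)" by simp
  ultimately show ?thesis by (simp only: abs_sgn * **)
qed

section \<open>Superpositions of Cauchy densities\<close>

text \<open>
  The factor \<open>J\<close> in the error \<open>\<phi> * J\<close> of the interpolation of \<open>- ln (x\<^sup>2 + \<alpha>\<^sup>2)\<close>, for the weight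
  \<open>w a = 2 * a / \<phi> (\<i> * a)\<close>.
\<close>

definition log_kernel :: "(real \<Rightarrow> real) \<Rightarrow> real \<Rightarrow> real \<Rightarrow> real" where
  "log_kernel w \<alpha> x = (LINT a|lborel. indicator {\<alpha><..} a * (w a / (x\<^sup>2 + a\<^sup>2)))"

lemma log_kernel_nonneg:
  assumes "\<And>a. a > \<alpha> \<Longrightarrow> w a \<ge> 0"
  shows "log_kernel w \<alpha> x \<ge> 0"
  unfolding log_kernel_def
  by (intro integral_nonneg_AE AE_I2) (use assms in \<open>auto simp: indicator_def\<close>)

lemma log_kernel_measurable [measurable]:
  assumes [measurable]: "w \<in> borel_measurable borel"
  shows "log_kernel w \<alpha> \<in> borel_measurable borel"
proof -
  have "(\<lambda>x. LINT a|lborel. indicator {\<alpha><..} a * (w a / (x\<^sup>2 + a\<^sup>2))) \<in> borel_measurable borel"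
    by measurable
  then show ?thesis by (simp add: log_kernel_def[abs_def])
qed

lemma nn_integral_log_kernel_swap:
  fixes v w V :: "real \<Rightarrow> real"
  assumes [measurable]: "w \<in> borel_measurable borel" "v \<in> borel_measurable borel"
    and w: "\<And>a. a > \<alpha> \<Longrightarrow> w a \<ge> 0" and v: "\<And>x. v x \<ge> 0"
    and V: "\<And>a. a > \<alpha> \<Longrightarrow> has_bochner_integral lborel (\<lambda>x. v x / (x\<^sup>2 + a\<^sup>2)) (V a)"
  shows "(\<integral>\<^sup>+x. (\<integral>\<^sup>+a. ennreal (v x * (indicator {\<alpha><..} a * (w a / (x\<^sup>2 + a\<^sup>2)))) \<partial>lborel) \<partial>lborel)
    = (\<integral>\<^sup>+a. ennreal (indicator {\<alpha><..} a * (w a * V a)) \<partial>lborel)"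
proof -
  have "(\<integral>\<^sup>+x. (\<integral>\<^sup>+a. ennreal (v x * (indicator {\<alpha><..} a * (w a / (x\<^sup>2 + a\<^sup>2)))) \<partial>lborel) \<partial>lborel)
     = (\<integral>\<^sup>+a. (\<integral>\<^sup>+x. ennreal (v x * (indicator {\<alpha><..} a * (w a / (x\<^sup>2 + a\<^sup>2)))) \<partial>lborel) \<partial>lborel)"
    by (rule lborel_pair.Fubini') measurable
  also have "\<dots> = (\<integral>\<^sup>+a. ennreal (indicator {\<alpha><..} a * (w a * V a)) \<partial>lborel)"
  proof (rule nn_integral_cong)
    fix a :: real
    show "(\<integral>\<^sup>+x. ennreal (v x * (indicator {\<alpha><..} a * (w a / (x\<^sup>2 + a\<^sup>2)))) \<partial>lborel) =
      ennreal (indicator {\<alpha><..} a * (w a * V a))"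
    proof (cases "a > \<alpha>")
      case True
      have "has_bochner_integral lborel (\<lambda>x. w a * (v x / (x\<^sup>2 + a\<^sup>2))) (w a * V a)"
        by (rule has_bochner_integral_mult_right) (rule V[OF True])
      then have "has_bochner_integral lborel (\<lambda>x. v x * (indicator {\<alpha><..} a * (w a / (x\<^sup>2 + a\<^sup>2)))) (w a * V a)"
        using True by (simp add: mult_ac)
      then have "(\<integral>\<^sup>+x. ennreal (v x * (indicator {\<alpha><..} a * (w a / (x\<^sup>2 + a\<^sup>2)))) \<partial>lborel) = ennreal (w a * V a)"
        using True w[OF True] v
        by (subst nn_integral_eq_integral) (auto simp: has_bochner_integral_iff intro!: AE_I2)
      then show ?thesis using True by simp
    qed simp
  qed
  finally show ?thesis .
qed

lemma
  fixes v w V :: "real \<Rightarrow> real"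
  assumes mw [measurable]: "w \<in> borel_measurable borel"
    and \<alpha>: "\<alpha> \<ge> 0" and w: "\<And>a. a > \<alpha> \<Longrightarrow> w a \<ge> 0"
    and fin: "(\<integral>\<^sup>+a. ennreal (indicator {\<alpha><..} a * (w a * (pi / a))) \<partial>lborel) < \<infinity>"
  shows integrable_log_kernel: "integrable lborel (log_kernel w \<alpha>)"
    and has_bochner_integral_weighted_log_kernel:
     "\<And>v V I. v \<in> borel_measurable borel \<Longrightarrow> (\<And>x. v x \<ge> 0) \<Longrightarrow>
       (\<And>a. a > \<alpha> \<Longrightarrow> has_bochner_integral lborel (\<lambda>x. v x / (x\<^sup>2 + a\<^sup>2)) (V a)) \<Longrightarrow>
       (\<integral>\<^sup>+a. ennreal (indicator {\<alpha><..} a * (w a * V a)) \<partial>lborel) = ennreal I \<Longrightarrow> I \<ge> 0 \<Longrightarrow>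
       has_bochner_integral lborel (\<lambda>x. v x * log_kernel w \<alpha> x) I"
proof -
  define k where "k = (\<lambda>x a. indicator {\<alpha><..} a * (w a / (x\<^sup>2 + a\<^sup>2)))"
  have k0: "k x a \<ge> 0" for x a using w by (auto simp: k_def indicator_def)
  have [measurable]: "case_prod k \<in> borel_measurable (borel \<Otimes>\<^sub>M borel)" unfolding k_def by measurable
  have lk: "log_kernel w \<alpha> x = (LINT a|lborel. k x a)" for x by (simp add: log_kernel_def k_def)
  have "(\<integral>\<^sup>+x. (\<integral>\<^sup>+a. ennreal (k x a) \<partial>lborel) \<partial>lborel) < \<infinity>"
    using nn_integral_log_kernel_swap[of w "\<lambda>_. 1" \<alpha> "\<lambda>a. pi / a"] fin w \<alpha>
      has_bochner_integral_cauchy_density by (simp add: k_def)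
  then have "AE x in lborel. (\<integral>\<^sup>+a. ennreal (k x a) \<partial>lborel) \<noteq> \<infinity>"
    by (intro nn_integral_PInf_AE) auto
  then have eq: "AE x in lborel. (\<integral>\<^sup>+a. ennreal (k x a) \<partial>lborel) = ennreal (log_kernel w \<alpha> x)"
  proof eventually_elim
    case (elim x)
    have "integrable lborel (k x)"
      using elim k0 by (intro integrableI_nonneg) (auto simp: less_top)
    then show ?case unfolding lk by (intro nn_integral_eq_integral) (auto simp: k0)
  qed
  have J0: "log_kernel w \<alpha> x \<ge> 0" for x by (rule log_kernel_nonneg[OF w])
  show main: "has_bochner_integral lborel (\<lambda>x. v x * log_kernel w \<alpha> x) I"
    if [measurable]: "v \<in> borel_measurable borel" and v: "\<And>x. v x \<ge> 0"
      and V: "\<And>a. a > \<alpha> \<Longrightarrow> has_bochner_integral lborel (\<lambda>x. v x / (x\<^sup>2 + a\<^sup>2)) (V a)"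
      and I: "(\<integral>\<^sup>+a. ennreal (indicator {\<alpha><..} a * (w a * V a)) \<partial>lborel) = ennreal I" "I \<ge> 0" for v V I
  proof (rule has_bochner_integral_nn_integral)
    have "(\<integral>\<^sup>+x. ennreal (v x * log_kernel w \<alpha> x) \<partial>lborel) = (\<integral>\<^sup>+x. (\<integral>\<^sup>+a. ennreal (v x * k x a) \<partial>lborel) \<partial>lborel)"
    proof (rule nn_integral_cong_AE)
      show "AE x in lborel. ennreal (v x * log_kernel w \<alpha> x) = (\<integral>\<^sup>+a. ennreal (v x * k x a) \<partial>lborel)"
        using eq
      proof eventually_elim
        case (elim x)
        have "(\<integral>\<^sup>+a. ennreal (v x * k x a) \<partial>lborel) = (\<integral>\<^sup>+a. ennreal (v x) * ennreal (k x a) \<partial>lborel)"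
          by (intro nn_integral_cong) (simp add: ennreal_mult v k0)
        also have "\<dots> = ennreal (v x) * (\<integral>\<^sup>+a. ennreal (k x a) \<partial>lborel)"
          by (rule nn_integral_cmult) measurable
        finally show ?case using elim by (simp add: ennreal_mult v J0)
      qed
    qed
    also have "\<dots> = ennreal I"
      unfolding k_def using nn_integral_log_kernel_swap[of w v \<alpha> V] w v V I(1) by simp
    finally show "(\<integral>\<^sup>+x. ennreal (v x * log_kernel w \<alpha> x) \<partial>lborel) = ennreal I" .
  qed (use v J0 I(2) in auto)
  have "(\<integral>\<^sup>+a. ennreal (indicator {\<alpha><..} a * (w a * (pi / a))) \<partial>lborel) \<noteq> \<infinity>" using fin by simp
  then obtain I where I: "(\<integral>\<^sup>+a. ennreal (indicator {\<alpha><..} a * (w a * (pi / a))) \<partial>lborel) = ennreal I" "I \<ge> 0"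
    by (metis ennreal_cases infinity_ennreal_def)
  have "has_bochner_integral lborel (\<lambda>x. 1 * log_kernel w \<alpha> x) I"
    by (rule main[where V = "\<lambda>a. pi / a"]) (use I \<alpha> has_bochner_integral_cauchy_density in auto)
  then show "integrable lborel (log_kernel w \<alpha>)" by (simp add: has_bochner_integral_iff)
qed

section \<open>The Gaussian formula for the minimal distance\<close>

lemma has_bochner_integral_exp_tail:
  fixes c \<alpha> :: real
  assumes c: "c > 0"
  shows "has_bochner_integral lborel (\<lambda>a. indicator {\<alpha><..} a * exp (- c * a)) (exp (- c * \<alpha>) / c)"
proof (rule has_bochner_integral_nn_integral)
  have lim: "((\<lambda>a. - exp (- c * a) / c) \<longlongrightarrow> 0) at_top" using c by real_asymp
  have "(\<integral>\<^sup>+a. ennreal (exp (- c * a)) * indicator {\<alpha>..} a \<partial>lborel) = ennreal (0 - (- exp (- c * \<alpha>) / c))"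
    by (rule nn_integral_FTC_atLeast[OF _ _ _ lim]) (use c in \<open>auto intro!: derivative_eq_intros\<close>)
  also have "(\<integral>\<^sup>+a. ennreal (exp (- c * a)) * indicator {\<alpha>..} a \<partial>lborel) =
      (\<integral>\<^sup>+a. ennreal (indicator {\<alpha><..} a * exp (- c * a)) \<partial>lborel)"
    by (intro nn_integral_cong_AE eventually_mono[OF AE_lborel_singleton[of \<alpha>]]) (auto simp: indicator_def)
  finally show "(\<integral>\<^sup>+a. ennreal (indicator {\<alpha><..} a * exp (- c * a)) \<partial>lborel) = ennreal (exp (- c * \<alpha>) / c)"
    by simp
qed (use c in auto)

text \<open>
  The minimal \<open>L\<^sup>1\<close>-distance for approximation of type \<open>pi\<close>. The error integral and the integral over
  Gaussians both expand into this series.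
\<close>

definition alternating_half_sum :: "real \<Rightarrow> real" where
  "alternating_half_sum \<alpha> = (\<Sum>n. 2 / pi * (- 1) ^ n / (real n + 1/2)\<^sup>2 * exp (- 2 * pi * \<alpha> * (real n + 1/2)))"

lemma summable_inverse_half_squares: "summable (\<lambda>n. 2 / pi / (real n + 1/2)\<^sup>2)"
proof (rule summable_comparison_test')
  have "summable (\<lambda>n. inverse (real (Suc n) ^ 2))"
    by (subst summable_Suc_iff) (rule inverse_power_summable, simp)
  then show "summable (\<lambda>n. 8 / pi * inverse (real (Suc n) ^ 2))" by (rule summable_mult)
  fix n :: nat
  have "(real (Suc n))\<^sup>2 \<le> (2 * (real n + 1/2))\<^sup>2" by (intro power_mono) auto
  then have "(real (Suc n))\<^sup>2 \<le> 4 * (real n + 1/2)\<^sup>2" unfolding power_mult_distrib by simp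
  then have "2 / pi / (real n + 1/2)\<^sup>2 \<le> 2 / pi / ((real (Suc n))\<^sup>2 / 4)"
    by (intro divide_left_mono) auto
  also have "2 / pi / ((real (Suc n))\<^sup>2 / 4) = 8 / pi * inverse (real (Suc n) ^ 2)"
    by (simp add: inverse_eq_divide del: of_nat_Suc)
  finally show "norm (2 / pi / (real n + 1/2)\<^sup>2) \<le> 8 / pi * inverse (real (Suc n) ^ 2)"
    by (simp del: of_nat_Suc)
qed

text \<open>
  Integrate the power series of \<open>arctan (exp (- pi * a))\<close> term by term.
\<close>

lemma nn_integral_arctan_exp:
  assumes \<alpha>: "\<alpha> \<ge> 0"
  shows "(\<integral>\<^sup>+a. ennreal (indicator {\<alpha><..} a * (8 * arctan (exp (- pi * a)))) \<partial>lborel) = ennreal (alternating_half_sum \<alpha>)"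
    and "alternating_half_sum \<alpha> \<ge> 0"
proof -
  define f where "f = (\<lambda>n a. 8 * (- 1) ^ n / (2 * real n + 1) * (indicator {\<alpha><..} a * exp (- (pi * (2 * real n + 1)) * a)))"
  have c: "pi * (2 * real n + 1) > 0" for n by (simp add: add_nonneg_pos)
  have hb: "has_bochner_integral lborel (f n) (8 * (- 1) ^ n / (2 * real n + 1) * (exp (- (pi * (2 * real n + 1)) * \<alpha>) / (pi * (2 * real n + 1))))" for n
    unfolding f_def by (intro has_bochner_integral_mult_right has_bochner_integral_exp_tail c)
  have nf: "norm (f n a) = 8 / (2 * real n + 1) * (indicator {\<alpha><..} a * exp (- (pi * (2 * real n + 1)) * a))" for n a
    by (simp add: f_def abs_mult power_abs)
  have hbn: "has_bochner_integral lborel (\<lambda>a. norm (f n a)) (8 / (2 * real n + 1) * (exp (- (pi * (2 * real n + 1)) * \<alpha>) / (pi * (2 * real n + 1))))" for n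
    unfolding nf by (intro has_bochner_integral_mult_right has_bochner_integral_exp_tail c)
  have coef: "8 / (2 * real n + 1) * (x / (pi * (2 * real n + 1))) = 2 / pi / (real n + 1/2)\<^sup>2 * x" for n x
  proof -
    have "8 / (2 * d) * (x / (pi * (2 * d))) = 2 / pi / d\<^sup>2 * x" for d :: real
      by (simp add: power2_eq_square)
    from this[of "real n + 1/2"] show ?thesis by simp
  qed
  have coef': "8 * s / (2 * real n + 1) * (x / (pi * (2 * real n + 1))) = 2 / pi * s / (real n + 1/2)\<^sup>2 * x" for n x s
  proof -
    have "8 * s / (2 * real n + 1) * (x / (pi * (2 * real n + 1))) = s * (8 / (2 * real n + 1) * (x / (pi * (2 * real n + 1))))"
      by simp
    then show ?thesis unfolding coef by simp
  qed
  have expeq: "exp (- (pi * (2 * real n + 1)) * \<alpha>) = exp (- 2 * pi * \<alpha> * (real n + 1/2))" for n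
    by (rule arg_cong[of _ _ exp]) (simp add: algebra_simps)
  have int: "integrable lborel (f n)" for n using hb by (simp add: has_bochner_integral_iff)
  have Lf: "integral\<^sup>L lborel (f n) = 2 / pi * (- 1) ^ n / (real n + 1/2)\<^sup>2 * exp (- 2 * pi * \<alpha> * (real n + 1/2))" for n
    using hb[of n] unfolding coef' expeq by (simp add: has_bochner_integral_iff)
  have Ln: "(LINT a|lborel. norm (f n a)) = 2 / pi / (real n + 1/2)\<^sup>2 * exp (- 2 * pi * \<alpha> * (real n + 1/2))" for n
    using hbn[of n] unfolding coef expeq by (simp add: has_bochner_integral_iff)
  have sumn: "summable (\<lambda>n. LINT a|lborel. norm (f n a))"
  proof (rule summable_comparison_test'[OF summable_inverse_half_squares])
    fix n :: nat
    have "exp (- 2 * pi * \<alpha> * (real n + 1/2)) \<le> 1" using \<alpha> by (simp add: mult_nonneg_nonneg)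
    then show "norm (LINT a|lborel. norm (f n a)) \<le> 2 / pi / (real n + 1/2)\<^sup>2"
      unfolding Ln by (simp add: mult_left_le divide_right_mono)
  qed
  have series: "f n a = indicator {\<alpha><..} a * (8 * ((- 1) ^ n * (1 / real (n * 2 + 1) * exp (- pi * a) ^ (n * 2 + 1))))" for n a
  proof -
    have "exp (- (pi * (2 * real n + 1)) * a) = exp (- pi * a) ^ (n * 2 + 1)"
      unfolding exp_of_nat_mult[symmetric] by (rule arg_cong[of _ _ exp]) (simp add: algebra_simps)
    then show ?thesis by (simp add: f_def mult_ac)
  qed
  have pt: "(\<Sum>n. f n a) = indicator {\<alpha><..} a * (8 * arctan (exp (- pi * a)))"
    and sumpt: "summable (\<lambda>n. norm (f n a))" for a
  proof -
    have "(\<Sum>n. f n a) = indicator {\<alpha><..} a * (8 * arctan (exp (- pi * a))) \<and> summable (\<lambda>n. norm (f n a))"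
    proof (cases "a > \<alpha>")
      case True
      define e where "e = exp (- pi * a)"
      have e: "0 < e" "e < 1" using True \<alpha> by (auto simp: e_def)
      have sg: "summable (\<lambda>n. 8 * e ^ n)" using e by (intro summable_mult summable_geometric) auto
      have nle: "norm (f n a) \<le> 8 * e ^ n" for n
      proof -
        have "1 / real (n * 2 + 1) * e ^ (n * 2 + 1) \<le> 1 * e ^ n"
          using e by (intro mult_mono power_decreasing) auto
        then show ?thesis unfolding series e_def[symmetric] using True e by (simp add: abs_mult power_abs)
      qed
      have sn: "summable (\<lambda>n. norm (f n a))" by (rule summable_comparison_test'[OF sg]) (use nle in simp)
      have sm: "summable (\<lambda>n. (- 1) ^ n * (1 / real (n * 2 + 1) * e ^ (n * 2 + 1)))"
        using summable_mult[OF summable_norm_cancel[OF sn], of "1/8"] True unfolding series e_def[symmetric] by simp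
      have "arctan e = (\<Sum>n. (- 1) ^ n * (1 / real (n * 2 + 1) * e ^ (n * 2 + 1)))"
        by (rule arctan_series) (use e in simp)
      then have "(\<Sum>n. f n a) = 8 * arctan e" unfolding series e_def[symmetric] using True suminf_mult[OF sm, of 8] by simp
      then show ?thesis using sn True by (simp add: e_def)
    qed (simp add: f_def)
    then show "(\<Sum>n. f n a) = indicator {\<alpha><..} a * (8 * arctan (exp (- pi * a)))" "summable (\<lambda>n. norm (f n a))" by auto
  qed
  note R = integrable_suminf[OF int _ sumn] integral_suminf[OF int _ sumn]
  have 1: "integrable lborel (\<lambda>a. indicator {\<alpha><..} a * (8 * arctan (exp (- pi * a))))"
    using R(1) sumpt unfolding pt by simp
  have 2: "(LINT a|lborel. indicator {\<alpha><..} a * (8 * arctan (exp (- pi * a)))) = alternating_half_sum \<alpha>"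
    using R(2) sumpt unfolding pt Lf alternating_half_sum_def by simp
  have nonneg: "0 \<le> indicator {\<alpha><..} a * (8 * arctan (exp (- pi * a)))" for a
    by (simp add: zero_le_arctan_iff)
  show "(\<integral>\<^sup>+a. ennreal (indicator {\<alpha><..} a * (8 * arctan (exp (- pi * a)))) \<partial>lborel) = ennreal (alternating_half_sum \<alpha>)"
    unfolding 2[symmetric] by (rule nn_integral_eq_integral[OF 1]) (use nonneg in auto)
  show "alternating_half_sum \<alpha> \<ge> 0" unfolding 2[symmetric] by (rule integral_nonneg_AE) (use nonneg in auto)
qed

text \<open>
  Normalised to be odd, so that its limits are plus and minus half of the total mass \<open>1\<close>.
\<close>

lemma gaussian_antiderivative:
  obtains N :: "real \<Rightarrow> real" where "\<And>x. DERIV N x :> exp (- pi * x\<^sup>2)" "N 0 = 0"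
    "(N \<longlongrightarrow> 1/2) at_top" "(N \<longlongrightarrow> - (1/2)) at_bot"
proof -
  have "(\<lambda>x. exp (- of_real pi * x\<^sup>2) :: complex) holomorphic_on UNIV" by (intro holomorphic_intros)
  then obtain P :: "complex \<Rightarrow> complex" where "\<And>x. x \<in> UNIV \<Longrightarrow> (P has_field_derivative exp (- of_real pi * x\<^sup>2)) (at x within UNIV)"
    by (rule holomorphic_convex_primitive'[OF convex_UNIV open_UNIV]) blast
  then have P: "\<And>x::complex. (P has_field_derivative exp (- of_real pi * x\<^sup>2)) (at x)" by simp
  define N where "N = (\<lambda>x. Re (P (of_real x)) - Re (P 0))"
  have N: "DERIV N x :> exp (- pi * x\<^sup>2)" for x
  proof -
    have "((\<lambda>x. P (of_real x)) has_vector_derivative exp (- of_real pi * (of_real x)\<^sup>2)) (at x)"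
      using has_vector_derivative_real_field[OF P] by blast
    from bounded_linear.has_vector_derivative[OF bounded_linear_Re this]
    have "((\<lambda>x. Re (P (of_real x))) has_vector_derivative exp (- pi * x\<^sup>2)) (at x)"
      by (simp add: exp_of_real flip: of_real_power of_real_mult of_real_minus)
    then have "((\<lambda>x. Re (P (of_real x))) has_field_derivative exp (- pi * x\<^sup>2)) (at x)"
      by (simp add: has_real_derivative_iff_has_vector_derivative)
    from DERIV_diff[OF this DERIV_const] show ?thesis unfolding N_def by simp
  qed
  have N0: "N 0 = 0" by (simp add: N_def)
  have gauss: "has_bochner_integral lborel (\<lambda>x. indicator {0..} x *\<^sub>R exp (- pi * x\<^sup>2)) (1/2)"
  proof -
    have "has_bochner_integral lborel (\<lambda>x. indicator {0..} (0 + sqrt pi * x) *\<^sub>R exp (- (0 + sqrt pi * x)\<^sup>2)) ((sqrt pi / 2) /\<^sub>R \<bar>sqrt pi\<bar>)"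
      by (rule lborel_has_bochner_integral_real_affine_iff[THEN iffD1, OF _ gaussian_moment_0]) simp
    moreover have "indicator {0..} (sqrt pi * x) = (indicator {0..} x :: real)" for x
      by (auto simp: indicator_def zero_le_mult_iff not_le)
    ultimately show ?thesis by (simp add: power_mult_distrib)
  qed
  have "((\<lambda>y. LINT x|lborel. indicator {..y} x *\<^sub>R (indicator {0..} x *\<^sub>R exp (- pi * x\<^sup>2))) \<longlongrightarrow> 1/2) at_top"
    unfolding has_bochner_integral_integral_eq[OF gauss, symmetric]
    using gauss by (intro tendsto_integral_at_top) (auto simp: has_bochner_integral_iff)
  moreover have "\<forall>\<^sub>F y in at_top. (LINT x|lborel. indicator {..y} x *\<^sub>R (indicator {0..} x *\<^sub>R exp (- pi * x\<^sup>2))) = N y"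
    using eventually_ge_at_top[of 0]
  proof eventually_elim
    case (elim y)
    have "(LINT x|lborel. indicator {0..y} x *\<^sub>R exp (- pi * x\<^sup>2)) = N y - N 0"
    proof (rule integral_FTC_atLeastAtMost[OF elim])
      show "(N has_vector_derivative exp (- pi * x\<^sup>2)) (at x within {0..y})" for x
        using has_field_derivative_at_within[OF N] by (simp add: has_real_derivative_iff_has_vector_derivative)
      show "continuous_on {0..y} (\<lambda>x. exp (- pi * x\<^sup>2))" by (intro continuous_intros)
    qed
    also have "(\<lambda>x. indicator {0..y} x *\<^sub>R exp (- pi * x\<^sup>2)) = (\<lambda>x. indicator {..y} x *\<^sub>R (indicator {0..} x *\<^sub>R exp (- pi * x\<^sup>2)))"
      by (auto simp: indicator_def)
    finally show ?case using N0 by simp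
  qed
  ultimately have top: "(N \<longlongrightarrow> 1/2) at_top" by (rule Lim_transform_eventually)
  have odd: "N (- x) = - N x" for x
  proof -
    have "DERIV (\<lambda>x. N x + N (- x)) x :> 0" for x
      by (rule derivative_eq_intros DERIV_chain2[OF N] N refl | simp)+
    then have "N x + N (- x) = N 0 + N (- 0)" by (rule DERIV_isconst_all[rule_format, of "\<lambda>x. N x + N (- x)"]) 
    then show ?thesis using N0 by simp
  qed
  have "((\<lambda>x. N (- x)) \<longlongrightarrow> 1/2) at_bot"
    by (rule filterlim_compose[OF top]) (rule filterlim_uminus_at_top_at_bot)
  from tendsto_minus[OF this] have "(N \<longlongrightarrow> - (1/2)) at_bot" by (simp add: odd)
  with N N0 top show thesis by (rule that)
qed

text \<open>
  This is the total mass of an inverse Gaussian density, up to a constant. As for its distribution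
  function, an antiderivative is an explicit combination of the Gaussian integral \<open>N\<close> at
  \<open>\<plusminus> \<alpha> * sqrt l - t / sqrt l\<close>: both Gaussian factors complete the square to the same exponential, and the
  terms with \<open>\<alpha>\<close> in the inner derivatives cancel. The case \<open>\<alpha> = 0\<close> has to be treated separately because
  the limit of these arguments at infinity is then \<open>0\<close>.
\<close>

lemma has_bochner_integral_inverse_gaussian:
  assumes t: "t > 0" and \<alpha>: "\<alpha> \<ge> 0"
  shows "has_bochner_integral lborel (\<lambda>l. indicator {0<..} l * (exp (- pi * (\<alpha>\<^sup>2 * l + t\<^sup>2 / l)) / (sqrt l) ^ 3))
    (exp (- 2 * pi * \<alpha> * t) / t)"
proof -
  obtain N :: "real \<Rightarrow> real" where N: "\<And>x. DERIV N x :> exp (- pi * x\<^sup>2)" "N 0 = 0"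
    "(N \<longlongrightarrow> 1/2) at_top" "(N \<longlongrightarrow> - (1/2)) at_bot" using gaussian_antiderivative by blast
  define f where "f = (\<lambda>l. exp (- pi * (\<alpha>\<^sup>2 * l + t\<^sup>2 / l)) / (sqrt l) ^ 3)"
  define em where "em = exp (- 2 * pi * \<alpha> * t)"
  define ep where "ep = exp (2 * pi * \<alpha> * t)"
  define F where "F = (\<lambda>l. (em * N (\<alpha> * sqrt l - t / sqrt l) + ep * N (- \<alpha> * sqrt l - t / sqrt l)) / t)"
  have F: "DERIV F l :> f l" if l: "l > 0" for l
  proof -
    define s where "s = sqrt l"
    have s: "s > 0" "s\<^sup>2 = l" using l by (auto simp: s_def)
    have inner: "((\<lambda>l. b * sqrt l - t / sqrt l) has_real_derivative (b / (2 * s) + t / (2 * s ^ 3))) (at l)" for b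
    proof -
      have "((\<lambda>l. b * sqrt l - t / sqrt l) has_real_derivative (b * (inverse (sqrt l) / 2) - (0 * sqrt l - t * (inverse (sqrt l) / 2)) / (sqrt l * sqrt l))) (at l)"
        using l by (intro DERIV_diff DERIV_cmult DERIV_divide DERIV_const DERIV_real_sqrt) auto
      also have "b * (inverse (sqrt l) / 2) - (0 * sqrt l - t * (inverse (sqrt l) / 2)) / (sqrt l * sqrt l) = b / (2 * s) + t / (2 * s ^ 3)"
        unfolding s_def[symmetric] using s by (simp add: field_simps power3_eq_cube)
      finally show ?thesis .
    qed
    have e1: "em * exp (- pi * (\<alpha> * s - t / s)\<^sup>2) = exp (- pi * (\<alpha>\<^sup>2 * l + t\<^sup>2 / l))"
      unfolding em_def exp_add[symmetric] s(2)[symmetric] using s(1)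
      by (intro arg_cong[of _ _ exp]) (simp add: power2_eq_square field_simps)
    have e2: "ep * exp (- pi * (- \<alpha> * s - t / s)\<^sup>2) = exp (- pi * (\<alpha>\<^sup>2 * l + t\<^sup>2 / l))"
      unfolding ep_def exp_add[symmetric] s(2)[symmetric] using s(1)
      by (intro arg_cong[of _ _ exp]) (simp add: power2_eq_square field_simps)
    have "DERIV F l :> (em * (exp (- pi * (\<alpha> * sqrt l - t / sqrt l)\<^sup>2) * (\<alpha> / (2 * s) + t / (2 * s ^ 3))) +
        ep * (exp (- pi * (- \<alpha> * sqrt l - t / sqrt l)\<^sup>2) * (- \<alpha> / (2 * s) + t / (2 * s ^ 3)))) / t"
      unfolding F_def by (intro DERIV_cdivide DERIV_add DERIV_cmult DERIV_chain2[OF N(1)] inner)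
    also have "(em * (exp (- pi * (\<alpha> * sqrt l - t / sqrt l)\<^sup>2) * (\<alpha> / (2 * s) + t / (2 * s ^ 3))) +
        ep * (exp (- pi * (- \<alpha> * sqrt l - t / sqrt l)\<^sup>2) * (- \<alpha> / (2 * s) + t / (2 * s ^ 3)))) / t =
        ((em * exp (- pi * (\<alpha> * s - t / s)\<^sup>2)) * (\<alpha> / (2 * s) + t / (2 * s ^ 3)) +
        (ep * exp (- pi * (- \<alpha> * s - t / s)\<^sup>2)) * (- \<alpha> / (2 * s) + t / (2 * s ^ 3))) / t"
      by (simp add: s_def mult.assoc)
    also have "((em * exp (- pi * (\<alpha> * s - t / s)\<^sup>2)) * (\<alpha> / (2 * s) + t / (2 * s ^ 3)) +
        (ep * exp (- pi * (- \<alpha> * s - t / s)\<^sup>2)) * (- \<alpha> / (2 * s) + t / (2 * s ^ 3))) / t = f l" unfolding e1 e2 f_def s_def[symmetric] using t s by (simp add: field_simps)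
    finally show ?thesis .
  qed
  have contf: "isCont f l" if "l > 0" for l unfolding f_def using that by (intro continuous_intros) auto
  have f0: "f l \<ge> 0" if "l > 0" for l using that by (simp add: f_def)
  have limb: "filterlim (\<lambda>l. b * sqrt l - t / sqrt l) at_bot (at_right 0)" for b using t by real_asymp
  have "(F \<longlongrightarrow> (em * (- (1/2)) + ep * (- (1/2))) / t) (at_right 0)"
    unfolding F_def using t by (intro tendsto_intros filterlim_compose[OF N(4)] limb) auto
  then have A: "((F \<circ> real_of_ereal) \<longlongrightarrow> (em * (- (1/2)) + ep * (- (1/2))) / t) (at_right 0)"
    by (simp add: ereal_tendsto_simps zero_ereal_def)
  obtain B where B0: "(F \<longlongrightarrow> B) at_top" and B: "B - (em * (- (1/2)) + ep * (- (1/2))) / t = em / t"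
  proof (cases "\<alpha> = 0")
    case True
    have "((\<lambda>l. 0 * sqrt l - t / sqrt l) \<longlongrightarrow> 0) at_top" by real_asymp
    moreover have "isCont N 0" using N(1) DERIV_isCont by blast
    ultimately have "((\<lambda>l. N (0 * sqrt l - t / sqrt l)) \<longlongrightarrow> N 0) at_top"
      by (rule isCont_tendsto_compose[rotated])
    then have "(F \<longlongrightarrow> (em * N 0 + ep * N 0) / t) at_top"
      unfolding F_def True minus_zero using t by (intro tendsto_intros) auto
    then show thesis by (rule that) (use True t N(2) in \<open>simp add: em_def ep_def\<close>)
  next
    case False
    then have a: "\<alpha> > 0" using \<alpha> by simp
    have 1: "filterlim (\<lambda>l. \<alpha> * sqrt l - t / sqrt l) at_top at_top" using a by real_asymp
    have 2: "filterlim (\<lambda>l. - \<alpha> * sqrt l - t / sqrt l) at_bot at_top" using a by real_asymp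
    have "(F \<longlongrightarrow> (em * (1/2) + ep * (- (1/2))) / t) at_top"
      unfolding F_def using t by (intro tendsto_intros filterlim_compose[OF N(4) 2] filterlim_compose[OF N(3) 1]) auto
    then show thesis by (rule that) (use t in \<open>simp add: field_simps\<close>)
  qed
  have B': "((F \<circ> real_of_ereal) \<longlongrightarrow> B) (at_left \<infinity>)" using B0 by (simp add: ereal_tendsto_simps)
  have "set_integrable lborel (einterval 0 \<infinity>) f" "(LBINT l=0..\<infinity>. f l) = B - (em * (- (1/2)) + ep * (- (1/2))) / t"
    by (rule interval_integral_FTC_nonneg[OF _ _ _ _ A B']; use F contf f0 in \<open>force simp: zero_ereal_def\<close>)+
  moreover have "einterval 0 \<infinity> = {0::real<..}" by (auto simp: einterval_iff zero_ereal_def)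
  ultimately show ?thesis unfolding B
    by (simp add: has_bochner_integral_iff set_integrable_def interval_lebesgue_integral_def
        set_lebesgue_integral_def f_def em_def)
qed

text \<open>
  The reflection \<open>n \<mapsto> - n - 1\<close> of the integers corresponds to \<open>t \<mapsto> - t\<close> for \<open>t = n + 1/2\<close>, so that
  for an even summand the negative half-integers contribute as much as the positive ones.
\<close>

lemma infsum_half_integers:
  fixes u :: "int \<Rightarrow> real"
  assumes sym: "\<And>n. u (- n - 1) = u n" and sum: "summable (\<lambda>n. norm (u (int n)))"
  shows "(\<Sum>\<^sub>\<infinity>n. u n) = 2 * (\<Sum>n. u (int n))"
proof -
  define S where "S = (\<Sum>n. u (int n))"
  have 1: "((\<lambda>n. u (int n)) has_sum S) UNIV"
    using norm_summable_imp_has_sum[OF sum summable_sums[OF summable_norm_cancel[OF sum]]] by (simp add: S_def)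
  have A: "(u has_sum S) (range int)"
    using 1 by (subst has_sum_reindex) (auto simp: o_def)
  have "((\<lambda>n. u (- int n - 1)) has_sum S) UNIV" using 1 by (simp add: sym)
  then have B: "(u has_sum S) (range (\<lambda>n. - int n - 1))"
    by (subst has_sum_reindex) (auto simp: o_def inj_on_def)
  have "range int \<union> range (\<lambda>n. - int n - 1) = UNIV"
  proof -
    have "n \<in> range int \<union> range (\<lambda>n. - int n - 1)" for n :: int
      by (cases "n \<ge> 0") (auto intro: range_eqI[of _ _ "nat n"] range_eqI[of _ _ "nat (- n - 1)"])
    then show ?thesis by blast
  qed
  moreover have "(u has_sum (S + S)) (range int \<union> range (\<lambda>n. - int n - 1))"
    by (rule has_sum_Un_disjoint[OF A B]) auto
  ultimately show ?thesis using infsumI by (fastforce simp: S_def)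
qed

text \<open>
  Term by term integration. The integral of the absolute value of the \<open>n\<close>-th term is at most
  \<open>2 / pi / (n + 1/2)\<^sup>2\<close>, uniformly in \<open>\<alpha>\<close>, so that \<open>\<alpha> = 0\<close> is included.
\<close>

lemma best_approx_integrand_integral:
  assumes \<alpha>: "\<alpha> \<ge> 0"
  shows "set_integrable lborel {0<..} (best_approx_integrand \<alpha>)"
    and "(LINT l:{0<..}|lborel. best_approx_integrand \<alpha> l) = alternating_half_sum \<alpha>"
proof -
  define tt where "tt = (\<lambda>n::nat. real n + 1/2)"
  have tt: "tt n > 0" for n by (simp add: tt_def add_nonneg_pos)
  define ig where "ig = (\<lambda>n l. indicator {0<..} l * (exp (- pi * (\<alpha>\<^sup>2 * l + (tt n)\<^sup>2 / l)) / (sqrt l) ^ 3))"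
  define f where "f = (\<lambda>n l. 2 / pi * (- 1) ^ n / tt n * ig n l)"
  have ig0: "ig n l \<ge> 0" for n l by (simp add: ig_def indicator_def)
  have hig: "has_bochner_integral lborel (ig n) (exp (- 2 * pi * \<alpha> * tt n) / tt n)" for n
    unfolding ig_def by (rule has_bochner_integral_inverse_gaussian[OF tt \<alpha>])
  have hb: "has_bochner_integral lborel (f n) (2 / pi * (- 1) ^ n / tt n * (exp (- 2 * pi * \<alpha> * tt n) / tt n))" for n
    unfolding f_def by (intro has_bochner_integral_mult_right hig)
  have nf: "norm (f n l) = 2 / pi / tt n * ig n l" for n l
    using ig0[of n l] tt[of n] by (simp add: f_def abs_mult power_abs)
  have hbn: "has_bochner_integral lborel (\<lambda>l. norm (f n l)) (2 / pi / tt n * (exp (- 2 * pi * \<alpha> * tt n) / tt n))" for n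
    unfolding nf by (intro has_bochner_integral_mult_right hig)
  have int: "integrable lborel (f n)" for n using hb by (simp add: has_bochner_integral_iff)
  have Lf: "integral\<^sup>L lborel (f n) = 2 / pi * (- 1) ^ n / (real n + 1/2)\<^sup>2 * exp (- 2 * pi * \<alpha> * (real n + 1/2))" for n
    using hb[of n] by (simp add: has_bochner_integral_iff tt_def power2_eq_square)
  have sumn: "summable (\<lambda>n. LINT l|lborel. norm (f n l))"
  proof (rule summable_comparison_test'[OF summable_inverse_half_squares])
    fix n :: nat
    have "exp (- 2 * pi * \<alpha> * tt n) \<le> 1" using \<alpha> tt[of n] by (simp add: mult_nonneg_nonneg)
    then have "2 / pi / (tt n)\<^sup>2 * exp (- 2 * pi * \<alpha> * tt n) \<le> 2 / pi / (tt n)\<^sup>2" by (intro mult_left_le) auto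
    moreover have "(LINT l|lborel. norm (f n l)) = 2 / pi / (tt n)\<^sup>2 * exp (- 2 * pi * \<alpha> * tt n)"
      using hbn[of n] by (simp add: has_bochner_integral_iff power2_eq_square)
    moreover have "real n + 1/2 = tt n" by (simp add: tt_def)
    ultimately show "norm (LINT l|lborel. norm (f n l)) \<le> 2 / pi / (real n + 1/2)\<^sup>2" by simp
  qed
  have pt: "indicator {0<..} l * best_approx_integrand \<alpha> l = (\<Sum>n. f n l)"
    and sumpt: "summable (\<lambda>n. norm (f n l))" for l
  proof -
    have "indicator {0<..} l * best_approx_integrand \<alpha> l = (\<Sum>n. f n l) \<and> summable (\<lambda>n. norm (f n l))"
    proof (cases "l > 0")
      case True
      define u where "u = (\<lambda>n::int. (- 1) powi n / (of_int n + 1 / 2) * Ghat l (of_int n + 1 / 2) :: real)"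
      define \<kappa> where "\<kappa> = exp (- pi * l * \<alpha>\<^sup>2) / l"
      have \<kappa>: "\<kappa> > 0" using True by (simp add: \<kappa>_def)
      have ut: "u (int n) = (- 1) ^ n / tt n * Ghat l (tt n)" for n by (simp add: u_def tt_def)
      have fu: "f n l = 2 / pi * u (int n) * \<kappa>" for n
      proof -
        have "Ghat l (tt n) * \<kappa> = ig n l"
        proof -
          have "(- 1 / 2 :: real) = - (1 / 2)" by simp
          then have "l powr (- 1 / 2) = 1 / sqrt l"
            using True by (simp only: powr_minus_divide powr_half_sqrt[OF less_imp_le])
          moreover have "exp (- pi * (\<alpha>\<^sup>2 * l + (tt n)\<^sup>2 / l)) = exp (- pi * (1 / l) * (tt n)\<^sup>2) * exp (- pi * l * \<alpha>\<^sup>2)"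
            unfolding exp_add[symmetric] by (rule arg_cong[of _ _ exp]) (simp add: algebra_simps)
          moreover have "(sqrt l) ^ 3 = sqrt l * l" using True by (simp add: power3_eq_cube)
          ultimately show ?thesis using True by (simp add: Ghat_def \<kappa>_def ig_def)
        qed
        then show ?thesis by (simp add: f_def ut mult.assoc)
      qed
      have sym: "u (- n - 1) = u n" for n
      proof -
        have "(- 1 :: real) powi (- n - 1) = - ((- 1) powi n)"
          by (simp add: power_int_diff power_int_minus power_int_minus_left)
        moreover have "real_of_int (- n - 1) + 1/2 = - (of_int n + 1/2)" by simp
        moreover have "Ghat l (- x) = Ghat l x" for x by (simp add: Ghat_def)
        ultimately show ?thesis by (simp only: u_def) (simp add: minus_divide_right[symmetric] del: of_int_diff of_int_minus minus_add_distrib)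
      qed
      have sumu: "summable (\<lambda>n. norm (u (int n)))"
      proof (rule summable_comparison_test')
        show "summable (\<lambda>n. l powr (- 1/2) * (l * (2 / pi / (real n + 1/2)\<^sup>2)))"
          by (intro summable_mult summable_inverse_half_squares)
        fix n :: nat
        \<comment> \<open>For fixed \<open>l\<close> any summable bound will do; \<open>exp (- y) \<le> 1 / y\<close> suffices.\<close>
        have e: "exp (- pi * (1 / l) * (tt n)\<^sup>2) \<le> l / (pi * (tt n)\<^sup>2)"
        proof -
          have p: "pi * (tt n)\<^sup>2 / l > 0" using True tt[of n] by simp
          have "pi * (tt n)\<^sup>2 / l \<le> exp (pi * (tt n)\<^sup>2 / l)" using exp_ge_add_one_self[of "pi * (tt n)\<^sup>2 / l"] by linarith
          then have "inverse (exp (pi * (tt n)\<^sup>2 / l)) \<le> inverse (pi * (tt n)\<^sup>2 / l)" using p by (rule le_imp_inverse_le)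
          then show ?thesis by (simp add: exp_minus[symmetric])
        qed
        have "norm (u (int n)) = 1 / tt n * (l powr (- 1/2) * exp (- pi * (1 / l) * (tt n)\<^sup>2))"
          using tt[of n] by (simp add: ut abs_mult power_abs Ghat_def)
        also have "\<dots> \<le> 2 * (l powr (- 1/2) * (l / (pi * (tt n)\<^sup>2)))"
          using True tt[of n] e by (intro mult_mono) (auto simp: tt_def divide_le_eq)
        also have "\<dots> = l powr (- 1/2) * (l * (2 / pi / (real n + 1/2)\<^sup>2))" by (simp add: tt_def)
        finally show "norm (norm (u (int n))) \<le> l powr (- 1/2) * (l * (2 / pi / (real n + 1/2)\<^sup>2))" by simp
      qed
      have sc: "summable (\<lambda>n. u (int n))" by (rule summable_norm_cancel[OF sumu])
      have "best_approx_integrand \<alpha> l = 1 / pi * (\<Sum>\<^sub>\<infinity>n. u n) * \<kappa>"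
        by (simp add: best_approx_integrand_def u_def \<kappa>_def)
      also have "\<dots> = 2 / pi * \<kappa> * (\<Sum>n. u (int n))" unfolding infsum_half_integers[OF sym sumu] by simp
      also have "\<dots> = (\<Sum>n. 2 / pi * \<kappa> * u (int n))" by (rule suminf_mult[OF sc, symmetric])
      also have "\<dots> = (\<Sum>n. f n l)" unfolding fu by (simp add: mult_ac)
      finally have 1: "best_approx_integrand \<alpha> l = (\<Sum>n. f n l)" .
      have "(\<lambda>n. norm (f n l)) = (\<lambda>n. 2 / pi * \<kappa> * norm (u (int n)))"
        unfolding fu using \<kappa> by (simp add: abs_mult mult_ac)
      then have "summable (\<lambda>n. norm (f n l))" using summable_mult[OF sumu, of "2 / pi * \<kappa>"] by simp
      with 1 True show ?thesis by simp
    qed (simp add: f_def ig_def)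
    then show "indicator {0<..} l * best_approx_integrand \<alpha> l = (\<Sum>n. f n l)" "summable (\<lambda>n. norm (f n l))" by auto
  qed
  note R = integrable_suminf[OF int _ sumn] integral_suminf[OF int _ sumn]
  show "set_integrable lborel {0<..} (best_approx_integrand \<alpha>)"
    unfolding set_integrable_def real_scaleR_def pt using R(1) sumpt by simp
  show "(LINT l:{0<..}|lborel. best_approx_integrand \<alpha> l) = alternating_half_sum \<alpha>"
    unfolding set_lebesgue_integral_def real_scaleR_def pt using R(2) sumpt
    by (simp add: Lf alternating_half_sum_def)
qed

section \<open>Entire functions that interpolate the logarithm\<close>

definition csinc :: "complex \<Rightarrow> complex" where
  "csinc z = (if z = 0 then 1 else sin z / z)"

lemma holomorphic_csinc: "csinc holomorphic_on UNIV"
proof -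
  have "(\<lambda>z. if z = 0 then deriv sin 0 else (sin z - sin 0) / (z - 0)) holomorphic_on (UNIV :: complex set)"
    by (rule pole_lemma_open) (auto intro: holomorphic_intros)
  moreover have "deriv sin (0::complex) = 1"
    using DERIV_imp_deriv[OF DERIV_sin[of "0::complex"]] by simp
  ultimately show ?thesis by (simp add: csinc_def[abs_def] cong: if_cong)
qed

lemma csinc_DERIV: "(csinc has_field_derivative deriv csinc z) (at z)"
  using holomorphic_csinc by (simp add: holomorphic_derivI)

lemma continuous_csinc: "continuous_on A csinc" "continuous_on A (deriv csinc)"
  using holomorphic_csinc holomorphic_deriv[OF holomorphic_csinc open_UNIV]
  by (auto intro: continuous_on_subset holomorphic_on_imp_continuous_on)

text \<open>
  The mean value inequality on the segment from \<open>0\<close> to \<open>z\<close>, where \<open>norm (cos w) \<le> exp \<bar>Im z\<bar>\<close>.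
\<close>

lemma norm_csinc_le: "norm (csinc z) \<le> exp \<bar>Im z\<bar>"
proof (cases "z = 0")
  case False
  have "norm (sin z - sin 0) \<le> exp \<bar>Im z\<bar> * norm (z - 0)"
  proof (rule field_differentiable_bound[of "closed_segment 0 z"])
    fix w assume "w \<in> closed_segment 0 z"
    then obtain u where u: "0 \<le> u" "u \<le> 1" "w = u *\<^sub>R z" by (auto simp: in_segment)
    have "\<bar>Im w\<bar> \<le> \<bar>Im z\<bar>" using u by (simp add: abs_mult mult_left_le_one_le)
    then show "norm (cos w) \<le> exp \<bar>Im z\<bar>" using norm_cos_le_exp[of w] by (meson exp_le_cancel_iff order_trans)
    show "(sin has_field_derivative cos w) (at w within closed_segment 0 z)"
      by (rule has_field_derivative_at_within[OF DERIV_sin])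
  qed auto
  then show ?thesis using False by (simp add: csinc_def norm_divide divide_le_eq)
qed (simp add: csinc_def)

text \<open>
  The functions \<open>cos\<^sup>2 (pi * z)\<close>, \<open>- sin\<^sup>2 (pi * z)\<close> and \<open>cos (pi * z)\<close> are all of the form \<open>\<phi> z = p + q * cos (T * z)\<close>. The last
  assumption bounds \<open>\<phi> (\<i> * a) = p + q * cosh (T * a)\<close> below by a positive multiple of its natural size on
  \<open>a \<ge> \<alpha>\<close>. For \<open>- sin\<^sup>2\<close> it fails at \<open>\<alpha> = 0\<close>, where the singularity of the logarithm rules out
  majorants.
  
  Formally, \<open>- ln (z\<^sup>2 + \<alpha>\<^sup>2)\<close> is the integral of \<open>2 * a / (z\<^sup>2 + a\<^sup>2)\<close> over \<open>a > \<alpha>\<close>, up to an infinite constant.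
  The entire function \<open>w a * S z a = 2 * a / (z\<^sup>2 + a\<^sup>2) * (1 - \<phi> z / \<phi> (\<i> * a))\<close> replaces the integrand; integrating up to
  \<open>n\<close> and subtracting \<open>2 * ln n\<close> gives the approximants, whose limit is the interpolating function.
\<close>

locale log_interpolation =
  fixes \<alpha> T p q K :: real
  assumes \<alpha>: "\<alpha> \<ge> 0" and T: "T > 0" and q: "q > 0" and K: "K > 0"
    and exp_le: "\<And>a. a \<ge> \<alpha> \<Longrightarrow> exp (T * a) \<le> K * (p + q * cosh (T * a))"
begin

text \<open>The value \<open>\<phi> (\<i> * a)\<close>, as a real number.\<close>

definition C :: "real \<Rightarrow> real" where "C a = p + q * cosh (T * a)"
definition w :: "real \<Rightarrow> real" where "w a = 2 * a / C a"
definition \<phi> :: "complex \<Rightarrow> complex" where "\<phi> z = of_real p + of_real q * cos (of_real T * z)"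
text \<open>
  The quotient \<open>(\<phi> (\<i> * a) - \<phi> z) / (z\<^sup>2 + a\<^sup>2)\<close>, written so that it is visibly entire in \<open>z\<close> and jointly
  continuous.
\<close>

definition S :: "complex \<Rightarrow> real \<Rightarrow> complex" where
  "S z a = of_real (q * T\<^sup>2 / 2) * (csinc (of_real (T / 2) * (z - \<i> * of_real a)) * csinc (of_real (T / 2) * (z + \<i> * of_real a)))"
definition approximant :: "nat \<Rightarrow> complex \<Rightarrow> complex" where
  "approximant n z = integral {\<alpha>..real n} (\<lambda>a. of_real (w a) * S z a) - of_real (2 * ln (real n))"
definition interpolant :: "complex \<Rightarrow> complex" where
  "interpolant z = lim (\<lambda>n. approximant n z)"

lemma C_pos: "a \<ge> \<alpha> \<Longrightarrow> C a > 0"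
  using exp_le[of a] K by (metis C_def exp_gt_zero less_le_trans zero_less_mult_pos)

lemma w_bounds: "a \<ge> \<alpha> \<Longrightarrow> 0 \<le> w a" "a \<ge> \<alpha> \<Longrightarrow> w a \<le> 2 * a * K * exp (- T * a)"
proof -
  assume a: "a \<ge> \<alpha>"
  have a0: "a \<ge> 0" using a \<alpha> by simp
  show "0 \<le> w a" using C_pos[OF a] a0 by (simp add: w_def)
  have "1 \<le> K * C a * exp (- T * a)"
    using exp_le[OF a] by (simp add: C_def exp_minus field_simps)
  then have "1 / C a \<le> K * exp (- T * a)"
    using C_pos[OF a] by (simp add: field_simps)
  then have "2 * a * (1 / C a) \<le> 2 * a * (K * exp (- T * a))" using a0 by (intro mult_left_mono) auto
  then show "w a \<le> 2 * a * K * exp (- T * a)" by (simp add: w_def)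
qed

lemma continuous_w: "continuous_on {\<alpha>..b} w"
  unfolding w_def[abs_def] C_def
  by (intro continuous_intros) (use C_pos in \<open>auto simp: C_def less_imp_neq[symmetric]\<close>)

lemma w_measurable [measurable]: "w \<in> borel_measurable borel"
proof -
  have "C \<in> borel_measurable borel"
    unfolding C_def[abs_def] by (intro borel_measurable_continuous_onI continuous_intros)
  then show ?thesis unfolding w_def[abs_def] by measurable
qed

text \<open>
  \<open>cosh (T * a) - cos (T * z)\<close> is \<open>cos (\<i> * T * a) - cos (T * z)\<close>, a product of two sines.
\<close>

lemma S_eq:
  assumes "z\<^sup>2 + of_real (a\<^sup>2) \<noteq> 0"
  shows "S z a = (of_real (C a) - \<phi> z) / (z\<^sup>2 + of_real (a\<^sup>2))"
proof -
  define u where "u = of_real (T / 2) * (z - \<i> * of_real a)"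
  define v where "v = of_real (T / 2) * (z + \<i> * of_real a)"
  have prod: "(z - \<i> * of_real a) * (z + \<i> * of_real a) = z\<^sup>2 + of_real (a\<^sup>2)"
    by (simp add: power2_eq_square algebra_simps)
  have uv: "u * v = of_real (T\<^sup>2 / 4) * (z\<^sup>2 + of_real (a\<^sup>2))"
    unfolding prod[symmetric] by (simp add: u_def v_def power2_eq_square)
  have nz: "u \<noteq> 0" "v \<noteq> 0"
    using uv assms T by auto
  have cosh: "complex_of_real (cosh (T * a)) = cos (\<i> * of_real (T * a))"
  proof -
    have e: "\<i> * (\<i> * of_real (T * a)) = complex_of_real (- (T * a))" by (simp add: complex_eq_iff)
    show ?thesis unfolding cos_exp_eq e of_real_minus[symmetric] exp_of_real cosh_def by (simp add: add.commute)
  qed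
  have "of_real (C a) - \<phi> z = of_real q * (cos (\<i> * of_real (T * a)) - cos (of_real T * z))"
    unfolding cosh[symmetric] by (simp add: C_def \<phi>_def algebra_simps)
  also have "cos (\<i> * of_real (T * a)) - cos (of_real T * z) = 2 * sin v * sin u"
  proof -
    have "v = (\<i> * of_real (T * a) + of_real T * z) / 2" "u = (of_real T * z - \<i> * of_real (T * a)) / 2"
      by (simp_all add: u_def v_def algebra_simps)
    then show ?thesis by (simp only: cos_diff_cos)
  qed
  finally have num: "of_real (C a) - \<phi> z = of_real q * (2 * sin v * sin u)" .
  have "S z a = of_real (q * T\<^sup>2 / 2) * (sin u / u * (sin v / v))"
    using nz by (simp add: S_def csinc_def u_def v_def)
  also have "\<dots> = of_real (q * T\<^sup>2 / 2) * (sin u * sin v) / (u * v)" by simp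
  also have "\<dots> = (of_real (C a) - \<phi> z) / (z\<^sup>2 + of_real (a\<^sup>2))"
  proof -
    define W where "W = z\<^sup>2 + of_real (a\<^sup>2)"
    have "W \<noteq> 0" using assms by (simp add: W_def)
    then show ?thesis unfolding uv num W_def[symmetric] using T by (simp add: field_simps)
  qed
  finally show ?thesis .
qed

lemma norm_S_le: "a \<ge> 0 \<Longrightarrow> norm (S z a) \<le> q * T\<^sup>2 / 2 * exp (T * (\<bar>Im z\<bar> + a))"
proof -
  assume a: "a \<ge> 0"
  have "norm (S z a) = (q * T\<^sup>2 / 2) * (norm (csinc (of_real (T / 2) * (z - \<i> * of_real a))) *
      norm (csinc (of_real (T / 2) * (z + \<i> * of_real a))))"
    unfolding S_def norm_mult norm_of_real using q by simp
  also have "\<dots> \<le> (q * T\<^sup>2 / 2) * (exp (T / 2 * (\<bar>Im z\<bar> + a)) * exp (T / 2 * (\<bar>Im z\<bar> + a)))"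
  proof (intro mult_left_mono mult_mono)
    have *: "norm (csinc (of_real (T / 2) * v)) \<le> exp (T / 2 * (\<bar>Im z\<bar> + a))" if "\<bar>Im v\<bar> \<le> \<bar>Im z\<bar> + a" for v
    proof -
      have "\<bar>Im (of_real (T / 2) * v)\<bar> = T / 2 * \<bar>Im v\<bar>" using T by (simp add: abs_mult)
      also have "\<dots> \<le> T / 2 * (\<bar>Im z\<bar> + a)" using T that by (intro mult_left_mono) auto
      finally show ?thesis using norm_csinc_le order_trans exp_le_cancel_iff by meson
    qed
    show "norm (csinc (of_real (T / 2) * (z - \<i> * of_real a))) \<le> exp (T / 2 * (\<bar>Im z\<bar> + a))"
      "norm (csinc (of_real (T / 2) * (z + \<i> * of_real a))) \<le> exp (T / 2 * (\<bar>Im z\<bar> + a))"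
      using a by (intro *; simp)+
  qed (use q in auto)
  also have "exp (T / 2 * (\<bar>Im z\<bar> + a)) * exp (T / 2 * (\<bar>Im z\<bar> + a)) = exp (T * (\<bar>Im z\<bar> + a))"
    unfolding exp_add[symmetric] by (rule arg_cong[of _ _ exp]) (simp add: field_simps)
  finally show ?thesis .
qed

lemma continuous_integrand: "continuous_on {\<alpha>..b} (\<lambda>a. of_real (w a) * S z a)"
  unfolding S_def
  by (intro continuous_intros continuous_w continuous_on_compose2[OF continuous_csinc(1)]) auto

text \<open>
  The integral over a compact interval depends holomorphically on \<open>z\<close>, since the derivative of the
  integrand, \<open>fx\<close>, is jointly continuous.
\<close>

lemma holomorphic_approximant: "approximant n holomorphic_on UNIV"
proof -
  define fx where "fx = (\<lambda>z a. of_real (w a) * (of_real (q * T\<^sup>2 / 2) *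
     (deriv csinc (of_real (T / 2) * (z - \<i> * of_real a)) * of_real (T / 2) * csinc (of_real (T / 2) * (z + \<i> * of_real a)) +
      csinc (of_real (T / 2) * (z - \<i> * of_real a)) * (deriv csinc (of_real (T / 2) * (z + \<i> * of_real a)) * of_real (T / 2)))))"
  have d: "((\<lambda>z. of_real (w a) * S z a) has_field_derivative fx z a) (at z)" for z a
  proof -
    have "((\<lambda>z. csinc (of_real (T / 2) * (z + b))) has_field_derivative
        deriv csinc (of_real (T / 2) * (z + b)) * of_real (T / 2)) (at z)" for b z
      by (rule DERIV_chain2[OF csinc_DERIV]) (auto intro!: derivative_eq_intros)
    note * = this[of "\<i> * of_real a"] this[of "- (\<i> * of_real a)", unfolded add_uminus_conv_diff]
    show ?thesis unfolding S_def fx_def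
      by (rule DERIV_cong[OF DERIV_cmult[OF DERIV_cmult[OF DERIV_mult[OF *(2) *(1)]]]]) (simp add: algebra_simps)
  qed
  have "(\<lambda>z. integral (cbox \<alpha> (real n)) (\<lambda>a. of_real (w a) * S z a)) holomorphic_on UNIV"
  proof (rule leibniz_rule_holomorphic[where fx = fx])
    show "((\<lambda>z. of_real (w a) * S z a) has_field_derivative fx z a) (at z within UNIV)" for z a using d by simp
    show "(\<lambda>a. of_real (w a) * S z a) integrable_on cbox \<alpha> (real n)" for z
      using continuous_integrand by (intro integrable_continuous) simp
    show "continuous_on (UNIV \<times> cbox \<alpha> (real n)) (\<lambda>(z, a). fx z a)"
      unfolding fx_def split_beta
      by (intro continuous_intros continuous_on_compose2[OF continuous_w[of "real n"]]
          continuous_on_compose2[OF continuous_csinc(1)[of UNIV]] continuous_on_compose2[OF continuous_csinc(2)[of UNIV]]) auto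
  qed simp
  then show ?thesis unfolding approximant_def[abs_def] by (auto intro!: holomorphic_intros)
qed

lemma norm_\<phi>_le: "norm (\<phi> z) \<le> \<bar>p\<bar> + q * exp (T * norm z)"
proof -
  have "norm (\<phi> z) \<le> \<bar>p\<bar> + q * norm (cos (of_real T * z))"
    unfolding \<phi>_def by (rule order_trans[OF norm_triangle_ineq]) (use q in \<open>simp add: norm_mult\<close>)
  also have "norm (cos (of_real T * z)) \<le> exp (T * norm z)"
  proof -
    have "\<bar>Im (of_real T * z)\<bar> \<le> T * norm z" using T abs_Im_le_cmod[of z] by (simp add: abs_mult)
    then show ?thesis using norm_cos_le_exp[of "of_real T * z"] by (meson exp_le_cancel_iff order_trans)
  qed
  finally show ?thesis using q by simp
qed

text \<open>
  The constant in the bound \<open>tail z / a\<^sup>2\<close> for the integrand minus \<open>2 / a\<close>: the two summands come from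
  \<open>2 * a / (z\<^sup>2 + a\<^sup>2) - 2 / a\<close> and from the term with \<open>\<phi>\<close>.
\<close>

definition tail :: "complex \<Rightarrow> real" where
  "tail z = 4 * (norm z)\<^sup>2 + 4 * K * norm (\<phi> z) / T"

lemma integrand_decay:
  assumes a: "a \<ge> \<alpha>" "a \<ge> 1" "a \<ge> 2 * norm z"
  shows "norm (of_real (w a) * S z a - of_real (2 / a)) \<le> tail z / a\<^sup>2"
proof -
  define D where "D = z\<^sup>2 + of_real (a\<^sup>2)"
  have "(2 * norm z)\<^sup>2 \<le> a\<^sup>2" using a by (intro power_mono) auto
  then have z2: "4 * (norm z)\<^sup>2 \<le> a\<^sup>2" by (simp add: power_mult_distrib)
  have "norm (complex_of_real (a\<^sup>2)) - norm (z\<^sup>2) \<le> norm D"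
    unfolding D_def by (metis add.commute norm_diff_ineq)
  then have "a\<^sup>2 - (norm z)\<^sup>2 \<le> norm D" by (simp add: norm_power)
  then have nD: "norm D \<ge> a\<^sup>2 / 2" using z2 norm_ge_zero[of D] by linarith
  have a2: "a\<^sup>2 > 0" using a by simp
  then have D0: "D \<noteq> 0" using nD by auto
  have Ca: "C a > 0" using C_pos a by simp
  have "of_real (w a) * S z a = of_real (w a) * (of_real (C a) - \<phi> z) / D"
    using S_eq[of z a] D0 by (simp add: D_def)
  also have "\<dots> = of_real (2 * a) / D - of_real (w a) * \<phi> z / D"
    using Ca by (simp add: w_def right_diff_distrib diff_divide_distrib)
  finally have "of_real (w a) * S z a - of_real (2 / a) = (of_real (2 * a) / D - of_real (2 / a)) - of_real (w a) * \<phi> z / D" by simp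
  also have "of_real (2 * a) / D - of_real (2 / a) = - (2 * z\<^sup>2) / (of_real a * D)"
    using D0 a by (simp add: D_def field_simps power2_eq_square)
  finally have "norm (of_real (w a) * S z a - of_real (2 / a)) \<le> norm (- (2 * z\<^sup>2) / (of_real a * D)) + norm (of_real (w a) * \<phi> z / D)"
    by (metis norm_triangle_ineq4)
  also have "norm (- (2 * z\<^sup>2) / (of_real a * D)) \<le> 4 * (norm z)\<^sup>2 / a\<^sup>2"
  proof -
    have "a\<^sup>2 / 2 \<le> a * norm D" using nD a by (smt (verit) mult_left_le_one_le mult_le_cancel_right1 norm_ge_zero)
    then have "2 * (norm z)\<^sup>2 / (a * norm D) \<le> 2 * (norm z)\<^sup>2 / (a\<^sup>2 / 2)"
      using a2 by (intro divide_left_mono) (auto intro: mult_pos_pos simp: D0 a, use a D0 in auto)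
    then show ?thesis using a by (simp add: norm_divide norm_mult norm_power)
  qed
  also have "norm (of_real (w a) * \<phi> z / D) \<le> (4 * K * norm (\<phi> z) / T) / a\<^sup>2"
  proof -
    have "exp (- T * a) \<le> 1 / (T * a)"
    proof -
      have "T * a > 0" using T a by simp
      moreover have "T * a \<le> exp (T * a)" using exp_ge_add_one_self[of "T * a"] by linarith
      ultimately have "inverse (exp (T * a)) \<le> inverse (T * a)" by (rule le_imp_inverse_le[rotated])
      then show ?thesis by (simp add: exp_minus inverse_eq_divide)
    qed
    then have "2 * a * K * exp (- T * a) \<le> 2 * a * K * (1 / (T * a))" using a K by (intro mult_left_mono) auto
    also have "\<dots> = 2 * K / T" using a T by simp
    finally have wa: "w a \<le> 2 * K / T" using w_bounds(2)[of a] a by simp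
    have "norm (of_real (w a) * \<phi> z / D) = w a * norm (\<phi> z) / norm D"
      using w_bounds(1)[of a] a by (simp add: norm_divide norm_mult)
    also have "\<dots> \<le> (2 * K / T * norm (\<phi> z)) / (a\<^sup>2 / 2)"
      using wa nD a2 K T w_bounds(1)[of a] a by (intro frac_le mult_right_mono) auto
    finally show ?thesis by (simp add: mult_ac)
  qed
  finally show ?thesis by (simp add: tail_def add_divide_distrib)
qed

lemma tail_nonneg: "tail z \<ge> 0" using K T by (simp add: tail_def)

lemma approximant_diff:
  assumes n: "real n \<ge> \<alpha>" "n \<ge> 1" "real n \<ge> 2 * norm z" and nm: "n \<le> m"
  shows "norm (approximant m z - approximant n z) \<le> tail z / real n"
proof -
  have nm': "real n \<le> real m" using nm by simp
  let ?f = "\<lambda>a. of_real (w a) * S z a"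
  have int: "?f integrable_on {\<alpha>..real m}" using continuous_integrand by (intro integrable_continuous_interval)
  have split: "integral {\<alpha>..real m} ?f = integral {\<alpha>..real n} ?f + integral {real n..real m} ?f"
    using Henstock_Kurzweil_Integration.integral_combine[OF n(1) nm' int] by simp
  have int2: "?f integrable_on {real n..real m}"
    by (rule integrable_on_subinterval[OF int]) (use n in auto)
  have lnint: "((\<lambda>a. complex_of_real (2 / a)) has_integral (of_real (2 * ln (real m)) - of_real (2 * ln (real n)))) {real n..real m}"
    by (rule fundamental_theorem_of_calculus[OF nm'])
       (use n in \<open>auto intro!: derivative_eq_intros has_vector_derivative_of_real simp: has_real_derivative_iff_has_vector_derivative[symmetric]\<close>)
  have "approximant m z - approximant n z = integral {real n..real m} (\<lambda>a. ?f a - complex_of_real (2 / a))"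
    using int2 lnint by (subst integral_diff) (auto simp: approximant_def split integral_unique has_integral_integrable)
  also have "norm \<dots> \<le> integral {real n..real m} (\<lambda>a. tail z / a\<^sup>2)"
  proof (rule integral_norm_bound_integral)
    show "(\<lambda>a. ?f a - complex_of_real (2 / a)) integrable_on {real n..real m}"
      using int2 lnint by (intro integrable_diff) (auto simp: has_integral_integrable)
    show "(\<lambda>a. tail z / a\<^sup>2) integrable_on {real n..real m}"
      using n by (intro integrable_continuous_interval continuous_intros) auto
    show "norm (?f a - complex_of_real (2 / a)) \<le> tail z / a\<^sup>2" if "a \<in> {real n..real m}" for a
      using that n by (intro integrand_decay) auto
  qed
  also have "\<dots> = - tail z / real m - - tail z / real n"
    by (intro integral_unique fundamental_theorem_of_calculus[OF nm'])
       (use n in \<open>auto intro!: derivative_eq_intros simp: has_real_derivative_iff_has_vector_derivative[symmetric] power2_eq_square\<close>)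
  also have "\<dots> \<le> tail z / real n" using tail_nonneg[of z] by simp
  finally show ?thesis .
qed

text \<open>
  By the decay of the integrand the approximants form a Cauchy sequence, with an error bound that is
  uniform on compact sets and explicit enough for the exponential type.
\<close>

lemma approximant_tendsto: "(\<lambda>n. approximant n z) \<longlonglongrightarrow> interpolant z"
  and approximant_error: "real n \<ge> \<alpha> \<Longrightarrow> n \<ge> 1 \<Longrightarrow> real n \<ge> 2 * norm z \<Longrightarrow>
    norm (interpolant z - approximant n z) \<le> tail z / real n"
proof -
  have "Cauchy (\<lambda>n. approximant n z)"
  proof (rule CauchyI')
    fix e :: real assume e: "e > 0"
    define M where "M = nat \<lceil>\<alpha> + 2 * norm z + tail z / e\<rceil> + 1"
    have t: "tail z / e \<ge> 0" using tail_nonneg[of z] e by simp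
    have M: "real M \<ge> \<alpha>" "real M \<ge> 2 * norm z" "real M > tail z / e" "M \<ge> 1"
    proof -
      have "real M \<ge> \<alpha> + 2 * norm z + tail z / e + 1" unfolding M_def by linarith
      then show "real M \<ge> \<alpha>" "real M \<ge> 2 * norm z" "real M > tail z / e"
        using t \<alpha> norm_ge_zero[of z] by linarith+
    qed (simp add: M_def)
    show "\<exists>M. \<forall>m\<ge>M. \<forall>n>m. dist (approximant m z) (approximant n z) < e"
    proof (intro exI[of _ M] allI impI)
      fix m n assume mn: "m \<ge> M" "n > m"
      have m: "real m \<ge> real M" using mn by simp
      have "dist (approximant m z) (approximant n z) \<le> tail z / real m"
        unfolding dist_norm norm_minus_commute[of "approximant m z"]
        by (rule approximant_diff) (use m M mn in auto)
      also have "\<dots> < e"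
      proof -
        have "tail z / e < real m" using M(3) m by linarith
        moreover have "real m > 0" using M(4) mn by simp
        ultimately show ?thesis using e by (simp add: field_simps)
      qed
      finally show "dist (approximant m z) (approximant n z) < e" .
    qed
  qed
  then show lim: "(\<lambda>n. approximant n z) \<longlonglongrightarrow> interpolant z"
    unfolding interpolant_def by (simp add: Cauchy_convergent convergent_LIMSEQ_iff[symmetric])
  assume n: "real n \<ge> \<alpha>" "n \<ge> 1" "real n \<ge> 2 * norm z"
  show "norm (interpolant z - approximant n z) \<le> tail z / real n"
  proof (rule tendsto_upperbound)
    show "(\<lambda>m. norm (approximant m z - approximant n z)) \<longlonglongrightarrow> norm (interpolant z - approximant n z)"
      by (intro tendsto_intros lim)
    show "\<forall>\<^sub>F m in sequentially. norm (approximant m z - approximant n z) \<le> tail z / real n"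
      using eventually_ge_at_top[of n] by eventually_elim (rule approximant_diff[OF n])
  qed simp
qed

lemma tail_le:
  assumes "norm z \<le> R"
  shows "tail z \<le> 4 * R\<^sup>2 + 4 * K * (\<bar>p\<bar> + q * exp (T * R)) / T"
proof -
  have "norm (\<phi> z) \<le> \<bar>p\<bar> + q * exp (T * norm z)" by (rule norm_\<phi>_le)
  also have "\<dots> \<le> \<bar>p\<bar> + q * exp (T * R)" using assms q T by simp
  finally show ?thesis unfolding tail_def using assms K T
    by (intro add_mono mult_left_mono divide_right_mono power_mono) auto
qed

lemma holomorphic_interpolant: "interpolant holomorphic_on UNIV"
proof (rule holomorphic_uniform_sequence[where f = approximant])
  fix z0 :: complex
  define R where "R = norm z0 + 1"
  have R: "norm z \<le> R" if "z \<in> cball z0 1" for z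
    using that norm_triangle_sub[of z z0] by (simp add: R_def dist_norm norm_minus_commute)
  define B where "B = 4 * R\<^sup>2 + 4 * K * (\<bar>p\<bar> + q * exp (T * R)) / T"
  have "uniform_limit (cball z0 1) approximant interpolant sequentially"
  proof (rule uniform_limitI)
    fix e :: real assume e: "e > 0"
    have "(\<lambda>n. B / real n) \<longlonglongrightarrow> 0" by real_asymp
    then have "\<forall>\<^sub>F n in sequentially. B / real n < e" using e by (rule order_tendstoD(2))
    moreover have "\<forall>\<^sub>F n in sequentially. n \<ge> nat \<lceil>\<alpha> + 2 * R\<rceil> + 1" by (rule eventually_ge_at_top)
    ultimately show "\<forall>\<^sub>F n in sequentially. \<forall>z\<in>cball z0 1. dist (approximant n z) (interpolant z) < e"
    proof eventually_elim
      case (elim n)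
      show ?case
      proof
        fix z assume z: "z \<in> cball z0 1"
        have R0: "R \<ge> 0" by (simp add: R_def)
        have n: "real n \<ge> \<alpha> + 2 * R" "n \<ge> 1" using elim(2) by linarith+
        have "norm (interpolant z - approximant n z) \<le> tail z / real n"
          by (rule approximant_error) (use n R[OF z] R0 \<alpha> in auto)
        also have "\<dots> \<le> B / real n" unfolding B_def by (intro divide_right_mono tail_le R z) simp
        finally show "dist (approximant n z) (interpolant z) < e"
          using elim(1) by (simp add: dist_norm norm_minus_commute)
      qed
    qed
  qed
  then show "\<exists>d>0. cball z0 d \<subseteq> UNIV \<and> uniform_limit (cball z0 d) approximant interpolant sequentially"
    by (intro exI[of _ 1]) auto
qed (auto intro: holomorphic_approximant)

lemma norm_approximant_le:
  assumes n: "real n \<ge> \<alpha>" "n \<ge> 1"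
  shows "norm (approximant n z) \<le> (K * q * T\<^sup>2 + 2) * (real n)\<^sup>2 * exp (T * norm z)"
proof -
  define B where "B = K * q * T\<^sup>2 * real n * exp (T * norm z)"
  have B0: "B \<ge> 0" using K q by (simp add: B_def)
  have "norm (integral {\<alpha>..real n} (\<lambda>a. of_real (w a) * S z a)) \<le> integral {\<alpha>..real n} (\<lambda>a. B)"
  proof (rule integral_norm_bound_integral)
    show "(\<lambda>a. of_real (w a) * S z a) integrable_on {\<alpha>..real n}"
      by (intro integrable_continuous_interval continuous_integrand)
    show "(\<lambda>a. B) integrable_on {\<alpha>..real n}" by (intro integrable_continuous_interval continuous_intros)
    fix a assume "a \<in> {\<alpha>..real n}"
    then have a: "\<alpha> \<le> a" "a \<le> real n" "a \<ge> 0" using \<alpha> by auto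
    have "norm (of_real (w a) * S z a) = w a * norm (S z a)"
      using w_bounds(1)[OF a(1)] by (simp add: norm_mult)
    also have "\<dots> \<le> (2 * a * K * exp (- T * a)) * (q * T\<^sup>2 / 2 * exp (T * (\<bar>Im z\<bar> + a)))"
      using a K by (intro mult_mono w_bounds norm_S_le) auto
    also have "\<dots> = K * q * T\<^sup>2 * a * (exp (- T * a) * exp (T * (\<bar>Im z\<bar> + a)))" by simp
    also have "exp (- T * a) * exp (T * (\<bar>Im z\<bar> + a)) = exp (T * \<bar>Im z\<bar>)"
      unfolding exp_add[symmetric] by (rule arg_cong[of _ _ exp]) (simp add: algebra_simps)
    also have "K * q * T\<^sup>2 * a * exp (T * \<bar>Im z\<bar>) \<le> B"
      unfolding B_def using K q T a abs_Im_le_cmod[of z] by (intro mult_mono) auto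
    finally show "norm (of_real (w a) * S z a) \<le> B" .
  qed
  also have "integral {\<alpha>..real n} (\<lambda>a. B) = B * (real n - \<alpha>)" using n by simp
  also have "B * (real n - \<alpha>) \<le> B * real n" using B0 \<alpha> by (intro mult_left_mono) auto
  also have "\<dots> = K * q * T\<^sup>2 * (real n)\<^sup>2 * exp (T * norm z)" by (simp add: B_def power2_eq_square)
  finally have 1: "norm (integral {\<alpha>..real n} (\<lambda>a. of_real (w a) * S z a)) \<le> K * q * T\<^sup>2 * (real n)\<^sup>2 * exp (T * norm z)"
    by simp
  have "2 * ln (real n) \<le> 2 * (real n)\<^sup>2 * exp (T * norm z)"
  proof -
    have "ln (real n) \<le> real n" using n ln_le_minus_one[of "real n"] by simp
    also have "real n \<le> (real n)\<^sup>2 * 1" using n by (simp add: power2_eq_square)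
    also have "\<dots> \<le> (real n)\<^sup>2 * exp (T * norm z)" using T by (intro mult_left_mono) auto
    finally show ?thesis by simp
  qed
  moreover have "ln (real n) \<ge> 0" using n by simp
  ultimately have 2: "norm (complex_of_real (2 * ln (real n))) \<le> 2 * (real n)\<^sup>2 * exp (T * norm z)"
    unfolding norm_of_real by simp
  have "norm (approximant n z) \<le> K * q * T\<^sup>2 * (real n)\<^sup>2 * exp (T * norm z) + 2 * (real n)\<^sup>2 * exp (T * norm z)"
    unfolding approximant_def by (rule order_trans[OF norm_triangle_ineq4 add_mono[OF 1 2]])
  then show ?thesis by (simp add: algebra_simps)
qed

text \<open>
  Compare with the approximant for an \<open>n\<close> of the order of \<open>1 + norm z\<close>. Both that approximant and the error
  are bounded by a multiple of \<open>n\<^sup>2 * exp (T * norm z)\<close>, and the polynomial factor is absorbed by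
  \<open>exp (\<epsilon> * norm z)\<close>.
\<close>

lemma entire_exp_type_interpolant: "entire_exp_type T interpolant"
  unfolding entire_exp_type_def
proof (intro conjI allI impI holomorphic_interpolant)
  fix \<epsilon> :: real assume \<epsilon>: "\<epsilon> > 0"
  define M where "M = (K * q * T\<^sup>2 + 2) + (4 + 4 * K * (\<bar>p\<bar> + q) / T)"
  have M: "M > 0" unfolding M_def using K q T by (intro add_pos_pos add_nonneg_pos add_pos_nonneg) auto
  define A where "A = M * (\<alpha> + 3)\<^sup>2 * (1 + 2 / \<epsilon>)\<^sup>2"
  have "norm (interpolant z) \<le> A * exp ((T + \<epsilon>) * norm z)" for z
  proof -
    define r where "r = norm z"
    define E where "E = exp (T * r)"
    have r0: "r \<ge> 0" by (simp add: r_def)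
    have E1: "E \<ge> 1" using T r0 by (simp add: E_def)
    define n where "n = nat \<lceil>\<alpha> + 2 * r\<rceil> + 1"
    have n: "real n \<ge> \<alpha>" "n \<ge> 1" "real n \<ge> 2 * r" "real n \<le> (\<alpha> + 3) * (1 + r)"
    proof -
      have c: "real n \<ge> \<alpha> + 2 * r" "real n \<le> \<alpha> + 2 * r + 2"
        using \<alpha> r0 unfolding n_def by linarith+
      then show "real n \<ge> \<alpha>" "real n \<ge> 2 * r" using \<alpha> r0 by linarith+
      have "\<alpha> * r \<ge> 0" using \<alpha> r0 by simp
      then show "real n \<le> (\<alpha> + 3) * (1 + r)" using c(2) r0 by (simp add: algebra_simps)
    qed (simp add: n_def)
    have n1: "real n \<ge> 1" using n(2) by simp
    have "norm (interpolant z) \<le> norm (approximant n z) + norm (interpolant z - approximant n z)"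
      by (metis add.commute diff_add_cancel norm_triangle_ineq)
    also have "norm (approximant n z) \<le> (K * q * T\<^sup>2 + 2) * (real n)\<^sup>2 * E"
      using norm_approximant_le[OF n(1,2), of z] by (simp add: E_def r_def)
    also have "norm (interpolant z - approximant n z) \<le> (4 + 4 * K * (\<bar>p\<bar> + q) / T) * (real n)\<^sup>2 * E"
    proof -
      have "norm (interpolant z - approximant n z) \<le> tail z / real n"
        by (rule approximant_error) (use n in \<open>auto simp: r_def\<close>)
      also have "\<dots> \<le> tail z / 1" using n1 tail_nonneg[of z] by (intro divide_left_mono) auto
      also have "\<dots> \<le> 4 * r\<^sup>2 + 4 * K * (\<bar>p\<bar> + q * E) / T"
        using tail_le[of z r] by (simp add: r_def E_def)
      also have "\<dots> \<le> 4 * ((real n)\<^sup>2 * E) + 4 * K * (\<bar>p\<bar> + q) / T * ((real n)\<^sup>2 * E)"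
      proof (rule add_mono)
        have "r\<^sup>2 \<le> (real n)\<^sup>2" using n(3) r0 by (intro power_mono) auto
        also have "(real n)\<^sup>2 = (real n)\<^sup>2 * 1" by simp
        also have "\<dots> \<le> (real n)\<^sup>2 * E" using E1 by (intro mult_left_mono) auto
        finally show "4 * r\<^sup>2 \<le> 4 * ((real n)\<^sup>2 * E)" by simp
        have "\<bar>p\<bar> * 1 \<le> \<bar>p\<bar> * E" using E1 by (intro mult_left_mono) auto
        then have "\<bar>p\<bar> + q * E \<le> (\<bar>p\<bar> + q) * (1 * E)" by (simp add: algebra_simps)
        also have "\<dots> \<le> (\<bar>p\<bar> + q) * ((real n)\<^sup>2 * E)"
          using n1 E1 q by (intro mult_left_mono mult_right_mono) (auto simp: one_le_power)
        finally have "4 * K / T * (\<bar>p\<bar> + q * E) \<le> 4 * K / T * ((\<bar>p\<bar> + q) * ((real n)\<^sup>2 * E))"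
          using K T by (intro mult_left_mono) auto
        then show "4 * K * (\<bar>p\<bar> + q * E) / T \<le> 4 * K * (\<bar>p\<bar> + q) / T * ((real n)\<^sup>2 * E)" by simp
      qed
      finally show ?thesis by (simp add: algebra_simps)
    qed
    finally have "norm (interpolant z) \<le> M * (real n)\<^sup>2 * E" by (simp add: M_def algebra_simps)
    also have "\<dots> \<le> M * ((\<alpha> + 3)\<^sup>2 * ((1 + 2 / \<epsilon>)\<^sup>2 * exp (\<epsilon> * r))) * E"
    proof (intro mult_right_mono mult_left_mono)
      have "1 + r \<le> (1 + 2 / \<epsilon>) * exp (\<epsilon> / 2 * r)"
      proof -
        have "1 \<le> exp (\<epsilon> / 2 * r)" using \<epsilon> r0 by simp
        moreover have "r \<le> 2 / \<epsilon> * exp (\<epsilon> / 2 * r)"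
          using exp_ge_add_one_self[of "\<epsilon> / 2 * r"] \<epsilon> by (simp add: field_simps)
        ultimately have "1 + r \<le> exp (\<epsilon> / 2 * r) + 2 / \<epsilon> * exp (\<epsilon> / 2 * r)" by (rule add_mono)
        then show ?thesis by (simp only: distrib_right mult_1)
      qed
      then have "(1 + r)\<^sup>2 \<le> ((1 + 2 / \<epsilon>) * exp (\<epsilon> / 2 * r))\<^sup>2" using r0 by (intro power_mono) auto
      also have "\<dots> = (1 + 2 / \<epsilon>)\<^sup>2 * exp (\<epsilon> * r)"
        by (simp add: power_mult_distrib flip: exp_double)
      finally have "(\<alpha> + 3)\<^sup>2 * (1 + r)\<^sup>2 \<le> (\<alpha> + 3)\<^sup>2 * ((1 + 2 / \<epsilon>)\<^sup>2 * exp (\<epsilon> * r))" by (intro mult_left_mono) auto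
      moreover have "(real n)\<^sup>2 \<le> ((\<alpha> + 3) * (1 + r))\<^sup>2" using n(4) by (intro power_mono) auto
      ultimately show "(real n)\<^sup>2 \<le> (\<alpha> + 3)\<^sup>2 * ((1 + 2 / \<epsilon>)\<^sup>2 * exp (\<epsilon> * r))"
        by (simp add: power_mult_distrib)
    qed (use M E1 in auto)
    also have "\<dots> = A * exp ((T + \<epsilon>) * r)" by (simp add: A_def E_def distrib_right exp_add)
    finally show ?thesis by (simp add: r_def)
  qed
  moreover have "A > 0" unfolding A_def using M \<alpha> \<epsilon> by (intro mult_pos_pos zero_less_power add_nonneg_pos add_pos_pos) auto
  ultimately show "\<exists>C>0. \<forall>z. norm (interpolant z) \<le> C * exp ((T + \<epsilon>) * norm z)" by blast
qed

text \<open>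
  The weight decays like \<open>a * exp (- T * a)\<close>, so only \<open>2 * a / (x\<^sup>2 + a\<^sup>2)\<close> has to be bounded: by \<open>1 / \<bar>x\<bar>\<close> for \<open>x \<noteq> 0\<close>,
  and by \<open>2 / \<alpha>\<close> for \<open>x = 0\<close>, where \<open>\<alpha> > 0\<close>.
\<close>

lemma integrable_kernel:
  assumes x: "x\<^sup>2 + \<alpha>\<^sup>2 \<noteq> 0"
  shows "integrable lborel (\<lambda>a. indicator {\<alpha><..} a * (w a / (x\<^sup>2 + a\<^sup>2)))"
proof -
  obtain D where D: "\<And>a. a > \<alpha> \<Longrightarrow> 2 * a / (x\<^sup>2 + a\<^sup>2) \<le> D"
  proof (cases "x = 0")
    case True
    then have a: "\<alpha> > 0" using x \<alpha> by (cases "\<alpha> = 0") auto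
    show thesis
    proof (rule that[of "2 / \<alpha>"])
      fix a assume "a > \<alpha>"
      then show "2 * a / (x\<^sup>2 + a\<^sup>2) \<le> 2 / \<alpha>" using True a by (simp add: power2_eq_square field_simps)
    qed
  next
    case False
    show thesis
    proof (rule that[of "1 / \<bar>x\<bar>"])
      fix a assume "a > \<alpha>"
      have "0 \<le> (\<bar>x\<bar> - a)\<^sup>2" by simp
      then have "2 * a * \<bar>x\<bar> \<le> x\<^sup>2 + a\<^sup>2" by (simp add: power2_diff algebra_simps)
      moreover have "x\<^sup>2 + a\<^sup>2 > 0" using False by (simp add: add_pos_nonneg)
      ultimately show "2 * a / (x\<^sup>2 + a\<^sup>2) \<le> 1 / \<bar>x\<bar>" using False by (simp add: field_simps)
    qed
  qed
  show ?thesis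
  proof (rule Bochner_Integration.integrable_bound)
    show "integrable lborel (\<lambda>a. (D * K) * (indicator {\<alpha><..} a * exp (- T * a)))"
      using has_bochner_integral_exp_tail[OF T, of \<alpha>] by (intro integrable_mult_right) (simp add: has_bochner_integral_iff)
    show "AE a in lborel. norm (indicator {\<alpha><..} a * (w a / (x\<^sup>2 + a\<^sup>2))) \<le> norm ((D * K) * (indicator {\<alpha><..} a * exp (- T * a)))"
    proof (rule AE_I2)
      fix a
      show "norm (indicator {\<alpha><..} a * (w a / (x\<^sup>2 + a\<^sup>2))) \<le> norm ((D * K) * (indicator {\<alpha><..} a * exp (- T * a)))"
      proof (cases "a > \<alpha>")
        case True
        then have a: "a \<ge> \<alpha>" "a > 0" using \<alpha> by auto
        have "w a / (x\<^sup>2 + a\<^sup>2) \<le> 2 * a * K * exp (- T * a) / (x\<^sup>2 + a\<^sup>2)"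
          by (intro divide_right_mono w_bounds a) auto
        also have "\<dots> = (2 * a / (x\<^sup>2 + a\<^sup>2)) * (K * exp (- T * a))" by simp
        also have "\<dots> \<le> D * (K * exp (- T * a))" using D[OF True] K by (intro mult_right_mono) auto
        finally show ?thesis using True w_bounds(1)[OF a(1)] by (simp add: mult.assoc)
      qed simp
    qed
  qed measurable
qed

text \<open>
  Away from the singularity the integrand splits into \<open>2 * a / (x\<^sup>2 + a\<^sup>2)\<close>, with the antiderivative
  \<open>ln (x\<^sup>2 + a\<^sup>2)\<close>, and the term with \<open>\<phi>\<close>. At the upper end \<open>ln (x\<^sup>2 + n\<^sup>2) - 2 * ln n\<close> tends to \<open>0\<close>.
\<close>

lemma interpolant_of_real:
  assumes x: "x\<^sup>2 + \<alpha>\<^sup>2 \<noteq> 0"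
  shows "interpolant (of_real x) = of_real (- ln (x\<^sup>2 + \<alpha>\<^sup>2) - (p + q * cos (T * x)) * log_kernel w \<alpha> x)"
proof -
  define \<psi> where "\<psi> = p + q * cos (T * x)"
  have \<phi>x: "\<phi> (of_real x) = of_real \<psi>"
    by (simp add: \<phi>_def \<psi>_def cos_of_real flip: of_real_mult)
  have pos: "x\<^sup>2 + a\<^sup>2 > 0" if "a \<ge> \<alpha>" for a
  proof -
    have "\<alpha>\<^sup>2 \<le> a\<^sup>2" using that \<alpha> by (intro power_mono) auto
    moreover have "x\<^sup>2 + \<alpha>\<^sup>2 > 0" using x by (simp add: order_less_le)
    ultimately show ?thesis by linarith
  qed
  have ker_cont: "continuous_on {\<alpha>..b} (\<lambda>a. w a / (x\<^sup>2 + a\<^sup>2))" for b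
    by (intro continuous_intros continuous_w) (use pos in force)
  define I where "I = (\<lambda>n::nat. integral {\<alpha>..real n} (\<lambda>a. w a / (x\<^sup>2 + a\<^sup>2)))"
  have I_lim: "I \<longlonglongrightarrow> log_kernel w \<alpha> x"
  proof -
    have "(\<lambda>n. LINT a|lborel. indicator {\<alpha>..real n} a *\<^sub>R (w a / (x\<^sup>2 + a\<^sup>2))) \<longlonglongrightarrow>
        (LINT a|lborel. indicator {\<alpha><..} a * (w a / (x\<^sup>2 + a\<^sup>2)))"
    proof (rule integral_dominated_convergence)
      show "integrable lborel (\<lambda>a. indicator {\<alpha><..} a * (w a / (x\<^sup>2 + a\<^sup>2)))" by (rule integrable_kernel[OF x])
      show "AE a in lborel. (\<lambda>n. indicator {\<alpha>..real n} a *\<^sub>R (w a / (x\<^sup>2 + a\<^sup>2))) \<longlonglongrightarrow> indicator {\<alpha><..} a * (w a / (x\<^sup>2 + a\<^sup>2))"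
        using AE_lborel_singleton[of \<alpha>]
      proof eventually_elim
        case (elim a)
        have "\<forall>\<^sub>F n in sequentially. indicator {\<alpha>..real n} a *\<^sub>R (w a / (x\<^sup>2 + a\<^sup>2)) = indicator {\<alpha><..} a * (w a / (x\<^sup>2 + a\<^sup>2))"
          using eventually_ge_at_top[of "nat \<lceil>a\<rceil>"]
        proof eventually_elim
          case (elim n)
          then have "a \<le> real n" by linarith
          then show ?case using \<open>a \<noteq> \<alpha>\<close> by (auto simp: indicator_def)
        qed
        then show ?case by (rule tendsto_eventually)
      qed
      show "AE a in lborel. norm (indicator {\<alpha>..real n} a *\<^sub>R (w a / (x\<^sup>2 + a\<^sup>2))) \<le> indicator {\<alpha><..} a * (w a / (x\<^sup>2 + a\<^sup>2))" for n
        using AE_lborel_singleton[of \<alpha>]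
        by eventually_elim (use w_bounds(1) in \<open>auto simp: indicator_def\<close>)
    qed measurable
    moreover have "(LINT a|lborel. indicator {\<alpha>..real n} a *\<^sub>R (w a / (x\<^sup>2 + a\<^sup>2))) = I n" for n
      using set_borel_integral_eq_integral(2)[OF borel_integrable_atLeastAtMost'[OF ker_cont]]
      by (simp add: I_def set_lebesgue_integral_def)
    ultimately show ?thesis by (simp add: log_kernel_def)
  qed
  have appr: "approximant n (of_real x) = of_real (ln (x\<^sup>2 + (real n)\<^sup>2) - 2 * ln (real n) - ln (x\<^sup>2 + \<alpha>\<^sup>2) - \<psi> * I n)"
    if n: "real n \<ge> \<alpha>" for n
  proof -
    have 1: "((\<lambda>a. 2 * a / (x\<^sup>2 + a\<^sup>2)) has_integral (ln (x\<^sup>2 + (real n)\<^sup>2) - ln (x\<^sup>2 + \<alpha>\<^sup>2))) {\<alpha>..real n}"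
      by (rule fundamental_theorem_of_calculus[OF n])
         (use pos in \<open>auto intro!: derivative_eq_intros simp: has_real_derivative_iff_has_vector_derivative[symmetric]\<close>)
    have 2: "((\<lambda>a. w a / (x\<^sup>2 + a\<^sup>2)) has_integral I n) {\<alpha>..real n}"
      unfolding I_def by (intro integrable_integral integrable_continuous_interval ker_cont)
    have 3: "((\<lambda>a. complex_of_real (2 * a / (x\<^sup>2 + a\<^sup>2) - \<psi> * (w a / (x\<^sup>2 + a\<^sup>2)))) has_integral
        of_real (ln (x\<^sup>2 + (real n)\<^sup>2) - ln (x\<^sup>2 + \<alpha>\<^sup>2) - \<psi> * I n)) {\<alpha>..real n}"
      using has_integral_linear[OF has_integral_diff[OF 1 has_integral_mult_right[OF 2, of \<psi>]] bounded_linear_of_real]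
      unfolding o_def .
    have "of_real (w a) * S (of_real x) a = complex_of_real (2 * a / (x\<^sup>2 + a\<^sup>2) - \<psi> * (w a / (x\<^sup>2 + a\<^sup>2)))"
      if "a \<in> {\<alpha>..real n}" for a
    proof -
      have a: "a \<ge> \<alpha>" using that by simp
      have eq: "(complex_of_real x)\<^sup>2 + of_real (a\<^sup>2) = of_real (x\<^sup>2 + a\<^sup>2)" by simp
      have "S (of_real x) a = of_real ((C a - \<psi>) / (x\<^sup>2 + a\<^sup>2))"
        using S_eq[of "of_real x" a] pos[OF a] unfolding eq \<phi>x of_real_eq_0_iff
        by (simp only: of_real_diff of_real_divide)
      then have "of_real (w a) * S (of_real x) a = complex_of_real (w a * ((C a - \<psi>) / (x\<^sup>2 + a\<^sup>2)))"
        by (simp only: of_real_mult)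
      also have "w a * ((C a - \<psi>) / (x\<^sup>2 + a\<^sup>2)) = 2 * a / (x\<^sup>2 + a\<^sup>2) - \<psi> * (w a / (x\<^sup>2 + a\<^sup>2))"
      proof -
        have "w a * C a = 2 * a" using C_pos[OF a] by (simp add: w_def)
        then show ?thesis by (simp add: right_diff_distrib diff_divide_distrib mult.commute)
      qed
      finally show ?thesis .
    qed
    then have "((\<lambda>a. of_real (w a) * S (of_real x) a) has_integral
        of_real (ln (x\<^sup>2 + (real n)\<^sup>2) - ln (x\<^sup>2 + \<alpha>\<^sup>2) - \<psi> * I n)) {\<alpha>..real n}"
      using 3 by (subst has_integral_cong) auto
    then show ?thesis unfolding approximant_def
      by (simp add: integral_unique)
  qed
  have "(\<lambda>n. complex_of_real (ln (x\<^sup>2 + (real n)\<^sup>2) - 2 * ln (real n) - ln (x\<^sup>2 + \<alpha>\<^sup>2) - \<psi> * I n)) \<longlonglongrightarrow>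
      of_real (0 - ln (x\<^sup>2 + \<alpha>\<^sup>2) - \<psi> * log_kernel w \<alpha> x)"
  proof (intro tendsto_intros I_lim)
    show "(\<lambda>n. ln (x\<^sup>2 + (real n)\<^sup>2) - 2 * ln (real n)) \<longlonglongrightarrow> 0" by real_asymp
  qed
  moreover have "\<forall>\<^sub>F n in sequentially. of_real (ln (x\<^sup>2 + (real n)\<^sup>2) - 2 * ln (real n) - ln (x\<^sup>2 + \<alpha>\<^sup>2) - \<psi> * I n) = approximant n (of_real x)"
    using eventually_ge_at_top[of "nat \<lceil>\<alpha>\<rceil>"]
  proof eventually_elim
    case (elim n)
    then have "real n \<ge> \<alpha>" by linarith
    from appr[OF this] show ?case by simp
  qed
  ultimately have "(\<lambda>n. approximant n (of_real x)) \<longlonglongrightarrow> of_real (0 - ln (x\<^sup>2 + \<alpha>\<^sup>2) - \<psi> * log_kernel w \<alpha> x)"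
    by (rule Lim_transform_eventually)
  with approximant_tendsto have "interpolant (of_real x) = of_real (0 - ln (x\<^sup>2 + \<alpha>\<^sup>2) - \<psi> * log_kernel w \<alpha> x)"
    by (rule LIMSEQ_unique)
  then show ?thesis by (simp add: \<psi>_def)
qed

lemma interpolant_real: "real_on_reals interpolant"
  unfolding real_on_reals_def
proof
  fix x :: real
  show "interpolant (of_real x) \<in> \<real>"
  proof (cases "x\<^sup>2 + \<alpha>\<^sup>2 = 0")
    case True
    then have x0: "x = 0" by (simp add: sum_power2_eq_zero_iff)
    \<comment> \<open>For \<open>x = \<alpha> = 0\<close> the formula for the values on the real line is not available; use continuity.\<close>
    have "isCont interpolant 0"
      using holomorphic_on_imp_continuous_on[OF holomorphic_interpolant] by (simp add: continuous_on_eq_continuous_at)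
    moreover have "(\<lambda>n. complex_of_real (1 / real (Suc n))) \<longlonglongrightarrow> of_real 0"
      by (intro tendsto_of_real) real_asymp
    ultimately have lim: "(\<lambda>n. interpolant (complex_of_real (1 / real (Suc n)))) \<longlonglongrightarrow> interpolant 0"
      by (intro isCont_tendsto_compose[of 0 interpolant]) auto
    have "interpolant (complex_of_real (1 / real (Suc n))) \<in> \<real>" for n
    proof -
      have "(1 / real (Suc n))\<^sup>2 + \<alpha>\<^sup>2 \<noteq> 0" by (simp add: sum_power2_eq_zero_iff del: of_nat_Suc)
      from interpolant_of_real[OF this] show ?thesis by (simp only: Reals_of_real)
    qed
    then have "interpolant 0 \<in> \<real>"
      by (rule closed_sequentially[OF closed_complex_Reals _ lim])
    then show ?thesis by (simp add: x0)
  next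
    case False
    from interpolant_of_real[OF this] show ?thesis by (simp only: Reals_of_real)
  qed
qed

text \<open>
  By Tonelli's theorem this is the total mass of the kernel \<open>log_kernel w \<alpha>\<close>.
\<close>

lemma kernel_mass_finite: "(\<integral>\<^sup>+a. ennreal (indicator {\<alpha><..} a * (w a * (pi / a))) \<partial>lborel) < \<infinity>"
proof -
  have "(\<integral>\<^sup>+a. ennreal (indicator {\<alpha><..} a * (w a * (pi / a))) \<partial>lborel) \<le>
      (\<integral>\<^sup>+a. ennreal (2 * pi * K * (indicator {\<alpha><..} a * exp (- T * a))) \<partial>lborel)"
  proof (intro nn_integral_mono ennreal_leI)
    fix a
    show "indicator {\<alpha><..} a * (w a * (pi / a)) \<le> 2 * pi * K * (indicator {\<alpha><..} a * exp (- T * a))"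
    proof (cases "a > \<alpha>")
      case True
      then have a: "a \<ge> \<alpha>" "a > 0" using \<alpha> by auto
      have "w a * (pi / a) \<le> 2 * a * K * exp (- T * a) * (pi / a)"
        using a by (intro mult_right_mono w_bounds) auto
      then show ?thesis using True a by (simp add: mult_ac)
    qed simp
  qed
  also have "\<dots> = ennreal (2 * pi * K * (exp (- T * \<alpha>) / T))"
  proof -
    have hb: "has_bochner_integral lborel (\<lambda>a. 2 * pi * K * (indicator {\<alpha><..} a * exp (- T * a))) (2 * pi * K * (exp (- T * \<alpha>) / T))"
      by (intro has_bochner_integral_mult_right has_bochner_integral_exp_tail T)
    then show ?thesis using K by (subst nn_integral_eq_integral) (auto simp: has_bochner_integral_iff)
  qed
  also have "\<dots> < \<infinity>" by simp
  finally show ?thesis .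
qed

lemmas kernel_integrable = integrable_log_kernel[OF w_measurable \<alpha> w_bounds(1)[OF less_imp_le] kernel_mass_finite]
lemmas kernel_weighted_integral = has_bochner_integral_weighted_log_kernel[OF w_measurable \<alpha> w_bounds(1)[OF less_imp_le] kernel_mass_finite]
lemmas kernel_nonneg = log_kernel_nonneg[of \<alpha> w, OF w_bounds(1)[OF less_imp_le]]

end

section \<open>The extremal functions\<close>

text \<open>
  The sign \<open>s = 1\<close> stands for \<open>cos\<^sup>2\<close> and minorants, \<open>s = - 1\<close> for \<open>- sin\<^sup>2\<close> and majorants. In both cases
  \<open>\<phi> z = (s + cos (2 * pi * z)) / 2\<close>, and this is its value at \<open>\<i> * a\<close>.
\<close>

lemma half_cosh_eq:
  fixes a s :: real
  assumes s: "s * s = 1"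
  shows "s / 2 + 1/2 * cosh (2 * pi * a) = (1 + s * exp (- 2 * pi * a))\<^sup>2 / (4 * exp (- 2 * pi * a))"
proof -
  define e where "e = exp (- 2 * pi * a)"
  have e: "e > 0" "exp (2 * pi * a) = 1 / e" by (simp_all add: e_def exp_minus inverse_eq_divide)
  have "cosh (2 * pi * a) = (1 / e + e) / 2" unfolding cosh_def e(2)[symmetric] by (simp add: e_def)
  moreover have "(1 + s * e)\<^sup>2 = 1 + 2 * s * e + e * e"
  proof -
    have "(1 + s * e)\<^sup>2 = 1 + 2 * s * e + (s * s) * (e * e)" by (simp add: power2_eq_square algebra_simps)
    then show ?thesis unfolding s by simp
  qed
  ultimately show ?thesis unfolding e_def[symmetric] using e(1) by (simp add: field_simps)
qed

lemma log_interpolation_one_sided: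
  fixes \<alpha> s :: real
  assumes s: "s = 1 \<or> s = - 1 \<and> \<alpha> > 0" and \<alpha>: "\<alpha> \<ge> 0"
  obtains K where "log_interpolation \<alpha> (2 * pi) (s / 2) (1/2) K"
proof -
  define d where "d = (if s = 1 then 1 else 1 - exp (- 2 * pi * \<alpha>))"
  have d: "d > 0" using s by (auto simp: d_def)
  have ss: "s * s = 1" using s by auto
  have "log_interpolation \<alpha> (2 * pi) (s / 2) (1/2) (4 / d\<^sup>2)"
  proof
    fix a :: real assume a: "a \<ge> \<alpha>"
    define e where "e = exp (- 2 * pi * a)"
    have e: "e > 0" "exp (2 * pi * a) = 1 / e" by (simp_all add: e_def exp_minus inverse_eq_divide)
    have "e \<le> exp (- 2 * pi * \<alpha>)" using a by (simp add: e_def)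
    then have "d \<le> 1 + s * e" using s e(1) by (auto simp: d_def)
    then have "d\<^sup>2 \<le> (1 + s * e)\<^sup>2" using d by (intro power_mono) auto
    then have "d\<^sup>2 / d\<^sup>2 / e \<le> (1 + s * e)\<^sup>2 / d\<^sup>2 / e" using e(1) by (intro divide_right_mono) auto
    then show "exp (2 * pi * a) \<le> 4 / d\<^sup>2 * (s / 2 + 1/2 * cosh (2 * pi * a))"
      unfolding half_cosh_eq[OF ss] e(2) e_def[symmetric] using d by simp
  qed (use \<alpha> d in auto)
  then show thesis by (rule that)
qed

lemma log_interpolation_cos:
  assumes "\<alpha> \<ge> 0"
  shows "log_interpolation \<alpha> pi 0 1 2"
proof
  fix a :: real
  have "exp (pi * a) / 2 \<le> cosh (pi * a)" by (simp add: cosh_def)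
  then show "exp (pi * a) \<le> 2 * (0 + 1 * cosh (pi * a))" by simp
qed (use assms in auto)

lemma nn_integral_log_primitive:
  fixes \<alpha> s :: real
  assumes s: "s = 1 \<or> s = - 1 \<and> \<alpha> > 0" and \<alpha>: "\<alpha> \<ge> 0"
  shows "(\<integral>\<^sup>+a. ennreal (indicator {\<alpha><..} a * (4 * pi * exp (- 2 * pi * a) / (1 + s * exp (- 2 * pi * a)))) \<partial>lborel)
    = ennreal (2 * s * ln (1 + s * exp (- 2 * pi * \<alpha>)))"
    and "2 * s * ln (1 + s * exp (- 2 * pi * \<alpha>)) \<ge> 0"
proof -
  have s2: "s * s = 1" using s by auto
  have pos: "1 + s * exp (- 2 * pi * a) > 0" if "a \<ge> \<alpha>" for a
  proof -
    have "s = -1 \<Longrightarrow> exp (- 2 * pi * a) < 1" using that s by auto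
    then show ?thesis using s by (auto simp: add_pos_pos)
  qed
  have lim: "((\<lambda>a. - 2 * s * ln (1 + s * exp (- 2 * pi * a))) \<longlongrightarrow> - 2 * s * ln (1 + s * 0)) at_top"
  proof (intro tendsto_intros)
    show "((\<lambda>a. exp (- 2 * pi * a)) \<longlongrightarrow> 0) at_top" by real_asymp
  qed auto
  have "(\<integral>\<^sup>+a. ennreal (4 * pi * exp (- 2 * pi * a) / (1 + s * exp (- 2 * pi * a))) * indicator {\<alpha>..} a \<partial>lborel)
     = ennreal (- 2 * s * ln (1 + s * 0) - (- 2 * s * ln (1 + s * exp (- 2 * pi * \<alpha>))))"
  proof (rule nn_integral_FTC_atLeast[OF _ _ _ lim])
    fix a assume a: "\<alpha> \<le> a"
    have "((\<lambda>a. - 2 * s * ln (1 + s * exp (- 2 * pi * a))) has_real_derivative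
        - 2 * s * ((s * (exp (- 2 * pi * a) * (- 2 * pi))) / (1 + s * exp (- 2 * pi * a)))) (at a)"
      using pos[OF a] by (auto intro!: derivative_eq_intros)
    moreover
    have "- 2 * s * ((s * (exp (- 2 * pi * a) * (- 2 * pi))) / (1 + s * exp (- 2 * pi * a)))
      = (s * s) * (4 * pi * exp (- 2 * pi * a) / (1 + s * exp (- 2 * pi * a)))" by simp
    then have "- 2 * s * ((s * (exp (- 2 * pi * a) * (- 2 * pi))) / (1 + s * exp (- 2 * pi * a)))
      = 4 * pi * exp (- 2 * pi * a) / (1 + s * exp (- 2 * pi * a))" unfolding s2 mult_1 .
    ultimately show "((\<lambda>a. - 2 * s * ln (1 + s * exp (- 2 * pi * a))) has_real_derivative
        4 * pi * exp (- 2 * pi * a) / (1 + s * exp (- 2 * pi * a))) (at a)"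
      by (simp only:)
    show "0 \<le> 4 * pi * exp (- 2 * pi * a) / (1 + s * exp (- 2 * pi * a))" using pos[OF a] by simp
  qed measurable
  also have "(\<integral>\<^sup>+a. ennreal (4 * pi * exp (- 2 * pi * a) / (1 + s * exp (- 2 * pi * a))) * indicator {\<alpha>..} a \<partial>lborel)
    = (\<integral>\<^sup>+a. ennreal (indicator {\<alpha><..} a * (4 * pi * exp (- 2 * pi * a) / (1 + s * exp (- 2 * pi * a)))) \<partial>lborel)"
    by (intro nn_integral_cong_AE eventually_mono[OF AE_lborel_singleton[of \<alpha>]]) (auto simp: indicator_def)
  finally show "(\<integral>\<^sup>+a. ennreal (indicator {\<alpha><..} a * (4 * pi * exp (- 2 * pi * a) / (1 + s * exp (- 2 * pi * a)))) \<partial>lborel)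
    = ennreal (2 * s * ln (1 + s * exp (- 2 * pi * \<alpha>)))" by simp
  show "2 * s * ln (1 + s * exp (- 2 * pi * \<alpha>)) \<ge> 0"
    using s pos[of \<alpha>] by (auto simp: ln_ge_zero mult_nonneg_nonneg)
qed

lemma tau_eq: "x\<^sup>2 + \<alpha>\<^sup>2 \<noteq> 0 \<Longrightarrow> tau \<alpha> x = ereal (- ln (x\<^sup>2 + \<alpha>\<^sup>2))"
  by (simp add: tau_def)

lemma real_of_ereal_tau: "x\<^sup>2 + \<alpha>\<^sup>2 \<noteq> 0 \<Longrightarrow> real_of_ereal (tau \<alpha> x) = - ln (x\<^sup>2 + \<alpha>\<^sup>2)"
  by (simp add: tau_def)

lemma AE_sum_squares_nonzero: "AE x in lborel. x\<^sup>2 + \<alpha>\<^sup>2 \<noteq> (0::real)"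
  using AE_lborel_singleton[of 0] by eventually_elim (simp add: sum_power2_eq_zero_iff)

lemma tau_measurable: "(\<lambda>x. real_of_ereal (tau \<alpha> x)) \<in> borel_measurable borel"
proof -
  have "(\<lambda>x. real_of_ereal (tau \<alpha> x)) = (\<lambda>x. if x\<^sup>2 + \<alpha>\<^sup>2 = 0 then 0 else - ln (x\<^sup>2 + \<alpha>\<^sup>2))"
    by (auto simp: tau_def)
  then show ?thesis by simp
qed

lemma tau_isCont: "x\<^sup>2 + \<alpha>\<^sup>2 \<noteq> 0 \<Longrightarrow> isCont (\<lambda>x. real_of_ereal (tau \<alpha> x)) x"
proof -
  assume x: "x\<^sup>2 + \<alpha>\<^sup>2 \<noteq> 0"
  have "\<forall>\<^sub>F y in nhds x. y\<^sup>2 + \<alpha>\<^sup>2 \<noteq> 0"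
    by (rule tendsto_imp_eventually_ne[OF _ x]) (intro tendsto_intros filterlim_ident)
  then have "\<forall>\<^sub>F y in nhds x. real_of_ereal (tau \<alpha> y) = - ln (y\<^sup>2 + \<alpha>\<^sup>2)"
    by eventually_elim (rule real_of_ereal_tau)
  moreover have "isCont (\<lambda>x. - ln (x\<^sup>2 + \<alpha>\<^sup>2)) x" using x by (intro continuous_intros) auto
  ultimately show ?thesis using isCont_cong by fast
qed

lemma L1_dist_tau:
  "L1_dist (tau \<alpha>) F = (\<integral>\<^sup>+x. ennreal (norm (of_real (real_of_ereal (tau \<alpha> x)) - F (of_real x))) \<partial>lborel)"
  unfolding L1_dist_def
  by (rule nn_integral_cong_AE, rule eventually_mono[OF AE_sum_squares_nonzero[of \<alpha>]]) (simp add: tau_def)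

lemma L1_dist_tau_real:
  assumes "real_on_reals F"
  shows "L1_dist (tau \<alpha>) F = (\<integral>\<^sup>+x. ennreal \<bar>real_of_ereal (tau \<alpha> x) - Re (F (of_real x))\<bar> \<partial>lborel)"
proof -
  have "F (of_real x) = of_real (Re (F (of_real x)))" for x
    using assms by (simp add: real_on_reals_def of_real_Re)
  then have "norm (of_real (real_of_ereal (tau \<alpha> x)) - F (of_real x)) = \<bar>real_of_ereal (tau \<alpha> x) - Re (F (of_real x))\<bar>" for x
    by (metis norm_of_real of_real_diff)
  then show ?thesis unfolding L1_dist_tau by simp
qed

lemma half_integer_nonzero: "(real_of_int n + 1/2)\<^sup>2 + \<alpha>\<^sup>2 \<noteq> 0"
proof -
  have "real_of_int n + 1/2 \<noteq> 0"
  proof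
    assume "real_of_int n + 1/2 = 0"
    then have "real_of_int (2 * n + 1) = of_int 0" by simp
    then have "2 * n + 1 = 0" by (simp only: of_int_eq_iff)
    then show False by presburger
  qed
  then show ?thesis by (simp add: sum_power2_eq_zero_iff)
qed

text \<open>
  If every competitor that is at least as good as \<open>F\<close> is equal to \<open>F\<close>, then \<open>F\<close> is the unique minimizer.
\<close>

lemma ex1_minimizer:
  fixes d :: "'a \<Rightarrow> 'b::linorder"
  assumes "P F" and "\<And>H. P H \<Longrightarrow> d H \<le> d F \<Longrightarrow> H = F"
  shows "(\<exists>!F. P F \<and> (\<forall>H. P H \<longrightarrow> d F \<le> d H)) \<and> (\<forall>G. P G \<and> (\<forall>H. P H \<longrightarrow> d G \<le> d H) \<longrightarrow> G = F)"
proof -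
  have "d F \<le> d H" if "P H" for H
    using linear[of "d F" "d H"] assms(2)[OF that] by auto
  then have F: "P F \<and> (\<forall>H. P H \<longrightarrow> d F \<le> d H)" using assms(1) by simp
  have eq: "G = F" if G: "P G \<and> (\<forall>H. P H \<longrightarrow> d G \<le> d H)" for G
    by (rule assms(2)) (simp_all add: G assms(1))
  show ?thesis
  proof (intro conjI allI impI)
    show "\<exists>!F. P F \<and> (\<forall>H. P H \<longrightarrow> d F \<le> d H)" by (rule ex1I[where a = F]) (rule F, rule eq)
  qed (rule eq)
qed

text \<open>
  With the Cauchy density \<open>1 / (x\<^sup>2 + a\<^sup>2)\<close> integrated against \<open>(1 + s * cos (2 * pi * x)) / 2\<close>, the weighted mass at \<open>a\<close>
  simplifies to \<open>4 * pi * e / (1 + s * e)\<close> with \<open>e = exp (- 2 * pi * a)\<close>, which has an elementary primitive.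
\<close>

lemma one_sided_log_extremal:
  fixes \<alpha> s :: real
  assumes s: "s = 1 \<or> s = - 1 \<and> \<alpha> > 0" and \<alpha>: "\<alpha> \<ge> 0"
  obtains F where "entire_exp_type (2 * pi) F" "real_on_reals F"
    "\<And>x. x\<^sup>2 + \<alpha>\<^sup>2 \<noteq> 0 \<Longrightarrow> s * (real_of_ereal (tau \<alpha> x) - Re (F (of_real x))) \<ge> 0"
    "\<And>x. x\<^sup>2 + \<alpha>\<^sup>2 \<noteq> 0 \<Longrightarrow> 1 + s * cos (2 * pi * x) = 0 \<Longrightarrow> Re (F (of_real x)) = real_of_ereal (tau \<alpha> x)"
    "\<And>H. entire_exp_type (2 * pi) H \<Longrightarrow> real_on_reals H \<Longrightarrow>
      (\<And>x. x\<^sup>2 + \<alpha>\<^sup>2 \<noteq> 0 \<Longrightarrow> s * (real_of_ereal (tau \<alpha> x) - Re (H (of_real x))) \<ge> 0) \<Longrightarrow>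
      L1_dist (tau \<alpha>) H \<le> L1_dist (tau \<alpha>) F \<Longrightarrow> H = F"
    "has_bochner_integral lborel (\<lambda>x. s * (real_of_ereal (tau \<alpha> x) - Re (F (of_real x))))
      (2 * s * ln (1 + s * exp (- 2 * pi * \<alpha>)))"
proof -
  have ss: "s * s = 1" using s by auto
  obtain K where LI: "log_interpolation \<alpha> (2 * pi) (s / 2) (1/2) K"
    using log_interpolation_one_sided[OF s \<alpha>] by blast
  interpret log_interpolation \<alpha> "2 * pi" "s / 2" "1/2" K by (rule LI)
  define J where "J = log_kernel w \<alpha>"
  have J0: "J x \<ge> 0" for x by (simp add: J_def kernel_nonneg)
  have Jm: "J \<in> borel_measurable borel" unfolding J_def by (rule log_kernel_measurable[OF w_measurable])
  define v where "v = (\<lambda>x. (1 + s * cos (2 * pi * x)) / 2)"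
  have v0: "v x \<ge> 0" for x
  proof -
    have "\<bar>s * cos (2 * pi * x)\<bar> \<le> 1" using s by (auto simp: abs_mult)
    then have "0 \<le> 1 + s * cos (2 * pi * x)" by (simp only: abs_le_iff) linarith
    then show ?thesis by (simp add: v_def)
  qed
  \<comment> \<open>The shift \<open>(1 - s) / 4\<close> is \<open>0\<close> for \<open>cos\<^sup>2\<close> and \<open>1/2\<close> for \<open>sin\<^sup>2\<close>.\<close>
  have v_sq: "v x = (cos (pi * (x - (1 - s) / 4)))\<^sup>2" for x
  proof -
    have c: "cos (2 * pi * x) = 2 * (cos (pi * x))\<^sup>2 - 1" "cos (2 * pi * x) = 1 - 2 * (sin (pi * x))\<^sup>2"
      using cos_double_cos[of "pi * x"] cos_double_sin[of "pi * x"] by (simp_all add: mult.assoc)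
    from s show ?thesis
    proof
      assume "s = 1" then show ?thesis unfolding v_def c(1) by simp
    next
      assume "s = - 1 \<and> \<alpha> > 0"
      then have s1: "s = - 1" by simp
      have "cos (pi * (x - (1 - s) / 4)) = sin (pi * x)" unfolding s1 right_diff_distrib cos_diff by simp
      then show ?thesis unfolding v_def c(2) s1 by simp
    qed
  qed
  have Fx: "interpolant (of_real x) = of_real (- ln (x\<^sup>2 + \<alpha>\<^sup>2) - s * (v x * J x))" if "x\<^sup>2 + \<alpha>\<^sup>2 \<noteq> 0" for x
  proof -
    have "s / 2 + 1/2 * cos (2 * pi * x) = s * v x"
      using ss by (simp add: v_def distrib_left mult.assoc[symmetric])
    then show ?thesis using interpolant_of_real[OF that] by (simp add: J_def mult.assoc)
  qed
  have diff: "s * (real_of_ereal (tau \<alpha> x) - Re (interpolant (of_real x))) = v x * J x" if "x\<^sup>2 + \<alpha>\<^sup>2 \<noteq> 0" for x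
    unfolding Fx[OF that] real_of_ereal_tau[OF that] using ss by (simp add: mult.assoc[symmetric])
  show thesis
  proof (rule that[of interpolant])
    show "entire_exp_type (2 * pi) interpolant" by (rule entire_exp_type_interpolant)
    show "real_on_reals interpolant" by (rule interpolant_real)
    show "s * (real_of_ereal (tau \<alpha> x) - Re (interpolant (of_real x))) \<ge> 0" if "x\<^sup>2 + \<alpha>\<^sup>2 \<noteq> 0" for x
      unfolding diff[OF that] using v0 J0 by simp
    show "Re (interpolant (of_real x)) = real_of_ereal (tau \<alpha> x)" if "x\<^sup>2 + \<alpha>\<^sup>2 \<noteq> 0" "1 + s * cos (2 * pi * x) = 0" for x
      unfolding Fx[OF that(1)] real_of_ereal_tau[OF that(1)] using that(2) by (simp add: v_def)
    show "H = interpolant"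
      if H: "entire_exp_type (2 * pi) H" "real_on_reals H"
        and Hs: "\<And>x. x\<^sup>2 + \<alpha>\<^sup>2 \<noteq> 0 \<Longrightarrow> s * (real_of_ereal (tau \<alpha> x) - Re (H (of_real x))) \<ge> 0"
        and le: "L1_dist (tau \<alpha>) H \<le> L1_dist (tau \<alpha>) interpolant" for H
    proof (rule one_sided_extremal_unique[where s = s and \<beta> = "(1 - s) / 4" and J = J and g = "\<lambda>x. real_of_ereal (tau \<alpha> x)",
          OF entire_exp_type_interpolant interpolant_real H])
      show "s = 1 \<or> s = - 1" using s by auto
      show "integrable lborel J" unfolding J_def by (rule kernel_integrable)
      show "AE x in lborel. s * (real_of_ereal (tau \<alpha> x) - Re (interpolant (of_real x))) = (cos (pi * (x - (1 - s) / 4)))\<^sup>2 * J x"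
        using AE_sum_squares_nonzero[of \<alpha>] by eventually_elim (simp add: diff v_sq)
      show "AE x in lborel. 0 \<le> s * (real_of_ereal (tau \<alpha> x) - Re (H (of_real x)))"
        using AE_sum_squares_nonzero[of \<alpha>] by eventually_elim (rule Hs)
      show "(\<integral>\<^sup>+x. ennreal \<bar>real_of_ereal (tau \<alpha> x) - Re (H (of_real x))\<bar> \<partial>lborel)
          \<le> (\<integral>\<^sup>+x. ennreal \<bar>real_of_ereal (tau \<alpha> x) - Re (interpolant (of_real x))\<bar> \<partial>lborel)"
        using le by (simp add: L1_dist_tau_real interpolant_real H)
    qed (auto simp: tau_measurable J0)
    have wV: "indicator {\<alpha><..} a * (w a * (pi / (2 * a) * (1 + s * exp (- 2 * pi * a)))) =
        indicator {\<alpha><..} a * (4 * pi * exp (- 2 * pi * a) / (1 + s * exp (- 2 * pi * a)))" for a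
    proof (cases "a > \<alpha>")
      case True
      then have a: "a > 0" using \<alpha> by simp
      define e where "e = exp (- 2 * pi * a)"
      have e: "e > 0" "e < 1" using a by (simp_all add: e_def)
      have nz: "1 + s * e \<noteq> 0" using s e by auto
      have "w a * (pi / (2 * a) * (1 + s * e)) = 2 * a / ((1 + s * e)\<^sup>2 / (4 * e)) * (pi / (2 * a) * (1 + s * e))"
        unfolding w_def C_def half_cosh_eq[OF ss] e_def[symmetric] ..
      also have "\<dots> = 4 * pi * e / (1 + s * e)"
      proof -
        have "2 * a / (d\<^sup>2 / (4 * e)) * (pi / (2 * a) * d) = 4 * pi * e / d" if "d \<noteq> 0" for d
          using a e(1) that by (simp add: power2_eq_square)
        from this[OF nz] show ?thesis .
      qed
      finally show ?thesis by (simp add: e_def)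
    qed simp
    have "has_bochner_integral lborel (\<lambda>x. v x * J x) (2 * s * ln (1 + s * exp (- 2 * pi * \<alpha>)))"
      unfolding J_def
    proof (rule kernel_weighted_integral)
      show "v \<in> borel_measurable borel" unfolding v_def by measurable
      show "has_bochner_integral lborel (\<lambda>x. v x / (x\<^sup>2 + a\<^sup>2)) (pi / (2 * a) * (1 + s * exp (- 2 * pi * a)))" if "\<alpha> < a" for a
        unfolding v_def by (rule has_bochner_integral_one_plus_cos_cauchy_density) (use that \<alpha> in simp)
      show "(\<integral>\<^sup>+a. ennreal (indicator {\<alpha><..} a * (w a * (pi / (2 * a) * (1 + s * exp (- 2 * pi * a))))) \<partial>lborel) =
          ennreal (2 * s * ln (1 + s * exp (- 2 * pi * \<alpha>)))"
        unfolding wV by (rule nn_integral_log_primitive[OF s \<alpha>])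
      show "0 \<le> 2 * s * ln (1 + s * exp (- 2 * pi * \<alpha>))" by (rule nn_integral_log_primitive[OF s \<alpha>])
    qed (simp_all add: v0)
    moreover have "AE x in lborel. v x * J x = s * (real_of_ereal (tau \<alpha> x) - Re (interpolant (of_real x)))"
      using AE_sum_squares_nonzero[of \<alpha>] by eventually_elim (simp add: diff)
    moreover have "(\<lambda>x. s * (real_of_ereal (tau \<alpha> x) - Re (interpolant (of_real x)))) \<in> borel_measurable lborel"
    proof -
      have "(\<lambda>x. Re (interpolant (of_real x))) \<in> borel_measurable borel"
        by (intro borel_measurable_continuous_onI continuous_on_Re continuous_on_entire_of_real holomorphic_interpolant)
      then show ?thesis using tau_measurable[of \<alpha>] by measurable
    qed
    moreover have "(\<lambda>x. v x * J x) \<in> borel_measurable lborel" unfolding v_def using Jm by measurable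
    ultimately show "has_bochner_integral lborel (\<lambda>x. s * (real_of_ereal (tau \<alpha> x) - Re (interpolant (of_real x))))
      (2 * s * ln (1 + s * exp (- 2 * pi * \<alpha>)))"
      using has_bochner_integral_cong_AE by blast
  qed
qed

lemma extremal_minorant_tau:
  fixes \<alpha> :: real
  assumes \<alpha>: "\<alpha> \<ge> 0"
  shows "(\<exists>!l. extremal_minorant (2 * pi) (tau \<alpha>) l) \<and>
    (\<forall>l. extremal_minorant (2 * pi) (tau \<alpha>) l \<longrightarrow>
       interpolates_at l (tau \<alpha>) {of_int n + 1 / 2 |n. True} \<and>
       has_bochner_integral lborel (\<lambda>x. real_of_ereal (tau \<alpha> x) - Re (l (of_real x)))
         (2 * ln (1 + exp (- 2 * pi * \<alpha>))))"
proof -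
  obtain F where F: "entire_exp_type (2 * pi) F" "real_on_reals F"
    and le: "\<And>x. x\<^sup>2 + \<alpha>\<^sup>2 \<noteq> 0 \<Longrightarrow> 1 * (real_of_ereal (tau \<alpha> x) - Re (F (of_real x))) \<ge> 0"
    and eq: "\<And>x. x\<^sup>2 + \<alpha>\<^sup>2 \<noteq> 0 \<Longrightarrow> 1 + 1 * cos (2 * pi * x) = 0 \<Longrightarrow> Re (F (of_real x)) = real_of_ereal (tau \<alpha> x)"
    and uniq: "\<And>H. entire_exp_type (2 * pi) H \<Longrightarrow> real_on_reals H \<Longrightarrow>
      (\<And>x. x\<^sup>2 + \<alpha>\<^sup>2 \<noteq> 0 \<Longrightarrow> 1 * (real_of_ereal (tau \<alpha> x) - Re (H (of_real x))) \<ge> 0) \<Longrightarrow>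
      L1_dist (tau \<alpha>) H \<le> L1_dist (tau \<alpha>) F \<Longrightarrow> H = F"
    and int: "has_bochner_integral lborel (\<lambda>x. 1 * (real_of_ereal (tau \<alpha> x) - Re (F (of_real x))))
      (2 * 1 * ln (1 + 1 * exp (- 2 * pi * \<alpha>)))"
    using one_sided_log_extremal[of 1 \<alpha>] \<alpha> by blast
  have iff: "(ereal (Re (H (of_real x))) \<le> tau \<alpha> x) \<longleftrightarrow> (x\<^sup>2 + \<alpha>\<^sup>2 \<noteq> 0 \<longrightarrow> 1 * (real_of_ereal (tau \<alpha> x) - Re (H (of_real x))) \<ge> 0)" for H x
    by (simp add: tau_def)
  have min: "minorant (2 * pi) (tau \<alpha>) H \<longleftrightarrow> entire_exp_type (2 * pi) H \<and> real_on_reals H \<and>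
      (\<forall>x. x\<^sup>2 + \<alpha>\<^sup>2 \<noteq> 0 \<longrightarrow> 1 * (real_of_ereal (tau \<alpha> x) - Re (H (of_real x))) \<ge> 0)" for H
    unfolding minorant_def iff ..
  have "minorant (2 * pi) (tau \<alpha>) F" unfolding min using F le by blast
  moreover have "H = F" if "minorant (2 * pi) (tau \<alpha>) H" "L1_dist (tau \<alpha>) H \<le> L1_dist (tau \<alpha>) F" for H
    using that uniq unfolding min by blast
  ultimately have ex: "(\<exists>!F. extremal_minorant (2 * pi) (tau \<alpha>) F) \<and> (\<forall>G. extremal_minorant (2 * pi) (tau \<alpha>) G \<longrightarrow> G = F)"
    unfolding extremal_minorant_def by (rule ex1_minimizer)
  have "interpolates_at F (tau \<alpha>) {of_int n + 1 / 2 |n. True}"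
    unfolding interpolates_at_def
  proof
    fix x assume "x \<in> {real_of_int n + 1 / 2 |n. True}"
    then obtain n :: int where n: "x = of_int n + 1/2" by blast
    have nz: "x\<^sup>2 + \<alpha>\<^sup>2 \<noteq> 0" unfolding n by (rule half_integer_nonzero)
    have "cos (pi * x) = 0" unfolding n by (rule cos_pi_half_int)
    then have "1 + 1 * cos (2 * pi * x) = 0" using cos_double_cos[of "pi * x"] by (simp add: mult.assoc)
    from eq[OF nz this] show "F (of_real x) \<in> \<real> \<and> ereal (Re (F (of_real x))) = tau \<alpha> x"
      using F(2) nz by (simp add: real_on_reals_def tau_def)
  qed
  moreover have "has_bochner_integral lborel (\<lambda>x. real_of_ereal (tau \<alpha> x) - Re (F (of_real x)))
      (2 * ln (1 + exp (- 2 * pi * \<alpha>)))"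
    using int by simp
  ultimately show ?thesis using ex by auto
qed

lemma extremal_majorant_tau:
  fixes \<alpha> :: real
  assumes \<alpha>: "\<alpha> > 0"
  shows "(\<exists>!m. extremal_majorant (2 * pi) (tau \<alpha>) m) \<and>
    (\<forall>m. extremal_majorant (2 * pi) (tau \<alpha>) m \<longrightarrow>
       interpolates_at m (tau \<alpha>) \<int> \<and>
       has_bochner_integral lborel (\<lambda>x. Re (m (of_real x)) - real_of_ereal (tau \<alpha> x))
         (- 2 * ln (1 - exp (- 2 * pi * \<alpha>))))"
proof -
  have s: "(- 1 :: real) = 1 \<or> (- 1 :: real) = - 1 \<and> \<alpha> > 0" and \<alpha>0: "\<alpha> \<ge> 0" using \<alpha> by auto
  obtain F where F: "entire_exp_type (2 * pi) F" "real_on_reals F"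
    and le: "\<And>x. x\<^sup>2 + \<alpha>\<^sup>2 \<noteq> 0 \<Longrightarrow> - 1 * (real_of_ereal (tau \<alpha> x) - Re (F (of_real x))) \<ge> 0"
    and eq: "\<And>x. x\<^sup>2 + \<alpha>\<^sup>2 \<noteq> 0 \<Longrightarrow> 1 + - 1 * cos (2 * pi * x) = 0 \<Longrightarrow> Re (F (of_real x)) = real_of_ereal (tau \<alpha> x)"
    and uniq: "\<And>H. entire_exp_type (2 * pi) H \<Longrightarrow> real_on_reals H \<Longrightarrow>
      (\<And>x. x\<^sup>2 + \<alpha>\<^sup>2 \<noteq> 0 \<Longrightarrow> - 1 * (real_of_ereal (tau \<alpha> x) - Re (H (of_real x))) \<ge> 0) \<Longrightarrow>
      L1_dist (tau \<alpha>) H \<le> L1_dist (tau \<alpha>) F \<Longrightarrow> H = F"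
    and int: "has_bochner_integral lborel (\<lambda>x. - 1 * (real_of_ereal (tau \<alpha> x) - Re (F (of_real x))))
      (2 * - 1 * ln (1 + - 1 * exp (- 2 * pi * \<alpha>)))"
    using one_sided_log_extremal[OF s \<alpha>0] by blast
  have nz: "x\<^sup>2 + \<alpha>\<^sup>2 \<noteq> 0" for x using \<alpha> by (simp add: sum_power2_eq_zero_iff)
  have iff: "(tau \<alpha> x \<le> ereal (Re (H (of_real x)))) \<longleftrightarrow> - 1 * (real_of_ereal (tau \<alpha> x) - Re (H (of_real x))) \<ge> 0" for H x
    unfolding tau_eq[OF nz] by auto
  have maj: "majorant (2 * pi) (tau \<alpha>) H \<longleftrightarrow> entire_exp_type (2 * pi) H \<and> real_on_reals H \<and>
      (\<forall>x. - 1 * (real_of_ereal (tau \<alpha> x) - Re (H (of_real x))) \<ge> 0)" for H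
    unfolding majorant_def iff ..
  have "majorant (2 * pi) (tau \<alpha>) F" unfolding maj using F le nz by blast
  moreover have "H = F" if "majorant (2 * pi) (tau \<alpha>) H" "L1_dist (tau \<alpha>) H \<le> L1_dist (tau \<alpha>) F" for H
    using that uniq unfolding maj by blast
  ultimately have ex: "(\<exists>!F. extremal_majorant (2 * pi) (tau \<alpha>) F) \<and> (\<forall>G. extremal_majorant (2 * pi) (tau \<alpha>) G \<longrightarrow> G = F)"
    unfolding extremal_majorant_def by (rule ex1_minimizer)
  have "interpolates_at F (tau \<alpha>) \<int>"
    unfolding interpolates_at_def
  proof
    fix x :: real assume "x \<in> \<int>"
    then have "cos (2 * pi * x) = 1" by (auto elim!: Ints_cases simp: cos_one_2pi_int mult_ac)
    then have "1 + - 1 * cos (2 * pi * x) = 0" by simp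
    from eq[OF nz this] show "F (of_real x) \<in> \<real> \<and> ereal (Re (F (of_real x))) = tau \<alpha> x"
      using F(2) nz[of x] by (simp add: real_on_reals_def tau_def)
  qed
  moreover have "has_bochner_integral lborel (\<lambda>x. Re (F (of_real x)) - real_of_ereal (tau \<alpha> x))
      (- 2 * ln (1 - exp (- 2 * pi * \<alpha>)))"
    using int by simp
  ultimately show ?thesis using ex by auto
qed

text \<open>
  With \<open>\<phi> z = cos (pi * z)\<close> the weight \<open>2 * a / cosh (pi * a)\<close> cancels the factor \<open>cosh (pi * a)\<close> in the integral of
  \<open>\<bar>cos (pi * x)\<bar> / (x\<^sup>2 + a\<^sup>2)\<close>, and the distance becomes the integral of \<open>8 * arctan (exp (- pi * a))\<close> over \<open>a > \<alpha>\<close>.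
\<close>

lemma best_approximation_tau:
  fixes \<alpha> :: real
  assumes \<alpha>: "\<alpha> \<ge> 0"
  shows "(\<exists>!k. best_approximation pi (tau \<alpha>) k) \<and>
    (\<forall>k. best_approximation pi (tau \<alpha>) k \<longrightarrow>
       interpolates_at k (tau \<alpha>) {of_int n + 1 / 2 |n. True} \<and>
       real_on_reals k \<and>
       (\<forall>x::real. ereal (sgn (cos (pi * x))) * (tau \<alpha> x - ereal (Re (k (of_real x)))) \<ge> 0) \<and>
       set_integrable lborel {0<..} (best_approx_integrand \<alpha>) \<and>
       has_bochner_integral lborel
         (\<lambda>x. norm (of_real (real_of_ereal (tau \<alpha> x)) - k (of_real x)))
         (LINT l:{0<..}|lborel. best_approx_integrand \<alpha> l))"
proof -
  interpret log_interpolation \<alpha> pi 0 1 2 by (rule log_interpolation_cos[OF \<alpha>])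
  define J where "J = log_kernel w \<alpha>"
  have J0: "J x \<ge> 0" for x by (simp add: J_def kernel_nonneg)
  have Jm: "J \<in> borel_measurable borel" unfolding J_def by (rule log_kernel_measurable[OF w_measurable])
  have Fx: "interpolant (of_real x) = of_real (- ln (x\<^sup>2 + \<alpha>\<^sup>2) - cos (pi * x) * J x)" if "x\<^sup>2 + \<alpha>\<^sup>2 \<noteq> 0" for x
    using interpolant_of_real[OF that] by (simp add: J_def)
  have diff: "of_real (real_of_ereal (tau \<alpha> x)) - interpolant (of_real x) = of_real (cos (pi * x) * J x)"
    if "x\<^sup>2 + \<alpha>\<^sup>2 \<noteq> 0" for x
    unfolding Fx[OF that] real_of_ereal_tau[OF that] by simp
  have uniq: "H = interpolant" if H: "entire_exp_type pi H" and le: "L1_dist (tau \<alpha>) H \<le> L1_dist (tau \<alpha>) interpolant" for H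
  proof (rule best_approximation_unique[where J = J and g = "\<lambda>x. real_of_ereal (tau \<alpha> x)", OF entire_exp_type_interpolant H])
    show "isCont (\<lambda>x. real_of_ereal (tau \<alpha> x)) (of_int n + 1/2)" for n :: int
      by (rule tau_isCont[OF half_integer_nonzero])
    show "integrable lborel J" unfolding J_def by (rule kernel_integrable)
    show "AE x in lborel. of_real (real_of_ereal (tau \<alpha> x)) - interpolant (of_real x) = of_real (cos (pi * x) * J x)"
      using AE_sum_squares_nonzero[of \<alpha>] by eventually_elim (rule diff)
  qed (use le in \<open>auto simp: tau_measurable J0 L1_dist_tau\<close>)
  have ex: "(\<exists>!F. best_approximation pi (tau \<alpha>) F) \<and> (\<forall>G. best_approximation pi (tau \<alpha>) G \<longrightarrow> G = interpolant)"
    unfolding best_approximation_def 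
    by (rule ex1_minimizer[where P = "entire_exp_type pi" and d = "L1_dist (tau \<alpha>)", OF entire_exp_type_interpolant uniq])
  have interp: "interpolates_at interpolant (tau \<alpha>) {of_int n + 1 / 2 |n. True}"
    unfolding interpolates_at_def
  proof
    fix x assume "x \<in> {real_of_int n + 1 / 2 |n. True}"
    then obtain n :: int where n: "x = of_int n + 1/2" by blast
    have nz: "x\<^sup>2 + \<alpha>\<^sup>2 \<noteq> 0" unfolding n by (rule half_integer_nonzero)
    have "cos (pi * x) = 0" unfolding n by (rule cos_pi_half_int)
    then have "interpolant (of_real x) = of_real (- ln (x\<^sup>2 + \<alpha>\<^sup>2))" unfolding Fx[OF nz] by simp
    then show "interpolant (of_real x) \<in> \<real> \<and> ereal (Re (interpolant (of_real x))) = tau \<alpha> x"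
      by (simp only: Reals_of_real tau_eq[OF nz] Re_complex_of_real simp_thms)
  qed
  have sign: "ereal (sgn (cos (pi * x))) * (tau \<alpha> x - ereal (Re (interpolant (of_real x)))) \<ge> 0" for x
  proof (cases "x\<^sup>2 + \<alpha>\<^sup>2 = 0")
    case True
    then have "x = 0" by (simp add: sum_power2_eq_zero_iff)
    then show ?thesis using True by (simp add: tau_def)
  next
    case False
    have "sgn (cos (pi * x)) * (cos (pi * x) * J x) = \<bar>cos (pi * x)\<bar> * J x"
      by (simp only: abs_sgn[of "cos (pi * x)"] mult_ac)
    also have "\<dots> \<ge> 0" using J0[of x] by simp
    finally show ?thesis unfolding Fx[OF False] tau_eq[OF False] by simp
  qed
  have "has_bochner_integral lborel (\<lambda>x. \<bar>cos (pi * x)\<bar> * J x) (alternating_half_sum \<alpha>)"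
    unfolding J_def
  proof (rule kernel_weighted_integral)
    show "has_bochner_integral lborel (\<lambda>x. \<bar>cos (pi * x)\<bar> / (x\<^sup>2 + a\<^sup>2)) (4 / a * arctan (exp (- pi * a)) * cosh (pi * a))" if "\<alpha> < a" for a
      by (rule has_bochner_integral_abs_cos_cauchy_density) (use that \<alpha> in simp)
    have wV: "indicator {\<alpha><..} a * (w a * (4 / a * arctan (exp (- pi * a)) * cosh (pi * a))) =
       indicator {\<alpha><..} a * (8 * arctan (exp (- pi * a)))" for a
    proof (cases "a > \<alpha>")
      case True
      have "cosh (pi * a) > 0" by (rule cosh_real_pos)
      with True \<alpha> show ?thesis by (simp add: w_def C_def)
    qed simp
    show "(\<integral>\<^sup>+a. ennreal (indicator {\<alpha><..} a * (w a * (4 / a * arctan (exp (- pi * a)) * cosh (pi * a)))) \<partial>lborel) =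
        ennreal (alternating_half_sum \<alpha>)"
      unfolding wV by (rule nn_integral_arctan_exp[OF \<alpha>])
    show "0 \<le> alternating_half_sum \<alpha>" by (rule nn_integral_arctan_exp[OF \<alpha>])
  qed auto
  moreover have "AE x in lborel. \<bar>cos (pi * x)\<bar> * J x = norm (of_real (real_of_ereal (tau \<alpha> x)) - interpolant (of_real x))"
    using AE_sum_squares_nonzero[of \<alpha>]
  proof eventually_elim
    case (elim x)
    show ?case unfolding diff[OF elim] norm_of_real abs_mult using J0[of x] by simp
  qed
  moreover have "(\<lambda>x. norm (of_real (real_of_ereal (tau \<alpha> x)) - interpolant (of_real x))) \<in> borel_measurable lborel"
  proof -
    have "(\<lambda>x. interpolant (of_real x)) \<in> borel_measurable borel"
      by (rule borel_measurable_entire_of_real[OF holomorphic_interpolant])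
    then show ?thesis using tau_measurable[of \<alpha>] by measurable
  qed
  moreover have "(\<lambda>x. \<bar>cos (pi * x)\<bar> * J x) \<in> borel_measurable lborel" using Jm by measurable
  ultimately have "has_bochner_integral lborel (\<lambda>x. norm (of_real (real_of_ereal (tau \<alpha> x)) - interpolant (of_real x)))
      (alternating_half_sum \<alpha>)"
    using has_bochner_integral_cong_AE by blast
  then show ?thesis
    using ex interp sign interpolant_real best_approx_integrand_integral[OF \<alpha>] by auto
qed

theorem corollary23:
  fixes \<alpha> :: real
  assumes "\<alpha> \<ge> 0"
  shows "((\<exists>!l. extremal_minorant (2 * pi) (tau \<alpha>) l) \<and>
          (\<forall>l. extremal_minorant (2 * pi) (tau \<alpha>) l \<longrightarrow>
             interpolates_at l (tau \<alpha>) {of_int n + 1 / 2 |n. True} \<and>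
             has_bochner_integral lborel
               (\<lambda>x. real_of_ereal (tau \<alpha> x) - Re (l (of_real x)))
               (2 * ln (1 + exp (- 2 * pi * \<alpha>)))))
       \<and> (0 < \<alpha> \<longrightarrow>
          (\<exists>!m. extremal_majorant (2 * pi) (tau \<alpha>) m) \<and>
          (\<forall>m. extremal_majorant (2 * pi) (tau \<alpha>) m \<longrightarrow>
             interpolates_at m (tau \<alpha>) \<int> \<and>
             has_bochner_integral lborel
               (\<lambda>x. Re (m (of_real x)) - real_of_ereal (tau \<alpha> x))
               (- 2 * ln (1 - exp (- 2 * pi * \<alpha>)))))
       \<and> ((\<exists>!k. best_approximation pi (tau \<alpha>) k) \<and>
          (\<forall>k. best_approximation pi (tau \<alpha>) k \<longrightarrow>
             interpolates_at k (tau \<alpha>) {of_int n + 1 / 2 |n. True} \<and>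
             real_on_reals k \<and>
             (\<forall>x::real. ereal (sgn (cos (pi * x))) * (tau \<alpha> x - ereal (Re (k (of_real x)))) \<ge> 0) \<and>
             set_integrable lborel {0<..} (best_approx_integrand \<alpha>) \<and>
             has_bochner_integral lborel
               (\<lambda>x. norm (of_real (real_of_ereal (tau \<alpha> x)) - k (of_real x)))
               (LINT l:{0<..}|lborel. best_approx_integrand \<alpha> l)))"
  by (rule conjI[OF extremal_minorant_tau[OF assms] conjI[OF _ best_approximation_tau[OF assms]]])
     (rule impI, rule extremal_majorant_tau)

end
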